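(* Let $J$ be a bounded half-line Jacobi matrix, let $N_j\to\infty$ be a sequence along which the limits described in the context exist, and let $\gamma:\mathbb{R}\to\mathbb{R}$ be the associated Lyapunov exponent and $g$ the associated Herglotz function. For (Lebesgue) almost all $x\in\mathbb{R}$, we have that $$(D_{\mathrm{ap}}\gamma)(x)=-\operatorname{Re}\, g(x) .$$ In particular, $\gamma$ is approximately differentiable almost everywhere.
   Context: Approximate derivative: a Lebesgue measurable function $f:\mathbb{R}\to\mathbb{R}$ is approximately differentiable at $x\in\mathbb{R}$ if there is $d\in\mathbb{R}$ such that for all $\epsilon>0$ $$\lim_{h\to 0+}\frac{1}{2h} \left| \left\{ y\in(-h,h): \left| \frac{f(x+y)-f(x)}{y} - d \right| \ge \epsilon \right\} \right| = 0;$$ then $(D_{\mathrm{ap}}f)(x)=d$. Here $|\cdot|$ is Lebesgue measure. Setting: a Herglotz function is a holomorphic map of $\mathbb{C}^+=\{z\in\mathbb{C}:\operatorname{Im}z>0\}$ to itself. Let $J$ be a half-line Jacobi matrix on $\ell_2(\mathbb{Z}_+)$, $\mathbb{Z}_+=\{1,2,\dots\}$: $(Ju)(n)=a(n)u(n+1)+a(n-1)u(n-1)+b(n)u(n)$ (term with $u(n-1)$ omitted for $n=1$), with real coefficients satisfying $(M+1)^{-1}\le a(n)\le M+1$, $|b(n)|\le M$ for some $M>0$. Put $a(0)=1$. For $z\in\mathbb{C}^+$ let $f_\pm(n,z)$ be the solutions of $a(n)f(n+1)+a(n-1)f(n-1)+b(n)f(n)=zf(n)$ ($n\ge1$) with $f_-(0,z)=0$,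 $f_-(1,z)=1$, $f_+(0,z)=1$, $f_+(1,z)=-\langle\delta_1,(J-z)^{-1}\delta_1\rangle$. Then $f_\pm(n,z)\ne0$ for $n\ge1$ and $z\mapsto\mp f_\pm(n+1,z)/f_\pm(n,z)$ are Herglotz functions. With the logarithm satisfying $\operatorname{Im}\ln\zeta\in(0,\pi)$ for $\zeta\in\mathbb{C}^+$, put $$w_\pm^{(N)}(z)=\frac1N\sum_{n=1}^N\ln\left[\mp\frac{f_\pm(n+1,z)}{f_\pm(n,z)}\right],\qquad g_N(z)=\frac1N\sum_{n=1}^N\langle\delta_n,(J-z)^{-1}\delta_n\rangle=\int_{\mathbb{R}}\frac{d\nu_N(t)}{t-z},$$ $d\nu_N(t)=\frac1N\sum_{n=1}^N d\|E(t)\delta_n\|^2$ ($E$ the spectral resolution of $J$), and $dk_N=\frac1N\sum_{n=1}^N\delta_{\lambda_n^{(N)}}$, where $\lambda_1^{(N)},\dots,\lambda_N^{(N)}$ are the eigenvalues of the truncation of $J$ to $\ell_2(\{1,\dots,N\})$ (boundary conditions $u(0)=u(N+1)=0$). $N_j\to\infty$ is a fixed (otherwise arbitrary) sequence such that, as $j\to\infty$, $w_\pm^{(N_j)}\to w_\pm$ and $g_{N_j}\to g$ uniformly on compact subsets of $\mathbb{C}^+$ with Herglotz limits, $\nu_{N_j}$ and $dk_{N_j}$ converge in weak $*$ sense to probability measures, and $(a(1)\cdots a(N_j))^{1/N_j}\to A>0$. Write $w_+=-\gamma+i\pi k$ with $\gamma,k$ real valued on $\mathbb{C}^+$, and put $\gamma(t)=\lim_{y\to0+}\gamma(t+iy)$,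 $k(t)=\lim_{y\to0+}k(t+iy)$ for $t\in\mathbb{R}$ (these limits exist for every $t$, and $k(t)$ is increasing). $\gamma$ is called the Lyapunov exponent, and the measure $dk$ (which is also the weak $*$ limit of $dk_{N_j}$ and $\nu_{N_j}$) the density of states measure; $g(z)=\int_{\mathbb{R}}\frac{dk(t)}{t-z}$. For almost every $x\in\mathbb{R}$, $g(x)=\lim_{y\to0+}g(x+iy)$ exists. *)

theory Defs
  imports
    "HOL-Computational_Algebra.Polynomial"
    "Jordan_Normal_Form.Char_Poly"
    "HOL-Probability.Probability"
begin

subsection \<open>Approximate derivatives\<close>

text \<open>
  Lebesgue measurability of f is part of the notion. At y = 0 the difference quotient is junk,
  which affects only a null set.
\<close>

definition has_approx_derivative :: "(real \<Rightarrow> real) \<Rightarrow> real \<Rightarrow> real \<Rightarrow> bool" where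
  "has_approx_derivative f d x \<longleftrightarrow>
     f \<in> borel_measurable lebesgue \<and>
     (\<forall>\<epsilon>>0. ((\<lambda>h. 1 / (2 * h) *
         measure lebesgue {y \<in> {-h<..<h}. \<bar>(f (x + y) - f x) / y - d\<bar> \<ge> \<epsilon>}) \<longlongrightarrow> 0) (at_right 0))"

definition approx_differentiable :: "(real \<Rightarrow> real) \<Rightarrow> real \<Rightarrow> bool" where
  "approx_differentiable f x \<longleftrightarrow> (\<exists>d. has_approx_derivative f d x)"


subsection \<open>Herglotz functions and weak * convergence\<close>

abbreviation upper_half_plane :: "complex set" where
  "upper_half_plane \<equiv> {z. Im z > 0}"

definition herglotz :: "(complex \<Rightarrow> complex) \<Rightarrow> bool" where
  "herglotz F \<longleftrightarrow> F holomorphic_on upper_half_plane \<and> F ` upper_half_plane \<subseteq> upper_half_plane"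

definition compactly_converges :: "(nat \<Rightarrow> complex \<Rightarrow> complex) \<Rightarrow> (complex \<Rightarrow> complex) \<Rightarrow> bool" where
  "compactly_converges F G \<longleftrightarrow>
     (\<forall>K. compact K \<and> K \<subseteq> upper_half_plane \<longrightarrow> uniform_limit K F G sequentially)"

definition boundary_value :: "(complex \<Rightarrow> 'a::t2_space) \<Rightarrow> real \<Rightarrow> 'a" where
  "boundary_value F t = Lim (at_right 0) (\<lambda>y. F (Complex t y))"

text \<open>Measures on the line are regarded as functionals on the continuous functions vanishing at infinity.\<close>

definition weak_star_converges :: "(nat \<Rightarrow> real measure) \<Rightarrow> real measure \<Rightarrow> bool" where
  "weak_star_converges \<mu> \<mu>' \<longleftrightarrow>
     (\<forall>f :: real \<Rightarrow> real. continuous_on UNIV f \<and> (f \<longlongrightarrow> 0) at_infinity \<longrightarrow>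
        (\<lambda>j. \<integral>t. f t \<partial>\<mu> j) \<longlonglongrightarrow> (\<integral>t. f t \<partial>\<mu>'))"


subsection \<open>The space of square summable sequences on the positive integers\<close>

text \<open>
  Sequences are indexed by the positive integers; the unused value at 0 is normalised to 0, so
  that equality of functions is equality of sequences. The inner product is linear in its second
  argument.
\<close>

definition ell2 :: "(nat \<Rightarrow> complex) set" where
  "ell2 = {u. u 0 = 0 \<and> summable (\<lambda>n. (cmod (u n))\<^sup>2)}"

definition ell2_inner :: "(nat \<Rightarrow> complex) \<Rightarrow> (nat \<Rightarrow> complex) \<Rightarrow> complex" where
  "ell2_inner u v = (\<Sum>n. cnj (u n) * v n)"

definition ell2_norm :: "(nat \<Rightarrow> complex) \<Rightarrow> real" where
  "ell2_norm u = sqrt (\<Sum>n. (cmod (u n))\<^sup>2)"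

definition basis_vector :: "nat \<Rightarrow> nat \<Rightarrow> complex" where
  "basis_vector m = (\<lambda>n. if n = m then 1 else 0)"


subsection \<open>Half-line Jacobi matrices\<close>

definition bounded_jacobi :: "(nat \<Rightarrow> real) \<Rightarrow> (nat \<Rightarrow> real) \<Rightarrow> bool" where
  "bounded_jacobi a b \<longleftrightarrow>
     (\<exists>M>0. \<forall>n\<ge>1. inverse (M + 1) \<le> a n \<and> a n \<le> M + 1 \<and> \<bar>b n\<bar> \<le> M)"

definition jacobi_op :: "(nat \<Rightarrow> real) \<Rightarrow> (nat \<Rightarrow> real) \<Rightarrow> (nat \<Rightarrow> complex) \<Rightarrow> nat \<Rightarrow> complex" where
  "jacobi_op a b u n =
     (if n = 0 then 0
      else of_real (a n) * u (n + 1)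
           + (if n = 1 then 0 else of_real (a (n - 1)) * u (n - 1))
           + of_real (b n) * u n)"

definition jacobi_resolvent ::
  "(nat \<Rightarrow> real) \<Rightarrow> (nat \<Rightarrow> real) \<Rightarrow> complex \<Rightarrow> (nat \<Rightarrow> complex) \<Rightarrow> nat \<Rightarrow> complex" where
  "jacobi_resolvent a b z = inv_into ell2 (\<lambda>u n. jacobi_op a b u n - z * u n)"

definition green_diag :: "(nat \<Rightarrow> real) \<Rightarrow> (nat \<Rightarrow> real) \<Rightarrow> nat \<Rightarrow> complex \<Rightarrow> complex" where
  "green_diag a b n z =
     ell2_inner (basis_vector n) (jacobi_resolvent a b z (basis_vector n))"

definition g_avg :: "(nat \<Rightarrow> real) \<Rightarrow> (nat \<Rightarrow> real) \<Rightarrow> nat \<Rightarrow> complex \<Rightarrow> complex" where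
  "g_avg a b N z = 1 / of_nat N * (\<Sum>n=1..N. green_diag a b n z)"


subsection \<open>Solutions of the difference equation\<close>

text \<open>
  The solution with values c0 and c1 at 0 and 1; see \<open>jacobi_solution_eq\<close> below.
\<close>

fun jacobi_solution ::
  "(nat \<Rightarrow> real) \<Rightarrow> (nat \<Rightarrow> real) \<Rightarrow> complex \<Rightarrow> complex \<Rightarrow> complex \<Rightarrow> nat \<Rightarrow> complex" where
  "jacobi_solution a b z c0 c1 0 = c0"
| "jacobi_solution a b z c0 c1 (Suc 0) = c1"
| "jacobi_solution a b z c0 c1 (Suc (Suc n)) =
     ((z - of_real (b (Suc n))) * jacobi_solution a b z c0 c1 (Suc n)
       - of_real (a n) * jacobi_solution a b z c0 c1 n) / of_real (a (Suc n))"

lemma jacobi_solution_eq: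
  assumes "n \<ge> 1" and "a n \<noteq> 0" and "f = jacobi_solution a b z c0 c1"
  shows "of_real (a n) * f (n + 1) + of_real (a (n - 1)) * f (n - 1) + of_real (b n) * f n = z * f n"
  using assms by (cases n) (auto simp: field_simps)

definition f_minus :: "(nat \<Rightarrow> real) \<Rightarrow> (nat \<Rightarrow> real) \<Rightarrow> nat \<Rightarrow> complex \<Rightarrow> complex" where
  "f_minus a b n z = jacobi_solution a b z 0 1 n"

definition f_plus :: "(nat \<Rightarrow> real) \<Rightarrow> (nat \<Rightarrow> real) \<Rightarrow> nat \<Rightarrow> complex \<Rightarrow> complex" where
  "f_plus a b n z = jacobi_solution a b z 1 (- green_diag a b 1 z) n"

text \<open>On the upper half plane the imaginary part of the principal branch \<open>Ln\<close> lies in (0, pi).\<close>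

definition w_plus_avg :: "(nat \<Rightarrow> real) \<Rightarrow> (nat \<Rightarrow> real) \<Rightarrow> nat \<Rightarrow> complex \<Rightarrow> complex" where
  "w_plus_avg a b N z =
     1 / of_nat N * (\<Sum>n=1..N. Ln (- (f_plus a b (n + 1) z / f_plus a b n z)))"

definition w_minus_avg :: "(nat \<Rightarrow> real) \<Rightarrow> (nat \<Rightarrow> real) \<Rightarrow> nat \<Rightarrow> complex \<Rightarrow> complex" where
  "w_minus_avg a b N z =
     1 / of_nat N * (\<Sum>n=1..N. Ln (f_minus a b (n + 1) z / f_minus a b n z))"


subsection \<open>Spectral resolution and the averaged spectral measures\<close>

definition orthogonal_projection :: "((nat \<Rightarrow> complex) \<Rightarrow> nat \<Rightarrow> complex) \<Rightarrow> bool" where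
  "orthogonal_projection P \<longleftrightarrow>
     (\<forall>u\<in>ell2. P u \<in> ell2 \<and> P (P u) = P u) \<and>
     (\<forall>u\<in>ell2. \<forall>v\<in>ell2. P (\<lambda>n. u n + v n) = (\<lambda>n. P u n + P v n)) \<and>
     (\<forall>c. \<forall>u\<in>ell2. P (\<lambda>n. c * u n) = (\<lambda>n. c * P u n)) \<and>
     (\<forall>u\<in>ell2. \<forall>v\<in>ell2. ell2_inner (P u) v = ell2_inner u (P v))"

text \<open>
  E t is the spectral projection of J for the half-line of all s \<le> t: an increasing, strongly right
  continuous family of orthogonal projections going from 0 to the identity, with J the integral of
  t against dE(t). The last clause states this for the quadratic forms, which by polarisation
  determine the operators.
\<close>

definition spectral_resolution ::
  "(nat \<Rightarrow> real) \<Rightarrow> (nat \<Rightarrow> real) \<Rightarrow> (real \<Rightarrow> (nat \<Rightarrow> complex) \<Rightarrow> nat \<Rightarrow> complex) \<Rightarrow> bool" where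
  "spectral_resolution a b E \<longleftrightarrow>
     (\<forall>t. orthogonal_projection (E t)) \<and>
     (\<forall>s t. \<forall>u\<in>ell2. s \<le> t \<longrightarrow> E s (E t u) = E s u \<and> E t (E s u) = E s u) \<and>
     (\<forall>t. \<forall>u\<in>ell2. ((\<lambda>s. ell2_norm (\<lambda>n. E s u n - E t u n)) \<longlongrightarrow> 0) (at_right t)) \<and>
     (\<forall>u\<in>ell2. ((\<lambda>t. ell2_norm (E t u)) \<longlongrightarrow> 0) at_bot) \<and>
     (\<forall>u\<in>ell2. ((\<lambda>t. ell2_norm (\<lambda>n. E t u n - u n)) \<longlongrightarrow> 0) at_top) \<and>
     (\<forall>u\<in>ell2. integrable (interval_measure (\<lambda>t. (ell2_norm (E t u))\<^sup>2)) (\<lambda>t. t) \<and>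
        ell2_inner u (jacobi_op a b u) =
          of_real (\<integral>t. t \<partial>interval_measure (\<lambda>t. (ell2_norm (E t u))\<^sup>2)))"

definition nu_avg :: "(real \<Rightarrow> (nat \<Rightarrow> complex) \<Rightarrow> nat \<Rightarrow> complex) \<Rightarrow> nat \<Rightarrow> real measure" where
  "nu_avg E N =
     interval_measure (\<lambda>t. 1 / real N * (\<Sum>n=1..N. (ell2_norm (E t (basis_vector n)))\<^sup>2))"


subsection \<open>Eigenvalue counting measures of the truncations\<close>

text \<open>Matrix indices start at 0, so row i corresponds to the site i + 1.\<close>

definition jacobi_truncation :: "(nat \<Rightarrow> real) \<Rightarrow> (nat \<Rightarrow> real) \<Rightarrow> nat \<Rightarrow> real mat" where
  "jacobi_truncation a b N = Matrix.mat N N (\<lambda>(i, j).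
     if i = j then b (i + 1)
     else if j = i + 1 then a (i + 1)
     else if i = j + 1 then a (j + 1)
     else 0)"

text \<open>
  The eigenvalues, with multiplicity, form the multiset of roots of the characteristic polynomial;
  as the truncation is a real symmetric matrix, this multiset has size N.
\<close>

definition dk_avg :: "(nat \<Rightarrow> real) \<Rightarrow> (nat \<Rightarrow> real) \<Rightarrow> nat \<Rightarrow> real measure" where
  "dk_avg a b N =
     distr (measure_pmf (pmf_of_multiset (proots (char_poly (jacobi_truncation a b N))))) borel (\<lambda>t. t)"


subsection \<open>The Lyapunov exponent\<close>

definition lyapunov_exponent :: "(complex \<Rightarrow> complex) \<Rightarrow> real \<Rightarrow> real" where
  "lyapunov_exponent w = boundary_value (\<lambda>z. - Re (w z))"

end

theory Submission
  imports Defs "HOL-Complex_Analysis.Complex_Analysis"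
begin

text \<open>
  Two properties of \<open>w_plus\<close> on the upper half plane carry the proof: its imaginary part is
  bounded, and its derivative is \<open>g\<close>. The Lyapunov exponent is the boundary value of
  \<open>- Re w_plus\<close>, so formally its derivative is \<open>- Re g\<close>; the work consists in giving this a
  meaning at almost every boundary point.

  For the identity \<open>w_plus' = g\<close> write \<open>p\<close> and \<open>q\<close> for \<open>f_minus\<close> and \<open>f_plus\<close>. They have
  Wronskian one, so the diagonal Green function is \<open>- p n * q n\<close>. For a fixed \<open>z\<close> the products
  \<open>p n * q n\<close> stay between two positive constants in modulus; hence the real parts of the
  averages of \<open>w_plus\<close> and \<open>w_minus\<close> cancel in the limit and \<open>w_plus' = - w_minus'\<close>. The
  derivative of the \<open>N\<close>-th average of \<open>w_minus\<close> is \<open>1/N\<close> times the logarithmic derivative of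
  \<open>p (N + 1)\<close>, and by the Christoffel-Darboux identity this is minus the sum of the first \<open>N\<close>
  diagonal Green functions, up to an error bounded in \<open>N\<close> (\<open>green_sum_log_derivative\<close>).

  Radial limits of \<open>g\<close> exist almost everywhere (\<open>herglotz_derivative_radial_limit\<close>). The function
  \<open>exp (\<i> g)\<close> is bounded by one, so it is the derivative of a function that is Lipschitz up to
  the real axis. At a point where the boundary function is differentiable a blow-up argument
  identifies the radial limit of \<open>exp (\<i> g)\<close>, which is Fatou's theorem. The limit is nonzero almost
  everywhere: \<open>Im g\<close> is the horizontal derivative of the bounded function \<open>Im w_plus\<close>, so its
  integrals over horizontal segments are bounded, and by Fatou's lemma \<open>Im g\<close> does not tend to
  infinity except on a null set. Where \<open>exp (\<i> g)\<close> has a nonzero limit, \<open>g\<close> converges by continuity.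

  Where \<open>g\<close> has a radial limit, \<open>w_plus\<close> has one too. Fix \<open>\<epsilon>\<close>. Off a null set the line is
  exhausted by closed sets on which \<open>g\<close> oscillates by at most \<open>\<epsilon>\<close> along the vertical segment of
  height \<open>\<delta>\<close>. At a density point \<open>x\<close> of such a set \<open>S\<close> the Schwarz-Pick inequality
  extends the control of \<open>g\<close> from the verticals over \<open>S\<close> to a full cone at \<open>x\<close>. If \<open>x + h\<close> lies in
  \<open>S\<close>, then \<open>w_plus (x + h) - w_plus x\<close> can be computed along the other three sides of a square of
  side \<open>|h|\<close> (\<open>boundary_difference_quotient\<close>): the two vertical sides cancel up to an error of order
  \<open>\<epsilon> |h|\<close>, and the horizontal one contributes \<open>h\<close> times the boundary value of \<open>g\<close>. The remaining
  \<open>h\<close> have density zero, which is exactly what the approximate derivative ignores.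
\<close>

section \<open>Differentiation almost everywhere on the line\<close>

text \<open>
  All almost everywhere differentiation below comes from this consequence of the Vitali covering
  theorem. Choose an open \<open>U\<close> around \<open>Y\<close> with \<open>\<alpha> (U - Y)\<close> small, and cover the exceptional
  points by disjoint intervals inside \<open>U\<close> on which \<open>\<alpha>\<close> exceeds \<open>\<beta>\<close> by \<open>\<epsilon>\<close> times the length. Since
  \<open>\<alpha> \<le> \<beta>\<close> on \<open>Y\<close>, the total excess is at most \<open>\<alpha> (U - Y)\<close>, so the total length is small.
\<close>

lemma negligible_measure_comparison:
  fixes \<alpha> \<beta> :: "real measure"
  assumes "finite_measure \<alpha>" "finite_measure \<beta>"
    and sets [measurable_cong]: "sets \<alpha> = sets borel" "sets \<beta> = sets borel"
    and Y: "Y \<in> sets borel"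
    and le: "\<And>X. X \<in> sets borel \<Longrightarrow> X \<subseteq> Y \<Longrightarrow> measure \<alpha> X \<le> measure \<beta> X"
    and "\<epsilon> > 0"
  shows "negligible {x \<in> Y. \<forall>d>0. \<exists>c r. 0 < r \<and> r < d \<and> x \<in> cball c r \<and>
            measure \<beta> (cball c r) + \<epsilon> * (2 * r) < measure \<alpha> (cball c r)}"
    (is "negligible ?B")
  unfolding negligible_outer_le
proof (intro allI impI)
  fix e :: real assume "e > 0"
  interpret A: finite_measure \<alpha> by fact
  interpret B: finite_measure \<beta> by fact
  define \<rho> where "\<rho> = density \<alpha> (indicator (-Y))"
  have \<rho>: "emeasure \<rho> X = emeasure \<alpha> (X - Y)" if "X \<in> sets borel" for X
    using that Y unfolding \<rho>_def
    by (subst emeasure_restricted) (auto simp: sets intro!: arg_cong[of _ _ "emeasure \<alpha>"])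
  have spa: "space \<alpha> = UNIV" using sets_eq_imp_space_eq[OF sets(1)] by simp
  have fin\<rho>: "emeasure \<rho> (space \<rho>) \<noteq> \<infinity>"
    using \<rho>[of UNIV] spa A.emeasure_finite by (simp add: \<rho>_def)
  have "emeasure \<rho> Y = (INF U \<in> {U. Y \<subseteq> U \<and> open U}. emeasure \<rho> U)"
    using outer_regular[of \<rho> Y] fin\<rho> Y sets by (simp add: \<rho>_def)
  moreover have "emeasure \<rho> Y = 0" using \<rho>[OF Y] by simp
  moreover have "0 < ennreal (\<epsilon> * e)" using \<open>e > 0\<close> \<open>\<epsilon> > 0\<close> by simp
  ultimately obtain U where U: "Y \<subseteq> U" "open U" "emeasure \<rho> U < ennreal (\<epsilon> * e)"
    by (metis (no_types, lifting) INF_less_iff mem_Collect_eq)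
  have small: "measure \<alpha> (U - Y) < \<epsilon> * e"
    using U \<rho>[of U] \<open>e > 0\<close> \<open>\<epsilon> > 0\<close> by (simp add: A.emeasure_eq_measure ennreal_less_iff)
  define K where "K = {(c, r). 0 < r \<and> cball c r \<subseteq> U \<and>
      measure \<beta> (cball c r) + \<epsilon> * (2 * r) < measure \<alpha> (cball c r)}"
  obtain C where C: "countable C" "C \<subseteq> K"
     and disj: "pairwise (\<lambda>i j. disjnt (cball (fst i) (snd i)) (cball (fst j) (snd j))) C"
     and neg: "negligible (?B - (\<Union>i \<in> C. cball (fst i) (snd i)))"
  proof (rule Vitali_covering_theorem_cballs[of K snd ?B fst])
    show "0 < snd i" if "i \<in> K" for i using that by (auto simp: K_def)
    fix x d :: real assume x: "x \<in> ?B" and "0 < d"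
    then obtain \<eta> where \<eta>: "\<eta> > 0" "ball x \<eta> \<subseteq> U" using U by (metis (mono_tags, lifting) mem_Collect_eq openE subsetD)
    obtain c r where cr: "0 < r" "r < min d (\<eta> / 2)" "x \<in> cball c r"
      "measure \<beta> (cball c r) + \<epsilon> * (2 * r) < measure \<alpha> (cball c r)"
      using x \<open>d > 0\<close> \<open>\<eta> > 0\<close> by (auto dest!: spec[of _ "min d (\<eta> / 2)"])
    have "cball c r \<subseteq> ball x \<eta>"
    proof
      fix y assume "y \<in> cball c r"
      with cr(2,3) show "y \<in> ball x \<eta>" by (auto simp: dist_real_def)
    qed
    with cr \<eta> show "\<exists>i. i \<in> K \<and> x \<in> cball (fst i) (snd i) \<and> snd i < d"
      by (intro exI[of _ "(c, r)"]) (auto simp: K_def)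
  qed
  let ?I = "\<lambda>i::real \<times> real. cball (fst i) (snd i)"
  have Kpos: "0 < snd i" if "i \<in> C" for i using that C by (auto simp: K_def)
  have fin: "measure lebesgue (\<Union>i\<in>C'. ?I i) \<le> e" if C': "C' \<subseteq> C" "finite C'" for C'
  proof -
    let ?V = "\<Union>i\<in>C'. ?I i"
    have V: "?V \<in> sets borel" using C'(2) by (intro sets.finite_UN) auto
    have dj: "disjoint_family_on ?I C'"
      using disj C' unfolding pairwise_def disjoint_family_on_def disjnt_def by blast
    have "measure lebesgue ?V \<le> (\<Sum>i\<in>C'. measure lebesgue (?I i))"
      using C' by (intro measure_UNION_le) auto
    also have "\<dots> = (\<Sum>i\<in>C'. 2 * snd i)"
    proof (intro sum.cong refl)
      fix i assume "i \<in> C'"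
      then have "0 < snd i" using Kpos C' by blast
      then show "measure lebesgue (?I i) = 2 * snd i" by (simp add: cball_eq_atLeastAtMost)
    qed
    finally have 1: "\<epsilon> * measure lebesgue ?V \<le> (\<Sum>i\<in>C'. \<epsilon> * (2 * snd i))"
      using \<open>\<epsilon> > 0\<close> by (simp add: sum_distrib_left[symmetric])
    have "(\<Sum>i\<in>C'. \<epsilon> * (2 * snd i)) \<le> (\<Sum>i\<in>C'. measure \<alpha> (?I i) - measure \<beta> (?I i))"
    proof (intro sum_mono)
      fix i assume "i \<in> C'"
      then have "i \<in> K" using C C' by auto
      then show "\<epsilon> * (2 * snd i) \<le> measure \<alpha> (?I i) - measure \<beta> (?I i)"
        by (auto simp: K_def)
    qed
    also have "\<dots> = measure \<alpha> ?V - measure \<beta> ?V"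
      using C' dj by (subst (1 2) measure_finite_Union)
        (auto simp: sum_subtractf sets A.emeasure_eq_measure B.emeasure_eq_measure)
    finally have 2: "(\<Sum>i\<in>C'. \<epsilon> * (2 * snd i)) \<le> measure \<alpha> ?V - measure \<beta> ?V" .
    have 3: "measure \<alpha> ?V = measure \<alpha> (?V \<inter> Y) + measure \<alpha> (?V - Y)"
      using V Y by (subst A.finite_measure_Union[symmetric]) (auto simp: sets intro!: arg_cong[of _ _ "measure \<alpha>"])
    have 4: "measure \<alpha> (?V \<inter> Y) \<le> measure \<beta> (?V \<inter> Y)"
      using V Y by (intro le) auto
    have 5: "measure \<beta> (?V \<inter> Y) \<le> measure \<beta> ?V"
      using V Y by (intro B.finite_measure_mono) (auto simp: sets)
    have "?I i \<subseteq> U" if "i \<in> C'" for i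
    proof -
      have "i \<in> K" using that C(2) C' by blast
      then show ?thesis by (auto simp: K_def)
    qed
    then have "?V \<subseteq> U" by blast
    then have 6: "measure \<alpha> (?V - Y) \<le> measure \<alpha> (U - Y)"
      using U Y by (intro A.finite_measure_mono) (auto simp: sets)
    from 1 2 3 4 5 6 small have "\<epsilon> * measure lebesgue ?V < \<epsilon> * e" by linarith
    then show ?thesis using \<open>\<epsilon> > 0\<close> by simp
  qed
  let ?W = "\<Union>i\<in>C. ?I i"
  have W: "?W \<in> lmeasurable" "measure lebesgue ?W \<le> e"
    using fmeasurable_UN_bound[of C ?I lebesgue e] measure_UN_bound[of C ?I lebesgue e] C(1) fin by auto
  show "\<exists>T. ?B \<subseteq> T \<and> T \<in> lmeasurable \<and> measure lebesgue T \<le> e"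
  proof (intro exI conjI)
    show "?B \<subseteq> ?W \<union> (?B - ?W)" by auto
    show "?W \<union> (?B - ?W) \<in> lmeasurable"
      using W(1) neg by (meson fmeasurable.Un negligible_iff_measure)
    show "measure lebesgue (?W \<union> (?B - ?W)) \<le> e"
      using W neg measure_Un_le[of ?W lebesgue "?B - ?W"] negligible_iff_measure[of "?B - ?W"]
      by (auto simp: fmeasurableD)
  qed
qed

definition density_point :: "real set \<Rightarrow> real \<Rightarrow> bool" where
  "density_point S x \<longleftrightarrow> (\<forall>\<epsilon>>0. \<exists>d>0. \<forall>r. 0 < r \<longrightarrow> r < d \<longrightarrow>
      measure lebesgue (cball x r - S) \<le> \<epsilon> * (2 * r))"

text \<open>
  Lebesgue's density theorem: compare Lebesgue measure on the complement of \<open>S\<close>, which vanishes on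
  subsets of \<open>S\<close>, with the zero measure. The truncation to bounded intervals makes the measures finite.
\<close>

lemma negligible_not_density_point:
  fixes S :: "real set"
  assumes S: "closed S"
  shows "negligible {x \<in> S. \<not> density_point S x}"
proof -
  define \<alpha> :: "nat \<Rightarrow> real measure" where "\<alpha> R = density lborel (indicator ({- real R..real R} - S))" for R
  have meas: "{- real R..real R} - S \<in> sets borel" for R using S by auto
  have \<alpha>: "emeasure (\<alpha> R) X = emeasure lborel (X \<inter> ({- real R..real R} - S))" if "X \<in> sets borel" for X R
    using that meas[of R] emeasure_restricted[of "{- real R..real R} - S" lborel X]
    by (simp add: \<alpha>_def Int_commute)
  define Z where "Z R m = {x \<in> S. \<forall>d>0. \<exists>c r. 0 < r \<and> r < d \<and> x \<in> cball c r \<and>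
            measure (null_measure borel) (cball c r) + inverse (real (Suc m)) * (2 * r) < measure (\<alpha> R) (cball c r)}" for R m
  have "negligible (Z R m)" for R m
    unfolding Z_def
  proof (rule negligible_measure_comparison)
    show "finite_measure (\<alpha> R)"
    proof
      have "emeasure lborel ({- real R..real R} - S) \<le> emeasure lborel {- real R..real R}"
        by (rule emeasure_mono) auto
      also have "\<dots> < \<infinity>" by simp
      finally have "emeasure (\<alpha> R) UNIV \<noteq> \<infinity>"
        using \<alpha>[of UNIV R] by (simp add: less_top)
      then show "emeasure (\<alpha> R) (space (\<alpha> R)) \<noteq> \<infinity>" by (simp add: \<alpha>_def)
    qed
    show "measure (\<alpha> R) X \<le> measure (null_measure borel) X" if "X \<in> sets borel" "X \<subseteq> S" for X
    proof -
      have "X \<inter> ({- real R..real R} - S) = {}" using that by auto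
      then show ?thesis using \<alpha>[OF that(1), of R] by (simp add: measure_def)
    qed
    show "finite_measure (null_measure (borel :: real measure))" by standard simp
    show "S \<in> sets borel" using S by simp
  qed (simp_all add: \<alpha>_def)
  then have "negligible (\<Union>R m. Z R m)" by (intro negligible_Union_nat)
  moreover have "density_point S x" if x: "x \<in> S" "x \<notin> (\<Union>R m. Z R m)" for x
    unfolding density_point_def
  proof (intro allI impI)
    fix \<epsilon> :: real assume "\<epsilon> > 0"
    then obtain m where m: "inverse (real (Suc m)) < \<epsilon>" using reals_Archimedean by blast
    obtain R where R: "\<bar>x\<bar> + 1 < real R" using reals_Archimedean2 by blast
    have nZ: "x \<notin> Z R m" using x(2) by blast
    have "\<exists>d>0. \<forall>c r. 0 < r \<longrightarrow> r < d \<longrightarrow> x \<in> cball c r \<longrightarrow>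
       measure (\<alpha> R) (cball c r) \<le> inverse (real (Suc m)) * (2 * r)"
    proof (rule ccontr)
      assume neg: "\<not> ?thesis"
      have "x \<in> Z R m"
        unfolding Z_def mem_Collect_eq
      proof (intro conjI allI impI x(1))
        fix d :: real assume "d > 0"
        with neg obtain c r where "0 < r" "r < d" "x \<in> cball c r"
          "\<not> measure (\<alpha> R) (cball c r) \<le> inverse (real (Suc m)) * (2 * r)" by blast
        then show "\<exists>c r. 0 < r \<and> r < d \<and> x \<in> cball c r \<and>
            measure (null_measure borel) (cball c r) + inverse (real (Suc m)) * (2 * r) < measure (\<alpha> R) (cball c r)"
          by (intro exI[of _ c] exI[of _ r]) simp
      qed
      with nZ show False by contradiction
    qed
    then obtain d where d: "d > 0" "\<And>c r. 0 < r \<Longrightarrow> r < d \<Longrightarrow> x \<in> cball c r \<Longrightarrow>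
       measure (\<alpha> R) (cball c r) \<le> inverse (real (Suc m)) * (2 * r)"
      by blast
    have "measure lebesgue (cball x r - S) \<le> \<epsilon> * (2 * r)" if r: "0 < r" "r < min d 1" for r
    proof -
      have "cball x r \<subseteq> {- real R..real R}"
        using R r unfolding cball_eq_atLeastAtMost by auto
      then have "cball x r \<inter> ({- real R..real R} - S) = cball x r - S" by blast
      then have "measure (\<alpha> R) (cball x r) = measure lebesgue (cball x r - S)"
        using \<alpha>[of "cball x r" R] S by (simp add: measure_def)
      moreover have "measure (\<alpha> R) (cball x r) \<le> inverse (real (Suc m)) * (2 * r)"
        using d(2)[of r x] r by auto
      moreover have "inverse (real (Suc m)) * (2 * r) \<le> \<epsilon> * (2 * r)"
        using m r by (intro mult_right_mono) auto
      ultimately show ?thesis by linarith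
    qed
    moreover have min_pos: "0 < min d 1" using d(1) by simp
    ultimately show "\<exists>d>0. \<forall>r. 0 < r \<longrightarrow> r < d \<longrightarrow> measure lebesgue (cball x r - S) \<le> \<epsilon> * (2 * r)"
      using min_pos by blast
  qed
  ultimately show ?thesis by (elim negligible_subset) blast
qed


text \<open>
  The limit is the infimum of the rationals that asymptotically bound \<open>f\<close> from above.
\<close>

lemma tendsto_of_dichotomy_at_rationals:
  fixes f :: "'a \<Rightarrow> real"
  assumes dich: "\<And>p. p \<in> \<rat> \<Longrightarrow> (\<forall>e>0. eventually (\<lambda>h. f h \<le> p + e) F) \<or> (\<forall>e>0. eventually (\<lambda>h. p - e \<le> f h) F)"
    and bounds: "eventually (\<lambda>h. a \<le> f h \<and> f h \<le> b) F" and "F \<noteq> bot"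
  shows "\<exists>L. (f \<longlongrightarrow> L) F"
proof -
  define up where "up p \<longleftrightarrow> (\<forall>e>0. eventually (\<lambda>h. f h \<le> p + e) F)" for p
  define P where "P = {p. p \<in> \<rat> \<and> up p}"
  have upD: "eventually (\<lambda>h. f h \<le> p + e) F" if "up p" "e > 0" for p e
    using that by (simp only: up_def)
  have lowD: "eventually (\<lambda>h. p - e \<le> f h) F" if "p \<in> \<rat>" "\<not> up p" "e > 0" for p e
    using dich[OF that(1)] that(2,3) by (simp only: up_def) fast
  obtain q where q: "q \<in> \<rat>" "b < q" using Rats_dense_in_real[of b "b + 1"] by auto
  have "eventually (\<lambda>h. f h \<le> q + e) F" if "e > 0" for e
    using bounds by (rule eventually_mono) (use q(2) that in linarith)
  then have "up q" by (simp only: up_def) blast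
  then have "q \<in> P" using q(1) by (simp only: P_def) simp
  then have ne: "P \<noteq> {}" by blast
  have low: "a \<le> p" if "p \<in> P" for p
  proof (rule field_le_epsilon)
    fix e :: real assume "e > 0"
    have "up p" using that by (simp only: P_def) simp
    from upD[OF this \<open>e > 0\<close>] bounds have "eventually (\<lambda>h. a \<le> p + e) F"
      by eventually_elim linarith
    then show "a \<le> p + e" using \<open>F \<noteq> bot\<close> by (simp add: eventually_const_iff)
  qed
  have bdd: "bdd_below P" using low by (rule bdd_belowI)
  have "(f \<longlongrightarrow> Inf P) F"
  proof (rule order_tendstoI)
    fix u assume "u < Inf P"
    then obtain p where p: "p \<in> \<rat>" "u < p" "p < Inf P" using Rats_dense_in_real by blast
    have "p \<notin> P"
    proof
      assume "p \<in> P"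
      then have "Inf P \<le> p" using bdd by (rule cInf_lower)
      with p(3) show False by linarith
    qed
    then have "\<not> up p" using p(1) by (simp only: P_def) simp
    moreover have "(p - u) / 2 > 0" using p(2) by simp
    ultimately have "eventually (\<lambda>h. p - (p - u) / 2 \<le> f h) F" using p(1) by (intro lowD)
    then show "eventually (\<lambda>h. u < f h) F" by (rule eventually_mono) (use p(2) in argo)
  next
    fix u assume "Inf P < u"
    with ne have "\<exists>p\<in>P. p < u" by (rule cInf_lessD)
    then obtain p where p: "p \<in> P" "p < u" by (rule bexE)
    have "up p" using p(1) by (simp only: P_def) simp
    moreover have "(u - p) / 2 > 0" using p(2) by simp
    ultimately have "eventually (\<lambda>h. f h \<le> p + (u - p) / 2) F" by (rule upD)
    then show "eventually (\<lambda>h. f h < u) F" by (rule eventually_mono) (use p(2) in argo)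
  qed
  then show ?thesis by blast
qed

text \<open>
  The difference quotients of \<open>F\<close> are quotients of its Lebesgue-Stieltjes measure \<open>\<alpha>\<close> by length. For
  every rational \<open>p\<close> a Hahn decomposition splits the line into a set where \<open>\<alpha>\<close> is below \<open>p\<close> times
  length and one where it is above; the comparison lemma turns this into the asymptotic dichotomy of
  \<open>tendsto_of_dichotomy_at_rationals\<close> at almost every point.
\<close>

lemma negligible_not_differentiable_mono_lipschitz:
  fixes F :: "real \<Rightarrow> real"
  assumes mono: "mono F" and lip: "B-lipschitz_on UNIV F"
  shows "negligible {x. \<not> F differentiable at x}"
proof -
  \<comment> \<open>Clamping makes the Stieltjes measures finite.\<close>
  define FR where "FR R x = F (max (- real R) (min (real R) x))" for R x
  define \<alpha> where "\<alpha> R = interval_measure (FR R)" for R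
  define \<beta> :: "nat \<Rightarrow> real \<Rightarrow> real measure" where
    "\<beta> R p = density lborel (\<lambda>x. ennreal p * indicator {- real R..real R} x)" for R p
  have contF: "continuous_on UNIV F" using lip by (rule lipschitz_on_continuous_on)
  have contFR: "continuous_on UNIV (FR R)" for R
    unfolding FR_def by (intro continuous_on_compose2[OF contF] continuous_intros) auto
  have monoFR: "FR R x \<le> FR R y" if "x \<le> y" for R x y
    unfolding FR_def using that by (intro monoD[OF mono]) auto
  have bFR: "FR R x \<le> F (real R)" "F (- real R) \<le> FR R x" for R x
    unfolding FR_def by (auto intro!: monoD[OF mono])
  have \<alpha>Icc: "emeasure (\<alpha> R) {u..v} = ennreal (FR R v - FR R u)" if "u \<le> v" for R u v
    unfolding \<alpha>_def by (rule emeasure_interval_measure_Icc) (use that monoFR contFR in auto)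
  have sets\<alpha> [simp]: "sets (\<alpha> R) = sets borel" "space (\<alpha> R) = UNIV" for R by (simp_all add: \<alpha>_def)
  have sets\<beta> [simp]: "sets (\<beta> R p) = sets borel" "space (\<beta> R p) = UNIV" for R p by (simp_all add: \<beta>_def)
  have fin\<alpha>: "finite_measure (\<alpha> R)" for R
  proof
    have "emeasure (\<alpha> R) (\<Union>n. {- real n..real n}) = (SUP n. emeasure (\<alpha> R) {- real n..real n})"
      by (rule SUP_emeasure_incseq[symmetric]) (auto simp: incseq_def)
    also have "(\<Union>n. {- real n..real n}) = UNIV"
    proof (intro equalityI subsetI UNIV_I)
      fix x :: real assume "x \<in> UNIV"
      obtain n where "\<bar>x\<bar> < real n" using reals_Archimedean2 by blast
      then show "x \<in> (\<Union>n. {- real n..real n})" by (auto intro!: exI[of _ n])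
    qed
    also have "(SUP n. emeasure (\<alpha> R) {- real n..real n}) \<le> ennreal (F (real R) - F (- real R))"
      by (intro SUP_least) (auto simp: \<alpha>Icc intro!: ennreal_leI diff_mono bFR)
    finally show "emeasure (\<alpha> R) (space (\<alpha> R)) \<noteq> \<infinity>" by (auto simp: top_unique)
  qed
  have \<beta>: "emeasure (\<beta> R p) X = ennreal p * emeasure lborel (X \<inter> {- real R..real R})" if "X \<in> sets borel" for R p X
  proof -
    have "emeasure (\<beta> R p) X = (\<integral>\<^sup>+x. ennreal p * indicator (X \<inter> {- real R..real R}) x \<partial>lborel)"
      unfolding \<beta>_def using that
      by (subst emeasure_density) (auto intro!: nn_integral_cong split: split_indicator)
    then show ?thesis using that by (simp add: nn_integral_cmult_indicator)
  qed
  have fin\<beta>: "finite_measure (\<beta> R p)" for R p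
    by standard (simp add: \<beta> ennreal_mult_eq_top_iff)
  have "\<exists>Y\<in>sets borel. (\<forall>X\<in>sets borel. X \<subseteq> Y \<longrightarrow> \<alpha> R X \<le> \<beta> R p X) \<and>
      (\<forall>X\<in>sets borel. X \<inter> Y = {} \<longrightarrow> \<beta> R p X \<le> \<alpha> R X)" for R p
    using finite_unsigned_Hahn_decomposition[OF fin\<beta>[of R p] fin\<alpha>[of R]] by auto
  then obtain Y where Y: "\<And>R p. Y R p \<in> sets borel"
    and Y1: "\<And>R p X. X\<in>sets borel \<Longrightarrow> X \<subseteq> Y R p \<Longrightarrow> \<alpha> R X \<le> \<beta> R p X"
    and Y2: "\<And>R p X. X\<in>sets borel \<Longrightarrow> X \<inter> Y R p = {} \<Longrightarrow> \<beta> R p X \<le> \<alpha> R X"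
    by metis
  define Z where "Z \<mu> \<nu> S m = {x \<in> S. \<forall>d>0. \<exists>c r. 0 < r \<and> r < d \<and> x \<in> cball c r \<and>
            measure \<nu> (cball c r) + inverse (real (Suc m)) * (2 * r) < measure \<mu> (cball c r)}"
    for \<mu> \<nu> :: "real measure" and S m
  have measure_le: "measure \<mu> X \<le> measure \<nu> X"
    if "emeasure \<mu> X \<le> emeasure \<nu> X" "finite_measure \<nu>" for \<mu> \<nu> :: "real measure" and X
    using that finite_measure.emeasure_finite[of \<nu> X] unfolding measure_def
    by (intro enn2real_mono) (auto simp: less_top)
  have neg1: "negligible (Z (\<alpha> R) (\<beta> R p) (Y R p) m)" for R p m
    unfolding Z_def using fin\<alpha> fin\<beta> Y Y1
    by (intro negligible_measure_comparison measure_le) auto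
  have neg2: "negligible (Z (\<beta> R p) (\<alpha> R) (- Y R p) m)" for R p m
    unfolding Z_def
  proof (rule negligible_measure_comparison)
    fix X assume X: "X \<in> sets borel" "X \<subseteq> - Y R p"
    then have "X \<inter> Y R p = {}" by auto
    with X show "measure (\<beta> R p) X \<le> measure (\<alpha> R) X" using fin\<alpha> by (intro measure_le Y2) auto
  qed (use fin\<alpha> fin\<beta> Y in auto)
  define N where "N = (\<Union>(R, m, p) \<in> UNIV \<times> UNIV \<times> \<rat>. Z (\<alpha> R) (\<beta> R p) (Y R p) m \<union> Z (\<beta> R p) (\<alpha> R) (- Y R p) m)"
  have "negligible N"
    unfolding N_def using neg1 neg2
    by (intro negligible_countable_Union) (auto intro!: negligible_Un countable_rat)
  moreover have "F differentiable at x" if x: "x \<notin> N" for x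
  proof -
    obtain R where R: "\<bar>x\<bar> + 1 < real R" using reals_Archimedean2 by blast
    let ?q = "\<lambda>h. (F (x + h) - F x) / h"
    have bnd: "0 \<le> ?q h \<and> ?q h \<le> B" if "h \<noteq> 0" for h
    proof
      show "0 \<le> ?q h"
        using that monoD[OF mono, of x "x + h"] monoD[OF mono, of "x + h" x]
        by (cases "h > 0") (auto simp: divide_nonneg_nonneg divide_nonpos_nonpos)
      have "\<bar>F (x + h) - F x\<bar> \<le> B * \<bar>h\<bar>"
        using lipschitz_onD[OF lip, of "x + h" x] by (auto simp: dist_real_def)
      then have "\<bar>?q h\<bar> \<le> B" using that by (simp add: field_simps)
      then show "?q h \<le> B" by linarith
    qed
    \<comment> \<open>The ball is the interval between \<open>x\<close> and \<open>x + h\<close>, for either sign of \<open>h\<close>.\<close>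
    have cb: "cball (x + h / 2) (\<bar>h\<bar> / 2) = {min x (x + h)..max x (x + h)}" for h
      by (cases "h \<ge> 0") (auto simp: cball_eq_atLeastAtMost field_simps)
    have \<alpha>q: "measure (\<alpha> R) (cball (x + h / 2) (\<bar>h\<bar> / 2)) = ?q h * \<bar>h\<bar>" if h: "h \<noteq> 0" "\<bar>h\<bar> < 1" for h
    proof -
      have e: "FR R (x + h) = F (x + h)" "FR R x = F x" using R h by (auto simp: FR_def max_def min_def)
      have "FR R (max x (x + h)) - FR R (min x (x + h)) = ?q h * \<bar>h\<bar>"
        using h e by (cases "h > 0") (auto simp: max_def min_def)
      moreover have "0 \<le> ?q h * \<bar>h\<bar>" using bnd[OF h(1)] by (intro mult_nonneg_nonneg) auto
      moreover have "emeasure (\<alpha> R) (cball (x + h / 2) (\<bar>h\<bar> / 2)) =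
          ennreal (FR R (max x (x + h)) - FR R (min x (x + h)))"
        unfolding cb by (rule \<alpha>Icc) auto
      ultimately show ?thesis unfolding measure_def by (simp only: enn2real_ennreal)
    qed
    have \<beta>q: "measure (\<beta> R p) (cball (x + h / 2) (\<bar>h\<bar> / 2)) = p * \<bar>h\<bar>" if h: "\<bar>h\<bar> < 1" and "p \<ge> 0" for h p
    proof -
      have "cball (x + h / 2) (\<bar>h\<bar> / 2) \<inter> {- real R..real R} = {min x (x + h)..max x (x + h)}"
        using R h unfolding cb by auto
      then have "emeasure (\<beta> R p) (cball (x + h / 2) (\<bar>h\<bar> / 2)) = ennreal (p * \<bar>h\<bar>)"
        using \<open>p \<ge> 0\<close> by (subst \<beta>) (auto simp: ennreal_mult max_def min_def)
      then show ?thesis using \<open>p \<ge> 0\<close> by (simp add: measure_def)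
    qed
    have key: "eventually (\<lambda>h. measure \<mu> (cball (x + h / 2) (\<bar>h\<bar> / 2)) \<le> measure \<nu> (cball (x + h / 2) (\<bar>h\<bar> / 2)) + e * \<bar>h\<bar>) (at 0)"
      if zz: "\<And>m. x \<notin> Z \<mu> \<nu> S m" "x \<in> S" and "e > 0" for \<mu> \<nu> S e
    proof -
      obtain m where m: "inverse (real (Suc m)) < e" using reals_Archimedean \<open>e > 0\<close> by blast
      obtain d where d: "d > 0" "\<And>c r. 0 < r \<Longrightarrow> r < d \<Longrightarrow> x \<in> cball c r \<Longrightarrow>
         measure \<mu> (cball c r) \<le> measure \<nu> (cball c r) + inverse (real (Suc m)) * (2 * r)"
        using zz(1)[of m] zz(2) unfolding Z_def mem_Collect_eq not_less[symmetric] by blast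
      have "eventually (\<lambda>h::real. h \<noteq> 0 \<and> \<bar>h\<bar> < d) (at 0)"
        using d(1) by (auto simp: eventually_at dist_real_def intro!: exI[of _ d])
      then show ?thesis
      proof eventually_elim
        case (elim h)
        have "measure \<mu> (cball (x + h / 2) (\<bar>h\<bar> / 2)) \<le> measure \<nu> (cball (x + h / 2) (\<bar>h\<bar> / 2)) + inverse (real (Suc m)) * (2 * (\<bar>h\<bar> / 2))"
          using elim by (intro d(2)) (auto simp: dist_real_def)
        also have "inverse (real (Suc m)) * (2 * (\<bar>h\<bar> / 2)) \<le> e * \<bar>h\<bar>"
          using m by (simp add: mult_right_mono)
        finally show ?case by simp
      qed
    qed
    have near: "eventually (\<lambda>h::real. h \<noteq> 0 \<and> \<bar>h\<bar> < 1) (at 0)"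
      by (auto simp: eventually_at dist_real_def intro!: exI[of _ 1])
    have "\<exists>L. (?q \<longlongrightarrow> L) (at 0)"
    proof (rule tendsto_of_dichotomy_at_rationals)
      show "eventually (\<lambda>h. 0 \<le> ?q h \<and> ?q h \<le> B) (at 0)" using near by eventually_elim (use bnd in auto)
      fix p :: real assume p: "p \<in> \<rat>"
      have nz: "x \<notin> Z (\<alpha> R) (\<beta> R p) (Y R p) m" "x \<notin> Z (\<beta> R p) (\<alpha> R) (- Y R p) m" for m
        using x p unfolding N_def by auto
      show "(\<forall>e>0. eventually (\<lambda>h. ?q h \<le> p + e) (at 0)) \<or> (\<forall>e>0. eventually (\<lambda>h. p - e \<le> ?q h) (at 0))"
      proof (cases "p \<ge> 0")
        case False
        have "eventually (\<lambda>h. p - e \<le> ?q h) (at 0)" if "e > 0" for e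
          using near by eventually_elim (use bnd False that in \<open>force\<close>)
        then show ?thesis by auto
      next
        case True
        show ?thesis
        proof (cases "x \<in> Y R p")
          case in_Y: True
          have "eventually (\<lambda>h. ?q h \<le> p + e) (at 0)" if "e > 0" for e
            using key[OF nz(1) in_Y that] near
          proof eventually_elim
            case (elim h)
            then have "?q h * \<bar>h\<bar> \<le> (p + e) * \<bar>h\<bar>" using \<alpha>q[of h] \<beta>q[of h p] True by (simp add: algebra_simps)
            then show ?case using elim by (simp only: mult_le_cancel_right) auto
          qed
          then show ?thesis by auto
        next
          case False
          then have compl: "x \<in> - Y R p" by simp
          have "eventually (\<lambda>h. p - e \<le> ?q h) (at 0)" if "e > 0" for e
            using key[OF nz(2) compl that] near
          proof eventually_elim
            case (elim h)
            then have "(p - e) * \<bar>h\<bar> \<le> ?q h * \<bar>h\<bar>" using \<alpha>q[of h] \<beta>q[of h p] True by (simp add: algebra_simps)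
            then show ?case using elim by (simp only: mult_le_cancel_right) auto
          qed
          then show ?thesis by auto
        qed
      qed
    qed simp
    then obtain L where "(?q \<longlongrightarrow> L) (at 0)" by blast
    then have "(F has_field_derivative L) (at x)" by (simp add: DERIV_def)
    then show ?thesis by (auto simp: real_differentiable_def)
  qed
  ultimately show ?thesis by (elim negligible_subset) blast
qed

text \<open>
  Adding a multiple of the identity makes a Lipschitz function nondecreasing.
\<close>

lemma negligible_not_differentiable_lipschitz:
  fixes F :: "real \<Rightarrow> real"
  assumes lip: "B-lipschitz_on UNIV F"
  shows "negligible {x. \<not> F differentiable at x}"
proof (rule negligible_subset)
  have B: "B \<ge> 0" using lip by (rule lipschitz_on_nonneg)
  have bound: "\<bar>F x - F y\<bar> \<le> B * \<bar>x - y\<bar>" for x y using lipschitz_onD[OF lip, of x y] by (simp add: dist_real_def)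
  show "negligible {x. \<not> (\<lambda>x. F x + B * x) differentiable at x}"
  proof (rule negligible_not_differentiable_mono_lipschitz)
    show "mono (\<lambda>x. F x + B * x)"
    proof
      fix x y :: real assume "x \<le> y"
      then show "F x + B * x \<le> F y + B * y" using bound[of x y] by (simp add: algebra_simps abs_if split: if_splits)
    qed
    show "(2 * B)-lipschitz_on UNIV (\<lambda>x. F x + B * x)"
    proof (rule lipschitz_onI)
      fix x y :: real
      have "\<bar>B * x - B * y\<bar> = B * \<bar>x - y\<bar>" using B by (simp add: right_diff_distrib[symmetric] abs_mult)
      then show "dist (F x + B * x) (F y + B * y) \<le> 2 * B * dist x y"
        using bound[of x y] unfolding dist_real_def by linarith
    qed (use B in auto)
  qed
  show "{x. \<not> F differentiable at x} \<subseteq> {x. \<not> (\<lambda>x. F x + B * x) differentiable at x}"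
  proof -
    have "F differentiable at x" if "(\<lambda>x. F x + B * x) differentiable at x" for x
    proof -
      have "(\<lambda>x. (F x + B * x) - B * x) differentiable at x"
        using that by (intro differentiable_diff) auto
      then show ?thesis by simp
    qed
    then show ?thesis by blast
  qed
qed

section \<open>Radial limits of bounded holomorphic functions\<close>

lemma closure_upper_half_plane: "closure upper_half_plane = {z. 0 \<le> Im z}"
  using closure_halfspace_gt[of \<i> 0] by simp

text \<open>
  Continuity lets the holomorphic pieces be pasted across the real axis; the identity theorem does
  the rest.
\<close>

lemma zero_of_zero_below_real_axis:
  assumes holU: "h holomorphic_on (ball 0 2 \<inter> {z. 0 < Im z})" and conth: "continuous_on (ball 0 2) h"
   and hdef: "\<And>z. Im z < 0 \<Longrightarrow> h z = 0" and z: "z \<in> ball 0 2"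
  shows "h z = (0::complex)"
proof -
    have iH: "inner \<i> z = Im z" for z by (simp add: inner_complex_def)
    have "h holomorphic_on ball 0 2"
    proof (rule holomorphic_on_paste_across_line[of _ \<i> _ 0])
      have "(\<lambda>_. 0) holomorphic_on (ball 0 2 \<inter> {z. Im z < 0})" by (rule holomorphic_on_const)
      then have "h holomorphic_on (ball 0 2 \<inter> {z. Im z < 0})"
        by (rule holomorphic_transform) (simp add: hdef)
      then show "h holomorphic_on (ball 0 2 \<inter> {z. inner \<i> z < 0})" unfolding iH .
      show "h holomorphic_on (ball 0 2 \<inter> {z. 0 < inner \<i> z})" unfolding iH by (rule holU)
    next
      show "open (ball (0::complex) 2)" by (rule open_ball)
      show "\<i> \<noteq> 0" by (rule complex_i_not_zero)
      show "continuous_on (ball 0 2) h" by (rule conth)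
    qed
    then show "h z = 0"
    proof (rule analytic_continuation)
      have "open (ball (0::complex) 2 \<inter> {z. Im z < 0})" by (intro open_Int open_ball open_halfspace_Im_lt)
      then show "- \<i> islimpt ball 0 2 \<inter> {z. Im z < 0}" by (rule open_imp_islimpt) simp
      show "h z = 0" if "z \<in> ball 0 2 \<inter> {z. Im z < 0}" for z using that hdef by simp
    qed (use z in auto)
qed
text \<open>
  The core of Fatou's theorem. If the derivative at height \<open>y\<close> stayed away from \<open>d\<close> along some
  sequence \<open>\<rho> n\<close> of heights, then the rescalings \<open>\<phi> n\<close> of \<open>\<Phi>\<close> around \<open>x\<close> would still be
  equi-Lipschitz, so a subsequence converges uniformly on a half disc to some \<open>\<Psi>\<close>. On the real axis
  \<open>\<Psi>\<close> is the linear map with slope \<open>d\<close>, hence it is that map on the whole half disc, and its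
  derivative at \<open>\<i>\<close>, which is the limit of the derivatives of \<open>\<Phi>\<close>, equals \<open>d\<close>.
\<close>

lemma deriv_tendsto_boundary_derivative:
  fixes \<Phi> :: "complex \<Rightarrow> complex" and x :: real
  assumes lip: "C-lipschitz_on {z. 0 \<le> Im z} \<Phi>" and hol: "\<Phi> holomorphic_on upper_half_plane"
    and vd: "((\<lambda>t. \<Phi> (complex_of_real t)) has_vector_derivative d) (at x)"
  shows "((\<lambda>y. deriv \<Phi> (Complex x y)) \<longlongrightarrow> d) (at_right 0)"
proof (rule tendsto_at_right_sequentially[of 0 1])
  fix S :: "nat \<Rightarrow> real"
  assume Spos: "\<And>n. 0 < S n" and S0: "S \<longlonglongrightarrow> 0"
  show "(\<lambda>n. deriv \<Phi> (Complex x (S n))) \<longlonglongrightarrow> d"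
  proof (rule ccontr)
    assume "\<not> ?thesis"
    then obtain e where e: "e > 0" "\<not> eventually (\<lambda>n. dist (deriv \<Phi> (Complex x (S n))) d < e) sequentially"
      unfolding tendsto_iff by blast
    then have "infinite {n. \<not> dist (deriv \<Phi> (Complex x (S n))) d < e}"
      unfolding eventually_cofinite[symmetric] cofinite_eq_sequentially by simp
    then obtain r :: "nat \<Rightarrow> nat" where r: "strict_mono r" "\<And>n. r n \<in> {n. \<not> dist (deriv \<Phi> (Complex x (S n))) d < e}"
      using infinite_enumerate by blast
    define \<rho> where "\<rho> n = S (r n)" for n
    have \<rho>pos: "0 < \<rho> n" for n using Spos by (simp add: \<rho>_def)
    have \<rho>0: "\<rho> \<longlonglongrightarrow> 0" using LIMSEQ_subseq_LIMSEQ[OF S0 r(1)] by (simp add: \<rho>_def[abs_def] comp_def)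
    have far: "e \<le> dist (deriv \<Phi> (Complex x (\<rho> n))) d" for n using r(2)[of n] by (simp add: \<rho>_def)
    define \<phi> where "\<phi> n \<zeta> = (\<Phi> (of_real x + of_real (\<rho> n) * \<zeta>) - \<Phi> (of_real x)) / of_real (\<rho> n)" for n \<zeta>
    define K where "K = cball (0::complex) 2 \<inter> {z. 0 \<le> Im z}"
    define U where "U = ball (0::complex) 2 \<inter> {z. 0 < Im z}"
    have C0: "C \<ge> 0" using lip by (rule lipschitz_on_nonneg)
    have \<phi>lip: "norm (\<phi> n \<zeta> - \<phi> n \<zeta>') \<le> C * norm (\<zeta> - \<zeta>')" if "0 \<le> Im \<zeta>" "0 \<le> Im \<zeta>'" for n \<zeta> \<zeta>'
    proof -
      have "norm (\<Phi> (of_real x + of_real (\<rho> n) * \<zeta>) - \<Phi> (of_real x + of_real (\<rho> n) * \<zeta>'))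
          \<le> C * norm ((of_real x + of_real (\<rho> n) * \<zeta>) - (of_real x + of_real (\<rho> n) * \<zeta>'))"
        using \<rho>pos[of n] that by (intro lipschitz_on_normD[OF lip]) auto
      also have "(of_real x + of_real (\<rho> n) * \<zeta>) - (of_real x + of_real (\<rho> n) * \<zeta>') = of_real (\<rho> n) * (\<zeta> - \<zeta>')"
        by (simp add: algebra_simps)
      finally have "norm (\<Phi> (of_real x + of_real (\<rho> n) * \<zeta>) - \<Phi> (of_real x + of_real (\<rho> n) * \<zeta>'))
          \<le> C * norm (\<zeta> - \<zeta>') * \<rho> n"
        using \<rho>pos[of n] by (simp add: norm_mult mult_ac)
      moreover have "\<phi> n \<zeta> - \<phi> n \<zeta>' = (\<Phi> (of_real x + of_real (\<rho> n) * \<zeta>) - \<Phi> (of_real x + of_real (\<rho> n) * \<zeta>')) / of_real (\<rho> n)"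
        by (simp add: \<phi>_def diff_divide_distrib)
      ultimately show ?thesis using \<rho>pos[of n] by (simp add: norm_divide pos_divide_le_eq)
    qed
    have \<phi>0: "\<phi> n 0 = 0" for n by (simp add: \<phi>_def)
    have compK: "compact K" unfolding K_def
      by (intro compact_Int_closed compact_cball closed_halfspace_Im_ge)
    have KD: "norm \<zeta> \<le> 2" "0 \<le> Im \<zeta>" if "\<zeta> \<in> K" for \<zeta> using that by (auto simp: K_def)
    have bound: "norm (\<phi> n \<zeta>) \<le> C * 2" if "\<zeta> \<in> K" for n \<zeta>
    proof -
      have "norm (\<phi> n \<zeta>) \<le> C * norm \<zeta>" using \<phi>lip[of \<zeta> 0 n] KD[OF that] by (simp add: \<phi>0)
      also have "\<dots> \<le> C * 2" using KD[OF that] C0 by (intro mult_left_mono)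
      finally show ?thesis .
    qed
    have equicont: "\<exists>\<delta>. 0 < \<delta> \<and> (\<forall>n y. y \<in> K \<and> norm (\<zeta> - y) < \<delta> \<longrightarrow> norm (\<phi> n \<zeta> - \<phi> n y) < \<epsilon>)"
      if \<zeta>: "\<zeta> \<in> K" and \<epsilon>: "0 < \<epsilon>" for \<zeta> and \<epsilon> :: real
    proof -
      have C1: "0 < C + 1" using C0 by linarith
      have "norm (\<phi> n \<zeta> - \<phi> n y) < \<epsilon>" if y: "y \<in> K" "norm (\<zeta> - y) < \<epsilon> / (C + 1)" for n y
      proof -
        have "norm (\<phi> n \<zeta> - \<phi> n y) \<le> C * norm (\<zeta> - y)" by (intro \<phi>lip KD \<zeta> y)
        also have "\<dots> \<le> (C + 1) * norm (\<zeta> - y)" by (intro mult_right_mono) auto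
        also have "\<dots> < \<epsilon>" using y(2) C1 by (simp add: pos_less_divide_eq mult.commute)
        finally show ?thesis .
      qed
      moreover have "0 < \<epsilon> / (C + 1)" using \<epsilon> C1 by (rule divide_pos_pos)
      ultimately show ?thesis by blast
    qed
    have "\<exists>g k. continuous_on K g \<and> strict_mono (k :: nat \<Rightarrow> nat) \<and>
        uniform_limit K (\<lambda>n. \<phi> (k n)) g sequentially"
    proof (rule Arzela_Ascoli[OF compK bound equicont])
      fix g and k :: "nat \<Rightarrow> nat"
      assume g: "continuous_on K g" and k: "strict_mono k"
        and close: "\<And>e. 0 < e \<Longrightarrow> \<exists>N. \<forall>n x. n \<ge> N \<and> x \<in> K \<longrightarrow> norm (\<phi> (k n) x - g x) < e"
      have "uniform_limit K (\<lambda>n. \<phi> (k n)) g sequentially"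
      proof (rule uniform_limitI)
        fix e :: real assume "0 < e"
        from close[OF this] obtain N where "\<forall>n x. n \<ge> N \<and> x \<in> K \<longrightarrow> norm (\<phi> (k n) x - g x) < e" ..
        then show "eventually (\<lambda>n. \<forall>x\<in>K. dist (\<phi> (k n) x) (g x) < e) sequentially"
          unfolding dist_norm eventually_sequentially by (intro exI[of _ N]) simp
      qed
      with g k show ?thesis by (intro exI conjI)
    qed
    then obtain \<Psi> k where \<Psi>: "continuous_on K \<Psi>" "strict_mono (k :: nat \<Rightarrow> nat)"
      and unif: "uniform_limit K (\<lambda>n. \<phi> (k n)) \<Psi> sequentially"
      by (elim exE conjE)
    \<comment> \<open>On the real axis the blow-ups converge to the linear map given by the derivative.\<close>
    have real_line: "\<Psi> (of_real s) = d * of_real s" if "of_real s \<in> K" for s :: real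
    proof (cases "s = 0")
      case True
      have "(\<lambda>n. \<phi> (k n) (of_real s)) \<longlonglongrightarrow> \<Psi> (of_real s)"
        using unif that by (rule tendsto_uniform_limitI)
      then show ?thesis using True by (simp add: \<phi>0 LIMSEQ_const_iff)
    next
      case False
      have lim1: "(\<lambda>n. \<phi> (k n) (of_real s)) \<longlonglongrightarrow> \<Psi> (of_real s)"
        using unif that by (rule tendsto_uniform_limitI)
      have vd': "((\<lambda>h. (\<Phi> (of_real (x + h)) - \<Phi> (of_real x)) /\<^sub>R h) \<longlongrightarrow> d) (at 0)"
        using vd unfolding tendsto_complex_iff has_vector_derivative_complex_iff DERIV_def
        by (simp add: divide_inverse mult.commute)
      have "filterlim (\<lambda>n. \<rho> (k n) * s) (at 0) sequentially"
        unfolding filterlim_at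
      proof
        show "eventually (\<lambda>n. \<rho> (k n) * s \<in> UNIV \<and> \<rho> (k n) * s \<noteq> 0) sequentially"
          using \<rho>pos False by (intro always_eventually) (metis UNIV_I less_irrefl mult_eq_0_iff)
        show "(\<lambda>n. \<rho> (k n) * s) \<longlonglongrightarrow> 0"
          using LIMSEQ_subseq_LIMSEQ[OF \<rho>0 \<Psi>(2)] by (auto simp: comp_def intro: tendsto_mult_left_zero)
      qed
      from filterlim_compose[OF vd' this]
      have "(\<lambda>n. (\<Phi> (of_real (x + \<rho> (k n) * s)) - \<Phi> (of_real x)) /\<^sub>R (\<rho> (k n) * s)) \<longlonglongrightarrow> d" .
      then have "(\<lambda>n. (\<Phi> (of_real (x + \<rho> (k n) * s)) - \<Phi> (of_real x)) /\<^sub>R (\<rho> (k n) * s) * of_real s) \<longlonglongrightarrow> d * of_real s"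
        by (intro tendsto_intros)
      moreover have "(\<Phi> (of_real (x + \<rho> (k n) * s)) - \<Phi> (of_real x)) /\<^sub>R (\<rho> (k n) * s) * of_real s = \<phi> (k n) (of_real s)" for n
        using \<rho>pos[of "k n"] False by (simp add: \<phi>_def scaleR_conv_of_real field_simps)
      ultimately show ?thesis using lim1 LIMSEQ_unique by simp
    qed
    have Uopen: "open U" unfolding U_def by (intro open_Int open_ball open_halfspace_Im_gt)
    have UK: "U \<subseteq> K" by (auto simp: U_def K_def)
    have arg: "0 < Im (of_real x + of_real (\<rho> n) * \<zeta>)" if "\<zeta> \<in> U" for n \<zeta>
      using that \<rho>pos[of n] by (auto simp: U_def)
    have hol\<phi>: "\<phi> n holomorphic_on U" for n
    proof -
      have "(\<Phi> \<circ> (\<lambda>\<zeta>. of_real x + of_real (\<rho> n) * \<zeta>)) holomorphic_on U"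
        by (rule holomorphic_on_compose_gen[OF _ hol]) (use arg in \<open>auto intro!: holomorphic_intros\<close>)
      then show ?thesis unfolding \<phi>_def comp_def
        using \<rho>pos[of n] by (intro holomorphic_intros) auto
    qed
    have iU: "\<i> \<in> U" by (simp add: U_def)
    have deriv\<phi>: "deriv (\<phi> n) \<i> = deriv \<Phi> (Complex x (\<rho> n))" for n
    proof (rule DERIV_imp_deriv)
      have z: "of_real x + of_real (\<rho> n) * \<i> = Complex x (\<rho> n)" by (simp add: complex_eq_iff)
      have "(\<Phi> has_field_derivative deriv \<Phi> (Complex x (\<rho> n))) (at (of_real x + of_real (\<rho> n) * \<i>))"
        unfolding z using \<rho>pos[of n]
        by (intro holomorphic_derivI[OF hol open_halfspace_Im_gt]) simp
      then have "((\<lambda>\<zeta>. \<Phi> (of_real x + of_real (\<rho> n) * \<zeta>)) has_field_derivative deriv \<Phi> (Complex x (\<rho> n)) * of_real (\<rho> n)) (at \<i>)"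
        by (rule DERIV_chain2) (auto intro!: derivative_eq_intros)
      then show "(\<phi> n has_field_derivative deriv \<Phi> (Complex x (\<rho> n))) (at \<i>)"
        unfolding \<phi>_def using \<rho>pos[of n] by (auto intro!: derivative_eq_intros)
    qed
    have unifU: "uniform_limit U (\<lambda>n. \<phi> (k n)) \<Psi> sequentially"
      using unif UK by (rule uniform_limit_on_subset)
    have "(\<lambda>n. deriv (\<phi> (k n)) \<i>) \<longlonglongrightarrow> deriv \<Psi> \<i>"
      using unifU hol\<phi> Uopen iU by (intro deriv_complex_uniform_limit[where A = U]) auto
    then have lim_deriv: "(\<lambda>n. deriv \<Phi> (Complex x (\<rho> (k n)))) \<longlonglongrightarrow> deriv \<Psi> \<i>"
      by (simp add: deriv\<phi>)
    have hol\<Psi>: "\<Psi> holomorphic_on U"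
    proof (rule holomorphic_uniform_sequence[OF Uopen, of "\<lambda>n. \<phi> (k n)"])
      show "\<exists>d. 0 < d \<and> cball z d \<subseteq> U \<and> uniform_limit (cball z d) (\<lambda>n. \<phi> (k n)) \<Psi> sequentially" if "z \<in> U" for z
        
      proof -
        have "\<exists>d>0. cball z d \<subseteq> U" using Uopen \<open>z \<in> U\<close> by (simp add: open_contains_cball)
        then show ?thesis using uniform_limit_on_subset[OF unifU] by blast
      qed
    qed (rule hol\<phi>)
    \<comment> \<open>The difference between the limit and the linear map vanishes on the real axis, so it
      extends holomorphically by zero to the lower half plane.\<close>
    define h where "h \<zeta> = (if 0 \<le> Im \<zeta> then \<Psi> \<zeta> - d * \<zeta> else 0)" for \<zeta>
    have "continuous_on (K \<union> (cball 0 2 \<inter> {z. Im z \<le> 0})) h"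
      unfolding h_def
    proof (rule continuous_on_If)
      show "closed K" using compK by (rule compact_imp_closed)
      show "closed (cball 0 2 \<inter> {z. Im z \<le> 0})" by (intro closed_Int closed_cball closed_halfspace_Im_le)
      show "continuous_on K (\<lambda>\<zeta>. \<Psi> \<zeta> - d * \<zeta>)" using \<Psi>(1) by (intro continuous_intros)
      show "\<Psi> \<zeta> - d * \<zeta> = 0" if "\<zeta> \<in> cball 0 2 \<inter> {z. Im z \<le> 0}" "0 \<le> Im \<zeta>" for \<zeta>
      proof -
        have "\<zeta> = of_real (Re \<zeta>)" using that by (simp add: complex_eq_iff)
        moreover have "\<zeta> \<in> K" using that by (auto simp: K_def)
        ultimately show ?thesis using real_line[of "Re \<zeta>"] by auto
      qed
    qed (auto simp: K_def)
    then have conth: "continuous_on (ball 0 2) h"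
      by (rule continuous_on_subset) (auto simp: K_def)
    have "(\<lambda>\<zeta>. \<Psi> \<zeta> - d * \<zeta>) holomorphic_on U" by (intro holomorphic_intros hol\<Psi>)
    then have "h holomorphic_on U" by (rule holomorphic_transform) (simp add: h_def U_def)
    then have holh: "h holomorphic_on (ball 0 2 \<inter> {z. 0 < Im z})" unfolding U_def .
    have hbelow: "h z = 0" if "Im z < 0" for z using that by (simp add: h_def)
    have \<Psi>_eq: "\<Psi> \<zeta> = d * \<zeta>" if "\<zeta> \<in> U" for \<zeta>
    proof -
      have \<zeta>: "\<zeta> \<in> ball 0 2" "0 < Im \<zeta>" using that unfolding U_def by blast+
      have "h \<zeta> = 0" by (rule zero_of_zero_below_real_axis[OF holh conth hbelow \<zeta>(1)])
      then show ?thesis using \<zeta>(2) by (simp add: h_def)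
    qed
    have "((\<lambda>\<zeta>. d * \<zeta>) has_field_derivative d) (at \<i>)" by (rule DERIV_cmult_Id)
    then have "(\<Psi> has_field_derivative d) (at \<i>)"
      by (rule has_field_derivative_transform_within_open[OF _ Uopen iU]) (simp add: \<Psi>_eq)
    then have "deriv \<Psi> \<i> = d" by (rule DERIV_imp_deriv)
    with lim_deriv have "(\<lambda>n. deriv \<Phi> (Complex x (\<rho> (k n)))) \<longlonglongrightarrow> d" by simp
    from tendsto_dist[OF this tendsto_const[of d]]
    have "(\<lambda>n. dist (deriv \<Phi> (Complex x (\<rho> (k n)))) d) \<longlonglongrightarrow> 0" by simp
    then have "e \<le> 0" using far by (intro LIMSEQ_le_const) auto
    with e(1) show False by simp
  qed
qed simp

lemma AE_lebesgue_iff_negligible: "(AE x in lebesgue. P x) \<longleftrightarrow> negligible {x. \<not> P x}"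
  unfolding eventually_ae_filter space_completion space_lborel
  using negligible_iff_null_sets negligible_subset by (simp, blast)

text \<open>
  Fatou's theorem for the half plane: a primitive of \<open>F\<close> is Lipschitz, extends to the real axis, and
  is differentiable there almost everywhere.
\<close>

lemma bounded_holomorphic_radial_limit:
  fixes F :: "complex \<Rightarrow> complex"
  assumes hol: "F holomorphic_on upper_half_plane"
    and bound: "\<And>z. 0 < Im z \<Longrightarrow> norm (F z) \<le> B"
  shows "negligible {x. \<not> (\<exists>d. ((\<lambda>y. F (Complex x y)) \<longlongrightarrow> d) (at_right 0))}"
proof -
  have opn: "open upper_half_plane" by (rule open_halfspace_Im_gt)
  obtain \<Phi>0 where prim: "\<And>z. z \<in> upper_half_plane \<Longrightarrow> (\<Phi>0 has_field_derivative F z) (at z within upper_half_plane)"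
    using holomorphic_convex_primitive'[OF convex_halfspace_Im_gt opn hol] by blast
  have "0 \<le> B" using bound[of \<i>] norm_ge_zero[of "F \<i>"] by (simp del: norm_ge_zero)
  have "B-lipschitz_on upper_half_plane \<Phi>0"
  proof (rule lipschitz_onI)
    fix z z' assume "z \<in> upper_half_plane" "z' \<in> upper_half_plane"
    then have "norm (\<Phi>0 z - \<Phi>0 z') \<le> B * norm (z - z')"
      using bound by (intro field_differentiable_bound[OF convex_halfspace_Im_gt prim]) auto
    then show "dist (\<Phi>0 z) (\<Phi>0 z') \<le> B * dist z z'" by (simp add: dist_norm)
  qed fact
  then obtain \<Phi> where lip: "B-lipschitz_on {z. 0 \<le> Im z} \<Phi>" and ext: "\<And>z. 0 < Im z \<Longrightarrow> \<Phi> z = \<Phi>0 z"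
    using lipschitz_extend_closure[of B upper_half_plane \<Phi>0] unfolding closure_upper_half_plane by auto
  have der: "(\<Phi> has_field_derivative F z) (at z)" if "0 < Im z" for z
  proof (rule has_field_derivative_transform_within_open[OF _ opn])
    show "(\<Phi>0 has_field_derivative F z) (at z)" using prim[of z] that at_within_open[OF _ opn, of z] by simp
  qed (use that ext in auto)
  have hol\<Phi>: "\<Phi> holomorphic_on upper_half_plane"
    using der opn by (auto simp: holomorphic_on_open)
  have derivF: "deriv \<Phi> z = F z" if "0 < Im z" for z using der[OF that] by (rule DERIV_imp_deriv)
  have lipC: "norm (\<Phi> (of_real s) - \<Phi> (of_real t)) \<le> B * \<bar>s - t\<bar>" for s t
  proof -
    have "norm (\<Phi> (of_real s) - \<Phi> (of_real t)) \<le> B * norm (complex_of_real s - of_real t)"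
      by (rule lipschitz_on_normD[OF lip]) auto
    also have "norm (complex_of_real s - of_real t) = \<bar>s - t\<bar>" by (metis norm_of_real of_real_diff)
    finally show ?thesis .
  qed
  have lipRe: "B-lipschitz_on UNIV (\<lambda>t. Re (\<Phi> (of_real t)))"
  proof (rule lipschitz_onI)
    show "dist (Re (\<Phi> (of_real s))) (Re (\<Phi> (of_real t))) \<le> B * dist s t" for s t
      using lipC[of s t] abs_Re_le_cmod[of "\<Phi> (of_real s) - \<Phi> (of_real t)"] by (simp add: dist_real_def)
  qed fact
  have lipIm: "B-lipschitz_on UNIV (\<lambda>t. Im (\<Phi> (of_real t)))"
  proof (rule lipschitz_onI)
    show "dist (Im (\<Phi> (of_real s))) (Im (\<Phi> (of_real t))) \<le> B * dist s t" for s t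
      using lipC[of s t] abs_Im_le_cmod[of "\<Phi> (of_real s) - \<Phi> (of_real t)"] by (simp add: dist_real_def)
  qed fact
  let ?R = "{t. \<not> (\<lambda>t. Re (\<Phi> (of_real t))) differentiable at t}"
  let ?I = "{t. \<not> (\<lambda>t. Im (\<Phi> (of_real t))) differentiable at t}"
  have "negligible (?R \<union> ?I)"
    using lipRe lipIm by (intro negligible_Un negligible_not_differentiable_lipschitz)
  moreover have "\<exists>d. ((\<lambda>y. F (Complex x y)) \<longlongrightarrow> d) (at_right 0)" if "x \<notin> ?R \<union> ?I" for x
  proof -
    obtain u v where uv: "((\<lambda>t. Re (\<Phi> (of_real t))) has_real_derivative u) (at x)"
      "((\<lambda>t. Im (\<Phi> (of_real t))) has_real_derivative v) (at x)"
      using \<open>x \<notin> ?R \<union> ?I\<close> by (auto simp: real_differentiable_def)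
    then have "((\<lambda>t. \<Phi> (of_real t)) has_vector_derivative Complex u v) (at x)"
      by (simp add: has_vector_derivative_complex_iff)
    from deriv_tendsto_boundary_derivative[OF lip hol\<Phi> this]
    have lim: "((\<lambda>y. deriv \<Phi> (Complex x y)) \<longlongrightarrow> Complex u v) (at_right 0)" .
    have ev: "eventually (\<lambda>y. deriv \<Phi> (Complex x y) = F (Complex x y)) (at_right 0)"
      unfolding eventually_at_right_field by (intro exI[of _ 1]) (simp add: derivF)
    show ?thesis using Lim_transform_eventually[OF lim ev] by blast
  qed
  ultimately show ?thesis by (elim negligible_subset) blast
qed

section \<open>Radial limits of a Herglotz function\<close>

text \<open>
  Near zero \<open>\<i> * \<theta>\<close> differs from a continuous logarithm by a continuous function with values in a
  discrete set, hence by a constant.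
\<close>

lemma tendsto_of_exp_tendsto:
  fixes \<theta> :: "real \<Rightarrow> complex"
  assumes cont: "continuous_on {0<..} \<theta>"
    and lim: "((\<lambda>y. exp (\<i> * \<theta> y)) \<longlongrightarrow> d) (at_right 0)" and "d \<noteq> 0"
  shows "\<exists>c. (\<theta> \<longlongrightarrow> c) (at_right 0)"
proof -
  \<comment> \<open>Dividing by \<open>d\<close> moves the limit to one, away from the branch cut of \<open>Ln\<close>.\<close>
  define \<psi> where "\<psi> y = exp (\<i> * \<theta> y) / d" for y
  have \<psi>lim: "(\<psi> \<longlongrightarrow> 1) (at_right 0)"
    using tendsto_divide[OF lim tendsto_const[of d]] \<open>d \<noteq> 0\<close> by (simp add: \<psi>_def[abs_def])
  then have "eventually (\<lambda>y. dist (\<psi> y) 1 < 1) (at_right 0)" by (rule tendstoD) simp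
  then obtain \<delta> where \<delta>: "\<delta> > 0" "\<And>y. 0 < y \<Longrightarrow> y < \<delta> \<Longrightarrow> dist (\<psi> y) 1 < 1"
    unfolding eventually_at_right_field by blast
  have nonpos: "\<psi> y \<notin> \<real>\<^sub>\<le>\<^sub>0" if "y \<in> {0<..<\<delta>}" for y
  proof
    assume "\<psi> y \<in> \<real>\<^sub>\<le>\<^sub>0"
    then have "Re (\<psi> y) \<le> 0" by (simp add: complex_nonpos_Reals_iff)
    then have "1 \<le> norm (\<psi> y - 1)" using abs_Re_le_cmod[of "\<psi> y - 1"] by simp
    with \<delta>(2)[of y] that show False by (simp add: dist_norm)
  qed
  have \<psi>cont: "continuous_on {0<..<\<delta>} \<psi>"
    unfolding \<psi>_def using \<open>d \<noteq> 0\<close>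
    by (intro continuous_intros continuous_on_subset[OF cont]) auto
  define c0 where "c0 = Ln d"
  \<comment> \<open>The number of turns by which \<open>Ln\<close> misses the continuous logarithm of \<open>\<psi>\<close>.\<close>
  define n where "n y = (\<i> * \<theta> y - c0 - Ln (\<psi> y)) / (2 * of_real pi * \<i>)" for y
  have nint: "n y \<in> \<int>" if "y \<in> {0<..<\<delta>}" for y
  proof -
    have "\<psi> y \<noteq> 0" using nonpos[OF that] by auto
    then have "exp (\<i> * \<theta> y - c0 - Ln (\<psi> y)) = 1"
      using \<open>d \<noteq> 0\<close> by (simp add: exp_diff c0_def) (simp add: \<psi>_def)
    then obtain m :: int where "\<i> * \<theta> y - c0 - Ln (\<psi> y) = of_int (2 * m) * of_real pi * \<i>"
      unfolding exp_eq_1 by (auto simp: complex_eq_iff)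
    then have "n y = of_int m" by (simp add: n_def)
    then show ?thesis by simp
  qed
  have "n constant_on {0<..<\<delta>}"
  proof (rule continuous_discrete_range_constant)
    show "connected {0<..<\<delta>}" by simp
    show "continuous_on {0<..<\<delta>} n"
      unfolding n_def using nonpos
      by (intro continuous_intros \<psi>cont continuous_on_subset[OF cont]) auto
    fix y assume y: "y \<in> {0<..<\<delta>}"
    have "1 \<le> norm (n y' - n y)" if y': "y' \<in> {0<..<\<delta>}" "n y' \<noteq> n y" for y'
    proof -
      obtain a where a: "n y' = of_int a" using nint[OF y'(1)] by (rule Ints_cases)
      obtain b where b: "n y = of_int b" using nint[OF y] by (rule Ints_cases)
      have "a \<noteq> b" using a b y'(2) by auto
      then have "1 \<le> \<bar>a - b\<bar>" by linarith
      then have "1 \<le> \<bar>real_of_int (a - b)\<bar>" by linarith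
      moreover have "n y' - n y = of_int (a - b)" using a b by simp
      ultimately show ?thesis by (simp only: norm_of_int)
    qed
    then show "\<exists>e>0. \<forall>y'. y' \<in> {0<..<\<delta>} \<and> n y' \<noteq> n y \<longrightarrow> e \<le> norm (n y' - n y)"
      by (intro exI[of _ 1]) simp
  qed
  then obtain m where m: "\<And>y. y \<in> {0<..<\<delta>} \<Longrightarrow> n y = m" unfolding constant_on_def by blast
  have "((\<lambda>y. (Ln (\<psi> y) + c0 + m * (2 * of_real pi * \<i>)) / \<i>) \<longlongrightarrow> (Ln 1 + c0 + m * (2 * of_real pi * \<i>)) / \<i>) (at_right 0)"
    by (intro tendsto_intros \<psi>lim) auto
  moreover have "eventually (\<lambda>y. (Ln (\<psi> y) + c0 + m * (2 * of_real pi * \<i>)) / \<i> = \<theta> y) (at_right 0)"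
    unfolding eventually_at_right_field
  proof (intro exI[of _ \<delta>] conjI allI impI)
    fix y assume "0 < y" "y < \<delta>"
    then have "n y = m" by (intro m) simp
    then have "\<i> * \<theta> y - c0 - Ln (\<psi> y) = m * (2 * of_real pi * \<i>)" by (simp add: n_def field_simps)
    then have "Ln (\<psi> y) + c0 + m * (2 * of_real pi * \<i>) = \<i> * \<theta> y" by (simp add: algebra_simps)
    then show "(Ln (\<psi> y) + c0 + m * (2 * of_real pi * \<i>)) / \<i> = \<theta> y" by simp
  qed (use \<delta> in auto)
  ultimately show ?thesis using Lim_transform_eventually by blast
qed

text \<open>
  The radial limit of \<open>exp (\<i> * g)\<close> exists almost everywhere and determines that of \<open>g\<close> unless it is
  zero, that is, unless \<open>Im g\<close> tends to infinity. The fundamental theorem of calculus bounds the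
  integral of \<open>Im g\<close> over each horizontal segment by \<open>2 * M\<close>, and Fatou's lemma excludes that case almost everywhere.
\<close>

lemma herglotz_derivative_radial_limit:
  fixes w g :: "complex \<Rightarrow> complex"
  assumes der: "\<And>z. 0 < Im z \<Longrightarrow> (w has_field_derivative g z) (at z)"
    and hol: "g holomorphic_on upper_half_plane"
    and pos: "\<And>z. 0 < Im z \<Longrightarrow> 0 \<le> Im (g z)"
    and bound: "\<And>z. 0 < Im z \<Longrightarrow> \<bar>Im (w z)\<bar> \<le> M"
  shows "negligible {x. \<not> (\<exists>c. ((\<lambda>y. g (Complex x y)) \<longlongrightarrow> c) (at_right 0))}"
proof -
  have contg: "continuous_on upper_half_plane g" using hol by (rule holomorphic_on_imp_continuous_on)
  let ?N1 = "{x. \<not> (\<exists>d. ((\<lambda>y. exp (\<i> * g (Complex x y))) \<longlongrightarrow> d) (at_right 0))}"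
  have N1: "negligible ?N1"
  proof (rule bounded_holomorphic_radial_limit[where F = "\<lambda>z. exp (\<i> * g z)" and B = 1])
    show "(\<lambda>z. exp (\<i> * g z)) holomorphic_on upper_half_plane" by (intro holomorphic_intros hol)
    show "norm (exp (\<i> * g z)) \<le> 1" if "0 < Im z" for z using pos[OF that] by simp
  qed
  define y where "y n = inverse (real (Suc n))" for n
  have ypos: "0 < y n" for n by (simp add: y_def)
  have conty: "continuous_on UNIV (\<lambda>x. Im (g (Complex x (y n))))" for n
    using ypos[of n] by (intro continuous_intros continuous_on_compose2[OF contg]) (auto simp: Complex_eq intro!: continuous_intros)
  have meas [measurable]: "(\<lambda>x. Im (g (Complex x (y n)))) \<in> borel_measurable borel" for n
    using conty by (rule borel_measurable_continuous_onI)
  have int: "(\<integral>\<^sup>+x\<in>{-R..R}. ennreal (Im (g (Complex x (y n)))) \<partial>lborel) \<le> ennreal (2 * M)" if "R \<ge> 0" for n R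
  proof -
    have d: "((\<lambda>x. Im (w (Complex x (y n)))) has_real_derivative Im (g (Complex x (y n)))) (at x)" for x
    proof -
      have "((\<lambda>x. w (Complex x (y n))) has_vector_derivative 1 * g (Complex x (y n))) (at x)"
      proof (rule field_vector_diff_chain_at[where f = "\<lambda>x. Complex x (y n)" and g = w, unfolded o_def])
        show "((\<lambda>x. Complex x (y n)) has_vector_derivative 1) (at x)"
          by (auto simp: has_vector_derivative_complex_iff intro!: derivative_eq_intros)
        show "(w has_field_derivative g (Complex x (y n))) (at (Complex x (y n)))"
          using ypos[of n] by (intro der) simp
      qed
      then show ?thesis by (simp add: has_vector_derivative_complex_iff)
    qed
    have "(\<integral>\<^sup>+x\<in>{-R..R}. ennreal (Im (g (Complex x (y n)))) \<partial>lborel)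
        = ennreal (Im (w (Complex R (y n))) - Im (w (Complex (-R) (y n))))"
      by (rule nn_integral_FTC_Icc) (use d pos ypos that in auto)
    also have "\<dots> \<le> ennreal (2 * M)"
      using bound[of "Complex R (y n)"] bound[of "Complex (-R) (y n)"] ypos[of n] by (intro ennreal_leI) simp
    finally show ?thesis .
  qed
  define l where "l x = liminf (\<lambda>n. ennreal (Im (g (Complex x (y n)))))" for x
  have lmeas [measurable]: "l \<in> borel_measurable borel" unfolding l_def by measurable
  have AEl: "AE x in lborel. l x * indicator {- real R..real R} x \<noteq> \<infinity>" for R :: nat
  proof (rule nn_integral_PInf_AE)
    have "(\<integral>\<^sup>+x. l x * indicator {- real R..real R} x \<partial>lborel)
        = (\<integral>\<^sup>+x. liminf (\<lambda>n. ennreal (Im (g (Complex x (y n)))) * indicator {- real R..real R} x) \<partial>lborel)"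
      by (intro nn_integral_cong) (auto simp: l_def Liminf_const split: split_indicator)
    also have "\<dots> \<le> liminf (\<lambda>n. \<integral>\<^sup>+x\<in>{- real R..real R}. ennreal (Im (g (Complex x (y n)))) \<partial>lborel)"
      by (rule nn_integral_liminf) measurable
    also have "\<dots> \<le> ennreal (2 * M)"
      using int[of "real R"] by (intro order_trans[OF Liminf_le_Limsup Limsup_bounded]) auto
    finally show "(\<integral>\<^sup>+x. l x * indicator {- real R..real R} x \<partial>lborel) \<noteq> \<infinity>" by (auto simp: top_unique)
  qed measurable
  then have "AE x in lborel. \<forall>R::nat. l x * indicator {- real R..real R} x \<noteq> \<infinity>"
    by (simp add: AE_all_countable)
  then have "AE x in lborel. l x \<noteq> \<infinity>"
  proof eventually_elim
    case (elim x)
    obtain R :: nat where "\<bar>x\<bar> < real R" using reals_Archimedean2 by blast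
    then have "x \<in> {- real R..real R}" by auto
    with elim[rule_format, of R] show ?case by simp
  qed
  then have "AE x in lebesgue. l x \<noteq> \<infinity>" by (rule AE_completion)
  then have N2: "negligible {x. l x = \<infinity>}"
    by (simp add: AE_lebesgue_iff_negligible)
  have "\<exists>c. ((\<lambda>y. g (Complex x y)) \<longlongrightarrow> c) (at_right 0)" if x: "x \<notin> ?N1" "l x \<noteq> \<infinity>" for x
  proof -
    obtain d where d: "((\<lambda>y. exp (\<i> * g (Complex x y))) \<longlongrightarrow> d) (at_right 0)" using x(1) by blast
    have "d \<noteq> 0"
    proof
      assume "d = 0"
      have "filterlim y (at_right 0) sequentially"
        unfolding filterlim_at y_def using LIMSEQ_inverse_real_of_nat by (auto simp: eventually_sequentially)
      from filterlim_compose[OF d this] have "(\<lambda>n. exp (\<i> * g (Complex x (y n)))) \<longlonglongrightarrow> 0"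
        using \<open>d = 0\<close> by simp
      then have e: "(\<lambda>n. exp (- Im (g (Complex x (y n))))) \<longlonglongrightarrow> 0" using tendsto_norm_zero by fastforce
      have "ennreal K \<le> l x" for K
        unfolding l_def
      proof (rule Liminf_bounded)
        have "eventually (\<lambda>n. exp (- Im (g (Complex x (y n)))) < exp (- K)) sequentially"
          using e by (rule order_tendstoD) simp
        then show "eventually (\<lambda>n. ennreal K \<le> ennreal (Im (g (Complex x (y n))))) sequentially"
          by eventually_elim (simp add: ennreal_leI)
      qed
      moreover obtain K where "l x = ennreal K" "K \<ge> 0" using x(2) by (cases "l x") auto
      ultimately have "ennreal (K + 1) \<le> ennreal K" by metis
      then show False using \<open>K \<ge> 0\<close> by (simp add: ennreal_le_iff)
    qed
    moreover have "continuous_on {0<..} (\<lambda>y. g (Complex x y))"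
      by (intro continuous_on_compose2[OF contg]) (auto simp: Complex_eq intro!: continuous_intros)
    ultimately show ?thesis using tendsto_of_exp_tendsto d by blast
  qed
  then have "{x. \<not> (\<exists>c. ((\<lambda>y. g (Complex x y)) \<longlongrightarrow> c) (at_right 0))} \<subseteq> ?N1 \<union> {x. l x = \<infinity>}" by blast
  then show ?thesis using negligible_Un[OF N1 N2] negligible_subset by blast
qed

section \<open>From radial limits to cones\<close>

text \<open>
  The Schwarz lemma for \<open>g\<close>, rescaled to the disc of radius \<open>Im z0\<close> around \<open>z0\<close> and composed with the
  Cayley transform that sends \<open>g z0\<close> to zero.
\<close>

lemma herglotz_schwarz_pick:
  fixes g :: "complex \<Rightarrow> complex"
  assumes hol: "g holomorphic_on upper_half_plane"
    and pos: "\<And>z. 0 < Im z \<Longrightarrow> 0 < Im (g z)"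
    and z0: "0 < Im z0" and z: "norm (z - z0) \<le> \<rho> * Im z0" and \<rho>: "0 \<le> \<rho>" "\<rho> \<le> 1 / 2"
  shows "norm (g z - g z0) \<le> 4 * \<rho> * Im (g z0)"
proof -
  define y where "y = Im z0"
  have y: "y > 0" using z0 by (simp add: y_def)
  define \<phi> where "\<phi> \<zeta> = (g (z0 + of_real y * \<zeta>) - g z0) / (g (z0 + of_real y * \<zeta>) - cnj (g z0))" for \<zeta>
  have arg: "0 < Im (z0 + of_real y * \<zeta>)" if "norm \<zeta> < 1" for \<zeta>
  proof -
    have "\<bar>Im \<zeta>\<bar> < 1" using abs_Im_le_cmod[of \<zeta>] that by linarith
    then have "0 < y * (1 + Im \<zeta>)" using y by (intro mult_pos_pos) auto
    then show ?thesis by (simp add: y_def[symmetric] algebra_simps)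
  qed
  have ne: "g u - cnj (g z0) \<noteq> 0" if "0 < Im u" for u
  proof
    assume "g u - cnj (g z0) = 0"
    then have "Im (g u) + Im (g z0) = 0" by (simp add: complex_eq_iff)
    then show False using pos[OF that] pos[OF z0] by linarith
  qed
  define \<zeta> where "\<zeta> = (z - z0) / of_real y"
  have \<zeta>: "norm \<zeta> \<le> \<rho>" using z y by (simp add: \<zeta>_def norm_divide pos_divide_le_eq y_def)
  then have \<zeta>1: "norm \<zeta> < 1" using \<rho> by linarith
  have "norm (\<phi> \<zeta>) \<le> norm \<zeta>"
  proof (rule Schwarz_Lemma(1)[OF _ _ _ \<zeta>1])
    have "(g \<circ> (\<lambda>\<zeta>. z0 + of_real y * \<zeta>)) holomorphic_on ball 0 1"
    proof (rule holomorphic_on_compose_gen[OF _ hol])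
      show "(\<lambda>\<zeta>. z0 + of_real y * \<zeta>) ` ball 0 1 \<subseteq> upper_half_plane" using arg by auto
    qed (intro holomorphic_intros)
    then show "\<phi> holomorphic_on ball 0 1"
      unfolding \<phi>_def comp_def using ne[OF arg] by (intro holomorphic_intros) auto
    show "\<phi> 0 = 0" by (simp add: \<phi>_def)
    fix \<xi> :: complex assume "norm \<xi> < 1"
    define a where "a = g (z0 + of_real y * \<xi>)"
    have a: "0 < Im a" unfolding a_def by (intro pos arg) fact
    have "(norm (a - cnj (g z0)))\<^sup>2 = (norm (a - g z0))\<^sup>2 + 4 * Im a * Im (g z0)"
      unfolding cmod_power2 by (simp add: power2_eq_square algebra_simps)
    moreover have "0 < 4 * Im a * Im (g z0)" using a pos[OF z0] by simp
    ultimately have "(norm (a - g z0))\<^sup>2 < (norm (a - cnj (g z0)))\<^sup>2" by linarith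
    then have "norm (a - g z0) < norm (a - cnj (g z0))" by (rule power2_less_imp_less) simp
    then have "norm ((a - g z0) / (a - cnj (g z0))) < 1"
      by (simp add: norm_divide divide_less_eq)
    then show "norm (\<phi> \<xi>) < 1" by (simp add: \<phi>_def a_def)
  qed
  then have "norm (\<phi> \<zeta>) \<le> \<rho>" using \<zeta> by linarith
  moreover have z_eq: "z0 + of_real y * \<zeta> = z" using y by (simp add: \<zeta>_def)
  moreover have "0 < Im z" using arg[OF \<zeta>1] z_eq by simp
  ultimately have "norm (g z - g z0) \<le> \<rho> * norm (g z - cnj (g z0))"
    using ne[of z] by (simp add: \<phi>_def norm_divide pos_divide_le_eq)
  also have "g z - cnj (g z0) = (g z - g z0) + 2 * \<i> * of_real (Im (g z0))" by (simp add: complex_eq_iff)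
  also have "\<rho> * norm \<dots> \<le> \<rho> * (norm (g z - g z0) + 2 * Im (g z0))"
  proof (intro mult_left_mono \<rho>)
    have "norm (2 * \<i> * of_real (Im (g z0))) = 2 * Im (g z0)" using pos[OF z0] by (simp add: norm_mult)
    then show "norm ((g z - g z0) + 2 * \<i> * of_real (Im (g z0))) \<le> norm (g z - g z0) + 2 * Im (g z0)"
      using norm_triangle_ineq[of "g z - g z0" "2 * \<i> * of_real (Im (g z0))"] by linarith
  qed
  also have "\<dots> \<le> norm (g z - g z0) / 2 + 2 * \<rho> * Im (g z0)"
    using mult_right_mono[OF \<rho>(2), of "norm (g z - g z0)"] by (simp add: algebra_simps)
  finally show ?thesis by simp
qed

definition radially_stable :: "(complex \<Rightarrow> complex) \<Rightarrow> real \<Rightarrow> real \<Rightarrow> real set" where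
  "radially_stable g \<epsilon> \<delta> = {x. \<forall>y\<in>{0<..\<delta>}. \<forall>y'\<in>{0<..\<delta>}. norm (g (Complex x y) - g (Complex x y')) \<le> \<epsilon>}"

lemma continuous_on_horizontal:
  assumes "continuous_on upper_half_plane g" "0 < y"
  shows "continuous_on UNIV (\<lambda>x. g (Complex x y))"
proof -
  have "continuous_on UNIV (\<lambda>x. Complex x y)" unfolding Complex_eq by (intro continuous_intros)
  then show ?thesis by (rule continuous_on_compose2[OF assms(1)]) (use assms in auto)
qed

lemma closed_radially_stable:
  assumes "continuous_on upper_half_plane g"
  shows "closed (radially_stable g \<epsilon> \<delta>)"
proof -
  have "radially_stable g \<epsilon> \<delta> = (\<Inter>y\<in>{0<..\<delta>}. \<Inter>y'\<in>{0<..\<delta>}. {x. norm (g (Complex x y) - g (Complex x y')) \<le> \<epsilon>})"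
    by (auto simp: radially_stable_def)
  also have "closed \<dots>"
  proof (intro closed_INT ballI closed_Collect_le)
    fix y y' assume "y \<in> {0<..\<delta>}" "y' \<in> {0<..\<delta>}"
    then show "continuous_on UNIV (\<lambda>x. norm (g (Complex x y) - g (Complex x y')))"
      by (intro continuous_intros continuous_on_horizontal assms) auto
  qed (intro continuous_intros)
  finally show ?thesis .
qed

text \<open>
  Over points of the stable set near \<open>x\<close>, the function \<open>g\<close> is close to \<open>G\<close>: go up to height \<open>\<delta>\<close>, move
  horizontally by continuity, and come down. Density makes every point of the cone hyperbolically
  close to such a vertical, and \<open>herglotz_schwarz_pick\<close> bounds the change of \<open>g\<close>.
\<close>

lemma radial_limit_imp_cone_estimate:
  fixes g :: "complex \<Rightarrow> complex"
  assumes hol: "g holomorphic_on upper_half_plane"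
    and pos: "\<And>z. 0 < Im z \<Longrightarrow> 0 < Im (g z)"
    and lim: "((\<lambda>y. g (Complex x y)) \<longlongrightarrow> G) (at_right 0)"
    and stab: "x \<in> radially_stable g \<epsilon> \<delta>" and dens: "density_point (radially_stable g \<epsilon> \<delta>) x"
    and \<epsilon>: "0 < \<epsilon>" and \<delta>: "0 < \<delta>"
  shows "\<exists>\<eta>>0. \<forall>s y. 0 < y \<longrightarrow> y < \<eta> \<longrightarrow> \<bar>s\<bar> \<le> y \<longrightarrow> norm (g (Complex (x + s) y) - G) \<le> 4 * \<epsilon>"
proof -
  let ?S = "radially_stable g \<epsilon> \<delta>"
  have cont: "continuous_on UNIV (\<lambda>x. g (Complex x \<delta>))"
    using holomorphic_on_imp_continuous_on[OF hol] \<delta> by (rule continuous_on_horizontal)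
  have near: "norm (g (Complex x \<delta>) - G) \<le> \<epsilon>"
  proof (rule tendsto_upperbound)
    show "((\<lambda>y. norm (g (Complex x \<delta>) - g (Complex x y))) \<longlongrightarrow> norm (g (Complex x \<delta>) - G)) (at_right 0)"
      by (intro tendsto_intros lim)
    show "eventually (\<lambda>y. norm (g (Complex x \<delta>) - g (Complex x y)) \<le> \<epsilon>) (at_right 0)"
      unfolding eventually_at_right_field using stab \<delta> by (intro exI[of _ \<delta>]) (auto simp: radially_stable_def)
  qed simp
  obtain \<eta>1 where \<eta>1: "\<eta>1 > 0" "\<And>t. dist t x < \<eta>1 \<Longrightarrow> dist (g (Complex t \<delta>)) (g (Complex x \<delta>)) < \<epsilon>"
    using cont \<epsilon> unfolding continuous_on_iff by (metis UNIV_I)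
  have on_S: "norm (g (Complex t y) - G) \<le> 3 * \<epsilon>" if "t \<in> ?S" "\<bar>t - x\<bar> < \<eta>1" "0 < y" "y \<le> \<delta>" for t y
  proof -
    have "norm (g (Complex t y) - g (Complex t \<delta>)) \<le> \<epsilon>" using that \<delta> by (auto simp: radially_stable_def)
    moreover have "norm (g (Complex t \<delta>) - g (Complex x \<delta>)) < \<epsilon>"
      using \<eta>1(2)[of t] that(2) by (simp add: dist_norm)
    ultimately show ?thesis
      using near dist_triangle[of "g (Complex t y)" G "g (Complex t \<delta>)"]
        dist_triangle[of "g (Complex t \<delta>)" G "g (Complex x \<delta>)"] unfolding dist_norm by linarith
  qed
  define B where "B = norm G + 3 * \<epsilon>"
  have B: "0 < B" using \<epsilon> by (simp add: B_def add_nonneg_pos)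
  \<comment> \<open>A shift by \<open>\<rho> * y\<close> at height \<open>y\<close> then changes \<open>g\<close> by at most \<open>4 * \<rho> * B \<le> \<epsilon>\<close>.\<close>
  define \<rho> where "\<rho> = min (1 / 2) (\<epsilon> / (4 * B))"
  have \<rho>: "0 < \<rho>" "\<rho> \<le> 1 / 2" "4 * \<rho> * B \<le> \<epsilon>"
  proof -
    have "\<rho> \<le> \<epsilon> / (4 * B)" by (simp add: \<rho>_def)
    then show "4 * \<rho> * B \<le> \<epsilon>" using B by (simp add: pos_le_divide_eq mult_ac)
  qed (use \<epsilon> B in \<open>simp_all add: \<rho>_def\<close>)
  have "0 < \<rho> / 4" using \<rho> by simp
  then obtain \<eta>2 where \<eta>2: "\<eta>2 > 0" "\<And>r. 0 < r \<Longrightarrow> r < \<eta>2 \<Longrightarrow> measure lebesgue (cball x r - ?S) \<le> \<rho> / 4 * (2 * r)"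
    using dens unfolding density_point_def by blast
  have closedS: "closed ?S" using holomorphic_on_imp_continuous_on[OF hol] by (rule closed_radially_stable)
  show ?thesis
  proof (intro exI[of _ "min \<delta> (min (\<eta>1 / 2) (\<eta>2 / 2))"] conjI allI impI)
    show "0 < min \<delta> (min (\<eta>1 / 2) (\<eta>2 / 2))" using \<delta> \<eta>1 \<eta>2 by simp
    fix s y :: real assume y: "0 < y" "y < min \<delta> (min (\<eta>1 / 2) (\<eta>2 / 2))" and s: "\<bar>s\<bar> \<le> y"
    \<comment> \<open>The interval of radius \<open>\<rho> * y\<close> around \<open>x + s\<close> is too long to lie in the complement.\<close>
    have "\<exists>t\<in>?S. \<bar>t - (x + s)\<bar> \<le> \<rho> * y"
    proof (rule ccontr)
      assume none: "\<not> ?thesis"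
      have ry: "\<rho> * y \<le> y / 2" using \<rho>(2) y(1) by (simp add: field_simps)
      have "cball (x + s) (\<rho> * y) \<subseteq> cball x (2 * y) - ?S"
      proof
        fix t assume "t \<in> cball (x + s) (\<rho> * y)"
        then have t: "\<bar>t - (x + s)\<bar> \<le> \<rho> * y" by (simp add: dist_real_def abs_minus_commute)
        then have "t \<notin> ?S" using none by blast
        moreover have "\<bar>t - x\<bar> \<le> 2 * y" using t s ry by linarith
        ultimately show "t \<in> cball x (2 * y) - ?S" by (simp add: dist_real_def abs_minus_commute)
      qed
      then have "measure lebesgue (cball (x + s) (\<rho> * y)) \<le> measure lebesgue (cball x (2 * y) - ?S)"
        using closedS by (intro measure_mono_fmeasurable) (auto intro!: fmeasurable_Diff)
      also have "\<dots> \<le> \<rho> / 4 * (2 * (2 * y))" using y by (intro \<eta>2) auto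
      finally have "2 * (\<rho> * y) \<le> \<rho> * y"
        using \<rho>(1) y(1) by (simp add: cball_eq_atLeastAtMost)
      moreover have "0 < \<rho> * y" using \<rho>(1) y(1) by simp
      ultimately show False by linarith
    qed
    then obtain t where t: "t \<in> ?S" "\<bar>t - (x + s)\<bar> \<le> \<rho> * y" ..
    have ry: "\<rho> * y \<le> y / 2" using \<rho>(2) y(1) by (simp add: field_simps)
    have "\<bar>t - x\<bar> < \<eta>1" using t(2) s ry y by linarith
    then have c: "norm (g (Complex t y) - G) \<le> 3 * \<epsilon>" using on_S[OF t(1)] y by simp
    have "Im (g (Complex t y)) \<le> norm (g (Complex t y))" using abs_Im_le_cmod[of "g (Complex t y)"] by linarith
    also have "\<dots> \<le> B" using c norm_triangle_sub[of "g (Complex t y)" G] by (simp add: B_def)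
    finally have ImB: "Im (g (Complex t y)) \<le> B" .
    have "Complex (x + s) y - Complex t y = of_real (x + s - t)" by (simp add: complex_eq_iff)
    then have "norm (Complex (x + s) y - Complex t y) = \<bar>t - (x + s)\<bar>"
      by (simp only: norm_of_real abs_minus_commute)
    then have "norm (g (Complex (x + s) y) - g (Complex t y)) \<le> 4 * \<rho> * Im (g (Complex t y))"
      using t(2) \<rho> y(1) by (intro herglotz_schwarz_pick[OF hol pos]) auto
    also have "\<dots> \<le> 4 * \<rho> * B" using ImB \<rho> by (intro mult_left_mono) auto
    finally have "norm (g (Complex (x + s) y) - g (Complex t y)) \<le> \<epsilon>" using \<rho>(3) by linarith
    then show "norm (g (Complex (x + s) y) - G) \<le> 4 * \<epsilon>"
      using c norm_triangle_ineq[of "g (Complex (x + s) y) - g (Complex t y)" "g (Complex t y) - G"] by simp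
  qed
qed

section \<open>Approximate derivatives of boundary values\<close>

lemma vertical_increment_estimate:
  fixes w g :: "complex \<Rightarrow> complex"
  assumes der: "\<And>z. 0 < Im z \<Longrightarrow> (w has_field_derivative g z) (at z)"
    and close: "\<And>t. y' \<le> t \<Longrightarrow> t \<le> y \<Longrightarrow> norm (g (Complex x t) - c) \<le> \<epsilon>"
    and y: "0 < y'" "y' \<le> y"
  shows "norm (w (Complex x y) - w (Complex x y') - \<i> * of_real (y - y') * c) \<le> \<epsilon> * (y - y')"
proof -
  let ?seg = "closed_segment (Complex x y') (Complex x y)"
  have seg: "Re z = x \<and> y' \<le> Im z \<and> Im z \<le> y" if z: "z \<in> ?seg" for z
  proof -
    obtain u where u: "0 \<le> u" "u \<le> 1" "z = (1 - u) *\<^sub>R Complex x y' + u *\<^sub>R Complex x y"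
      using z unfolding closed_segment_def by blast
    have "Im z = y' + u * (y - y')" "Re z = x" unfolding u(3) by (simp_all add: algebra_simps)
    moreover have "0 \<le> u * (y - y')" using u y by simp
    moreover have "u * (y - y') \<le> 1 * (y - y')" using u y by (intro mult_right_mono) auto
    ultimately show ?thesis by simp
  qed
  have "norm ((w (Complex x y) - c * Complex x y) - (w (Complex x y') - c * Complex x y'))
      \<le> \<epsilon> * norm (Complex x y - Complex x y')"
  proof (rule field_differentiable_bound[of ?seg "\<lambda>z. w z - c * z" "\<lambda>z. g z - c"])
    fix z assume "z \<in> ?seg"
    note z = seg[OF this]
    have "((\<lambda>z. w z - c * z) has_field_derivative g z - c) (at z)"
      using z y(1) by (intro derivative_intros der DERIV_cmult_Id) auto
    then show "((\<lambda>z. w z - c * z) has_field_derivative g z - c) (at z within ?seg)"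
      by (rule has_field_derivative_at_within)
    have "z = Complex x (Im z)" using z by (simp add: complex_eq_iff)
    then show "norm (g z - c) \<le> \<epsilon>" using close[of "Im z"] z by simp
  qed auto
  moreover have "Complex x y - Complex x y' = \<i> * of_real (y - y')" by (simp add: complex_eq_iff)
  moreover from this have "norm (Complex x y - Complex x y') = y - y'"
    using y by (simp only: norm_mult norm_ii norm_of_real) simp
  moreover have "(w (Complex x y) - c * Complex x y) - (w (Complex x y') - c * Complex x y')
      = w (Complex x y) - w (Complex x y') - c * (Complex x y - Complex x y')"
    by (simp add: algebra_simps)
  ultimately show ?thesis by (simp only: mult.commute)
qed

lemma horizontal_increment_estimate:
  fixes w g :: "complex \<Rightarrow> complex"
  assumes der: "\<And>z. 0 < Im z \<Longrightarrow> (w has_field_derivative g z) (at z)"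
    and close: "\<And>s. \<bar>s\<bar> \<le> \<bar>h\<bar> \<Longrightarrow> norm (g (Complex (x + s) y) - c) \<le> \<epsilon>"
    and y: "0 < y"
  shows "norm (w (Complex (x + h) y) - w (Complex x y) - of_real h * c) \<le> \<epsilon> * \<bar>h\<bar>"
proof -
  let ?seg = "closed_segment (Complex x y) (Complex (x + h) y)"
  have seg: "Im z = y \<and> \<bar>Re z - x\<bar> \<le> \<bar>h\<bar>" if z: "z \<in> ?seg" for z
  proof -
    obtain u where u: "0 \<le> u" "u \<le> 1" "z = (1 - u) *\<^sub>R Complex x y + u *\<^sub>R Complex (x + h) y"
      using z unfolding closed_segment_def by blast
    have "Re z - x = u * h" "Im z = y" unfolding u(3) by (simp_all add: algebra_simps)
    moreover have "u * \<bar>h\<bar> \<le> 1 * \<bar>h\<bar>" using u by (intro mult_right_mono) auto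
    ultimately show ?thesis using u(1) by (simp add: abs_mult)
  qed
  have "norm ((w (Complex (x + h) y) - c * Complex (x + h) y) - (w (Complex x y) - c * Complex x y))
      \<le> \<epsilon> * norm (Complex (x + h) y - Complex x y)"
  proof (rule field_differentiable_bound[of ?seg "\<lambda>z. w z - c * z" "\<lambda>z. g z - c"])
    fix z assume "z \<in> ?seg"
    note z = seg[OF this]
    have "((\<lambda>z. w z - c * z) has_field_derivative g z - c) (at z)"
      using z y(1) by (intro derivative_intros der DERIV_cmult_Id) auto
    then show "((\<lambda>z. w z - c * z) has_field_derivative g z - c) (at z within ?seg)"
      by (rule has_field_derivative_at_within)
    have "z = Complex (x + (Re z - x)) y" using z by (simp add: complex_eq_iff)
    then show "norm (g z - c) \<le> \<epsilon>" using close[of "Re z - x"] z by simp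
  qed auto
  moreover have "Complex (x + h) y - Complex x y = of_real h" by (simp add: complex_eq_iff)
  moreover have "(w (Complex (x + h) y) - c * Complex (x + h) y) - (w (Complex x y) - c * Complex x y)
      = w (Complex (x + h) y) - w (Complex x y) - c * (Complex (x + h) y - Complex x y)"
    by (simp add: algebra_simps)
  ultimately show ?thesis by (simp only: mult.commute norm_of_real)
qed

lemma primitive_radial_limit:
  fixes w g :: "complex \<Rightarrow> complex"
  assumes der: "\<And>z. 0 < Im z \<Longrightarrow> (w has_field_derivative g z) (at z)"
    and lim: "((\<lambda>y. g (Complex x y)) \<longlongrightarrow> G) (at_right 0)"
  shows "\<exists>W. ((\<lambda>y. w (Complex x y)) \<longlongrightarrow> W) (at_right 0)"
proof -
  have "eventually (\<lambda>y. dist (g (Complex x y)) G < 1) (at_right 0)" using lim by (rule tendstoD) simp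
  then obtain \<delta> where \<delta>: "\<delta> > 0" "\<And>y. 0 < y \<Longrightarrow> y < \<delta> \<Longrightarrow> dist (g (Complex x y)) G < 1"
    unfolding eventually_at_right_field by blast
  define f where "f y = w (Complex x y) - \<i> * of_real y * G" for y
  have "norm (f y - f y') \<le> \<bar>y - y'\<bar>" if "y \<in> {0<..<\<delta>}" "y' \<in> {0<..<\<delta>}" "y' \<le> y" for y y'
  proof -
    have "norm (w (Complex x y) - w (Complex x y') - \<i> * of_real (y - y') * G) \<le> 1 * (y - y')"
    proof (rule vertical_increment_estimate[OF der])
      show "norm (g (Complex x t) - G) \<le> 1" if "y' \<le> t" "t \<le> y" for t
        using \<delta>(2)[of t] that \<open>y \<in> {0<..<\<delta>}\<close> \<open>y' \<in> {0<..<\<delta>}\<close> by (simp add: dist_norm)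
    qed (use that in auto)
    then show ?thesis using that(3) by (simp add: f_def algebra_simps)
  qed
  then have "norm (f y - f y') \<le> 1 * \<bar>y - y'\<bar>" if "y \<in> {0<..<\<delta>}" "y' \<in> {0<..<\<delta>}" for y y'
    using that by (cases "y' \<le> y") (force simp: norm_minus_commute abs_minus_commute)+
  then have "1-lipschitz_on {0<..<\<delta>} f"
    by (intro lipschitz_onI) (auto simp: dist_norm)
  then have "uniformly_continuous_on {0<..<\<delta>} f" by (rule lipschitz_on_uniformly_continuous)
  moreover have "0 \<in> closure {0<..<\<delta>}" using \<delta>(1) by simp
  ultimately obtain L where "(f \<longlongrightarrow> L) (at 0 within {0<..<\<delta>})"
    using uniformly_continuous_on_extension_at_closure by blast
  moreover have "at 0 within {0<..<\<delta>} = at_right 0"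
    using \<delta>(1) by (intro at_within_nhd[of _ "{..<\<delta>}"]) auto
  ultimately have "(f \<longlongrightarrow> L) (at_right 0)" by simp
  moreover have "((\<lambda>y. \<i> * of_real y * G) \<longlongrightarrow> \<i> * of_real 0 * G) (at_right 0)"
    by (intro tendsto_intros)
  ultimately have "((\<lambda>y. f y + \<i> * of_real y * G) \<longlongrightarrow> L + \<i> * of_real 0 * G) (at_right 0)"
    by (rule tendsto_add)
  then show ?thesis unfolding f_def by (intro exI) (simp only: diff_add_cancel)
qed

lemma boundary_increment_estimate:
  fixes w g :: "complex \<Rightarrow> complex"
  assumes der: "\<And>z. 0 < Im z \<Longrightarrow> (w has_field_derivative g z) (at z)"
    and W: "((\<lambda>y. w (Complex x y)) \<longlongrightarrow> W) (at_right 0)"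
    and stab: "x \<in> radially_stable g \<epsilon> \<delta>" and y: "0 < y" "y \<le> \<delta>"
  shows "norm (w (Complex x y) - W - \<i> * of_real y * g (Complex x y)) \<le> \<epsilon> * y"
proof (rule tendsto_le[of "at_right 0"])
  let ?c = "g (Complex x y)"
  show "((\<lambda>y'. norm (w (Complex x y) - w (Complex x y') - \<i> * of_real (y - y') * ?c)) \<longlongrightarrow>
      norm (w (Complex x y) - W - \<i> * of_real y * ?c)) (at_right 0)"
    by (auto intro!: tendsto_eq_intros W)
  show "((\<lambda>y'. \<epsilon> * (y - y')) \<longlongrightarrow> \<epsilon> * y) (at_right 0)"
    by (auto intro!: tendsto_eq_intros)
  show "eventually (\<lambda>y'. norm (w (Complex x y) - w (Complex x y') - \<i> * of_real (y - y') * ?c) \<le> \<epsilon> * (y - y')) (at_right 0)"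
    unfolding eventually_at_right_field
  proof (intro exI[of _ y] conjI allI impI y)
    fix y' assume y': "0 < y'" "y' < y"
    show "norm (w (Complex x y) - w (Complex x y') - \<i> * of_real (y - y') * ?c) \<le> \<epsilon> * (y - y')"
    proof (rule vertical_increment_estimate[OF der])
      fix t assume "y' \<le> t" "t \<le> y"
      then show "norm (g (Complex x t) - ?c) \<le> \<epsilon>" using stab y y' by (auto simp: radially_stable_def)
    qed (use y' in auto)
  qed
qed simp

lemma borel_measurable_lebesgue_modify:
  fixes f g :: "real \<Rightarrow> real"
  assumes f: "f \<in> borel_measurable lebesgue" and neg: "negligible {x. f x \<noteq> g x}"
  shows "g \<in> borel_measurable lebesgue"
proof (rule measurableI)
  fix A :: "real set" assume A: "A \<in> sets borel"
  let ?N = "{x. f x \<noteq> g x}"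
  have split: "g -` A \<inter> space lebesgue = (f -` A \<inter> space lebesgue - ?N) \<union> (g -` A \<inter> ?N)" by auto
  show "g -` A \<inter> space lebesgue \<in> sets lebesgue"
    unfolding split
  proof (intro sets.Un sets.Diff)
    show "f -` A \<inter> space lebesgue \<in> sets lebesgue" using f A by (rule measurable_sets)
    show "?N \<in> sets lebesgue" using neg by (rule negligible_imp_sets)
    show "g -` A \<inter> ?N \<in> sets lebesgue"
      by (intro negligible_imp_sets negligible_subset[OF neg] Int_lower2)
  qed
qed simp

lemma borel_measurable_boundary_value:
  fixes u :: "complex \<Rightarrow> real"
  assumes cont: "continuous_on upper_half_plane u"
    and neg: "negligible {x. \<not> (\<exists>c. ((\<lambda>y. u (Complex x y)) \<longlongrightarrow> c) (at_right 0))}" (is "negligible ?N")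
  shows "boundary_value u \<in> borel_measurable lebesgue"
proof -
  define y where "y n = inverse (real (Suc n))" for n
  define h where "h n x = indicator (- ?N) x * u (Complex x (y n))" for n x
  have N: "- ?N \<in> sets lebesgue" 
    using sets.compl_sets[OF negligible_imp_sets[OF neg]]
    by (simp only: Compl_eq_Diff_UNIV space_completion space_lborel space_borel)
  have "h n \<in> borel_measurable lebesgue" for n
  proof -
    have "(\<lambda>x. u (Complex x (y n))) \<in> borel_measurable borel"
      by (intro borel_measurable_continuous_onI continuous_on_horizontal cont) (simp add: y_def)
    then have "(\<lambda>x. u (Complex x (y n))) \<in> borel_measurable lebesgue"
      by (simp add: measurable_completion)
    then show ?thesis unfolding h_def using N by (intro borel_measurable_times borel_measurable_indicator)
  qed
  moreover have "(\<lambda>n. h n x) \<longlonglongrightarrow> indicator (- ?N) x * boundary_value u x" for x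
  proof (cases "x \<in> ?N")
    case False
    then obtain c where c: "((\<lambda>y. u (Complex x y)) \<longlongrightarrow> c) (at_right 0)" by blast
    have "boundary_value u x = c" unfolding boundary_value_def using c by (intro tendsto_Lim) auto
    moreover have "filterlim y (at_right 0) sequentially"
      unfolding filterlim_at y_def using LIMSEQ_inverse_real_of_nat by (auto simp: eventually_sequentially)
    ultimately show ?thesis using filterlim_compose[OF c] False by (simp add: h_def)
  qed (simp add: h_def)
  ultimately have "(\<lambda>x. indicator (- ?N) x * boundary_value u x) \<in> borel_measurable lebesgue"
    by (rule borel_measurable_LIMSEQ_real[where u = h, rotated])
  then show ?thesis
  proof (rule borel_measurable_lebesgue_modify)
    show "negligible {x. indicator (- ?N) x * boundary_value u x \<noteq> boundary_value u x}"
      by (rule negligible_subset[OF neg]) (auto simp: indicator_def)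
  qed
qed

text \<open>
  The form in which the approximate derivative is verified: for each \<open>\<epsilon>\<close> separately, the bad
  increments avoid a closed set with density one at \<open>x\<close>, up to a null set.
\<close>

lemma approx_derivative_of_density_bound:
  fixes f :: "real \<Rightarrow> real"
  assumes meas: "f \<in> borel_measurable lebesgue" and neg: "negligible N"
    and est: "\<And>\<epsilon>. 0 < \<epsilon> \<Longrightarrow> \<exists>S r. closed S \<and> density_point S x \<and> 0 < r \<and>
        (\<forall>h. h \<noteq> 0 \<longrightarrow> \<bar>h\<bar> < r \<longrightarrow> x + h \<in> S \<longrightarrow> x + h \<notin> N \<longrightarrow> \<bar>(f (x + h) - f x) / h - d\<bar> < \<epsilon>)"
  shows "has_approx_derivative f d x"
  unfolding has_approx_derivative_def
proof (intro conjI allI impI meas)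
  fix \<epsilon> :: real assume "0 < \<epsilon>"
  from est[OF this] obtain S r where S: "closed S" "density_point S x" and r: "0 < r"
    and q: "\<And>h. h \<noteq> 0 \<Longrightarrow> \<bar>h\<bar> < r \<Longrightarrow> x + h \<in> S \<Longrightarrow> x + h \<notin> N \<Longrightarrow> \<bar>(f (x + h) - f x) / h - d\<bar> < \<epsilon>"
    by blast
  define bad where "bad h = {y \<in> {-h<..<h}. \<epsilon> \<le> \<bar>(f (x + y) - f x) / y - d\<bar>}" for h
  have bad_le: "measure lebesgue (bad h) \<le> measure lebesgue (cball x h - S)" if h: "0 < h" "h < r" for h
  proof -
    let ?T = "(cball x h - S) \<union> (N \<union> {x})"
    have null: "negligible (N \<union> {x})" using neg by (intro negligible_Un) auto
    have lm: "cball x h - S \<in> lmeasurable" using S(1) by (intro fmeasurable_Diff) auto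
    have T: "?T \<in> lmeasurable" using lm negligible_imp_measurable[OF null] by (rule fmeasurable.Un)
    have "measure lebesgue ?T \<le> measure lebesgue (cball x h - S) + measure lebesgue (N \<union> {x})"
      by (rule measure_Un_le) (use lm negligible_imp_sets[OF null] in \<open>auto dest: fmeasurableD\<close>)
    then have mT: "measure lebesgue ?T \<le> measure lebesgue (cball x h - S)"
      using negligible_imp_measure0[OF null] by simp
    have sub: "bad h \<subseteq> (+) (- x) ` ?T"
    proof
      fix y assume y: "y \<in> bad h"
      have "x + y \<in> ?T"
      proof (rule ccontr)
        assume "x + y \<notin> ?T"
        then have "y \<noteq> 0" "x + y \<in> S \<or> x + y \<notin> cball x h" "x + y \<notin> N" by auto
        moreover have "\<bar>y\<bar> < h" using y by (auto simp: bad_def)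
        moreover from this have "x + y \<in> cball x h" by (simp add: dist_real_def)
        ultimately have "\<bar>(f (x + y) - f x) / y - d\<bar> < \<epsilon>" using h(2) by (intro q) auto
        with y show False by (simp add: bad_def)
      qed
      then show "y \<in> (+) (- x) ` ?T" by (intro image_eqI[of _ _ "x + y"]) auto
    qed
    \<comment> \<open>If \<open>bad h\<close> is not measurable, \<open>measure\<close> has its default value zero.\<close>
    show ?thesis
    proof (cases "bad h \<in> sets lebesgue")
      case True
      then have "measure lebesgue (bad h) \<le> measure lebesgue ((+) (- x) ` ?T)"
        using sub measurable_translation[OF T] by (intro measure_mono_fmeasurable)
      also have "\<dots> = measure lebesgue ?T" by (rule measure_translation)
      finally show ?thesis using mT by linarith
    next
      case False
      then show ?thesis by (simp add: measure_notin_sets)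
    qed
  qed
  show "((\<lambda>h. 1 / (2 * h) * measure lebesgue {y \<in> {-h<..<h}. \<epsilon> \<le> \<bar>(f (x + y) - f x) / y - d\<bar>}) \<longlongrightarrow> 0) (at_right 0)"
    unfolding bad_def[symmetric]
  proof (rule tendstoI)
    fix e :: real assume "0 < e"
    then have "0 < e / 2" by simp
    with S(2) obtain \<delta> where \<delta>: "\<delta> > 0" "\<And>h. 0 < h \<Longrightarrow> h < \<delta> \<Longrightarrow> measure lebesgue (cball x h - S) \<le> e / 2 * (2 * h)"
      unfolding density_point_def by blast
    show "eventually (\<lambda>h. dist (1 / (2 * h) * measure lebesgue (bad h)) 0 < e) (at_right 0)"
      unfolding eventually_at_right_field
    proof (intro exI[of _ "min \<delta> r"] conjI allI impI)
      fix h assume h: "0 < h" "h < min \<delta> r"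
      have "measure lebesgue (bad h) \<le> e / 2 * (2 * h)" using bad_le[of h] \<delta>(2)[of h] h by simp
      then have "1 / (2 * h) * measure lebesgue (bad h) \<le> e / 2" using h(1) by (simp add: field_simps)
      moreover have "0 \<le> 1 / (2 * h) * measure lebesgue (bad h)" using h(1) by simp
      ultimately show "dist (1 / (2 * h) * measure lebesgue (bad h)) 0 < e"
        using \<open>0 < e\<close> unfolding dist_real_def by linarith
    qed (use \<delta>(1) r in simp)
  qed
qed

text \<open>
  With \<open>y = |h|\<close>, the path from \<open>x\<close> up to height \<open>y\<close>, across to \<open>x + h\<close> and down again gives the errors
  \<open>A\<close> and \<open>B\<close> (vertical sides), \<open>C\<close> (horizontal side), and \<open>D\<close>, \<open>E\<close> from replacing \<open>g\<close> at the two upper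
  corners by \<open>G\<close>; their bounds add up to \<open>14 * \<epsilon> * |h|\<close>.
\<close>

lemma boundary_difference_quotient:
  fixes w g :: "complex \<Rightarrow> complex"
  assumes der: "\<And>z. 0 < Im z \<Longrightarrow> (w has_field_derivative g z) (at z)"
    and pos: "\<And>z. 0 < Im z \<Longrightarrow> 0 < Im (g z)" and hol: "g holomorphic_on upper_half_plane"
    and lim: "((\<lambda>y. g (Complex x y)) \<longlongrightarrow> G) (at_right 0)"
    and W: "\<And>t. t \<notin> N \<Longrightarrow> ((\<lambda>y. w (Complex t y)) \<longlongrightarrow> W t) (at_right 0)" and x: "x \<notin> N"
    and stab: "x \<in> radially_stable g \<epsilon> \<delta>" and dens: "density_point (radially_stable g \<epsilon> \<delta>) x"
    and \<epsilon>: "0 < \<epsilon>" and \<delta>: "0 < \<delta>"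
  shows "\<exists>r>0. \<forall>h. h \<noteq> 0 \<longrightarrow> \<bar>h\<bar> < r \<longrightarrow> x + h \<in> radially_stable g \<epsilon> \<delta> \<longrightarrow> x + h \<notin> N \<longrightarrow>
      norm ((W (x + h) - W x) / of_real h - G) \<le> 14 * \<epsilon>"
proof -
  obtain \<eta> where \<eta>: "\<eta> > 0"
    "\<And>s y. 0 < y \<Longrightarrow> y < \<eta> \<Longrightarrow> \<bar>s\<bar> \<le> y \<Longrightarrow> norm (g (Complex (x + s) y) - G) \<le> 4 * \<epsilon>"
    using radial_limit_imp_cone_estimate[OF hol pos lim stab dens \<epsilon> \<delta>] by blast
  show ?thesis
  proof (intro exI[of _ "min \<eta> \<delta>"] conjI allI impI)
    show "0 < min \<eta> \<delta>" using \<eta>(1) \<delta> by simp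
    fix h :: real assume h: "h \<noteq> 0" "\<bar>h\<bar> < min \<eta> \<delta>" and xh: "x + h \<in> radially_stable g \<epsilon> \<delta>" "x + h \<notin> N"
    define y where "y = \<bar>h\<bar>"
    have y: "0 < y" "y < \<eta>" "y \<le> \<delta>" using h by (auto simp: y_def)
    define A where "A = w (Complex (x + h) y) - W (x + h) - \<i> * of_real y * g (Complex (x + h) y)"
    define B where "B = w (Complex x y) - W x - \<i> * of_real y * g (Complex x y)"
    define C where "C = w (Complex (x + h) y) - w (Complex x y) - of_real h * G"
    define D where "D = \<i> * of_real y * (g (Complex (x + h) y) - G)"
    define E where "E = \<i> * of_real y * (g (Complex x y) - G)"
    have "norm A \<le> \<epsilon> * y" unfolding A_def
      by (rule boundary_increment_estimate[OF der W[OF xh(2)] xh(1) y(1,3)])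
    moreover have "norm B \<le> \<epsilon> * y" unfolding B_def
      by (rule boundary_increment_estimate[OF der W[OF x] stab y(1,3)])
    moreover have "norm C \<le> 4 * \<epsilon> * y" unfolding C_def
      unfolding y_def by (rule horizontal_increment_estimate[OF der]) (use \<eta>(2) y in \<open>auto simp: y_def\<close>)
    moreover have "norm D \<le> 4 * \<epsilon> * y"
    proof -
      have "norm (g (Complex (x + h) y) - G) \<le> 4 * \<epsilon>" using y by (intro \<eta>(2)) (auto simp: y_def)
      then show ?thesis using y(1) by (simp add: D_def norm_mult mult.commute)
    qed
    moreover have "norm E \<le> 4 * \<epsilon> * y"
    proof -
      have "norm (g (Complex (x + 0) y) - G) \<le> 4 * \<epsilon>" using y by (intro \<eta>(2)) auto
      then show ?thesis using y(1) by (simp add: E_def norm_mult mult.commute)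
    qed
    moreover have "W (x + h) - W x - of_real h * G = (C - D) + (E - A) + B"
      by (simp add: A_def B_def C_def D_def E_def algebra_simps)
    moreover have "norm ((C - D) + (E - A) + B) \<le> norm C + norm D + norm E + norm A + norm B"
      using norm_triangle_ineq[of "(C - D) + (E - A)" B] norm_triangle_ineq[of "C - D" "E - A"]
        norm_triangle_ineq4[of C D] norm_triangle_ineq4[of E A] by linarith
    ultimately have "norm (W (x + h) - W x - of_real h * G) \<le> 14 * \<epsilon> * y" by simp
    moreover have "(W (x + h) - W x) / of_real h - G = (W (x + h) - W x - of_real h * G) / of_real h"
      using h(1) by (simp add: diff_divide_distrib)
    ultimately show "norm ((W (x + h) - W x) / of_real h - G) \<le> 14 * \<epsilon>"
      using y(1) by (simp add: norm_divide pos_divide_le_eq y_def)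
  qed
qed

text \<open>
  The purely function theoretic part: a primitive \<open>w\<close> of a Herglotz function has boundary values
  with the expected approximate derivative as soon as \<open>Im w\<close> is bounded. It suffices to let \<open>\<epsilon>\<close> and
  the height \<open>\<delta>\<close> run through the reciprocals of the integers, so the exceptional set is null.
\<close>

theorem approx_derivative_boundary_real_part:
  fixes w g :: "complex \<Rightarrow> complex"
  assumes der: "\<And>z. 0 < Im z \<Longrightarrow> (w has_field_derivative g z) (at z)"
    and herg: "herglotz g"
    and bound: "\<And>z. 0 < Im z \<Longrightarrow> \<bar>Im (w z)\<bar> \<le> M"
  shows "AE x in lebesgue. has_approx_derivative (boundary_value (\<lambda>z. - Re (w z))) (- Re (boundary_value g x)) x"
proof -
  have hol: "g holomorphic_on upper_half_plane" and pos: "\<And>z. 0 < Im z \<Longrightarrow> 0 < Im (g z)"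
    using herg by (auto simp: herglotz_def)
  have contg: "continuous_on upper_half_plane g" using hol by (rule holomorphic_on_imp_continuous_on)
  define N where "N = {x. \<not> (\<exists>c. ((\<lambda>y. g (Complex x y)) \<longlongrightarrow> c) (at_right 0))}"
  have negN: "negligible N" unfolding N_def
    using herglotz_derivative_radial_limit[OF der hol _ bound] pos by (simp add: less_imp_le)
  define W where "W x = boundary_value w x" for x
  have W: "((\<lambda>y. w (Complex x y)) \<longlongrightarrow> W x) (at_right 0)" if x: "x \<notin> N" for x
  proof -
    obtain G where "((\<lambda>y. g (Complex x y)) \<longlongrightarrow> G) (at_right 0)" using x unfolding N_def by blast
    from primitive_radial_limit[OF der this] obtain c where "((\<lambda>y. w (Complex x y)) \<longlongrightarrow> c) (at_right 0)" by blast
    moreover from this have "W x = c" unfolding W_def boundary_value_def by (intro tendsto_Lim) auto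
    ultimately show ?thesis by simp
  qed
  let ?\<gamma> = "boundary_value (\<lambda>z. - Re (w z))"
  have \<gamma>: "?\<gamma> x = - Re (W x)" if "x \<notin> N" for x
    unfolding boundary_value_def using tendsto_minus[OF tendsto_Re[OF W[OF that]]] by (intro tendsto_Lim) auto
  have meas: "?\<gamma> \<in> borel_measurable lebesgue"
  proof (rule borel_measurable_boundary_value)
    have "continuous_on upper_half_plane w"
      using der by (intro continuous_at_imp_continuous_on) (auto intro: DERIV_isCont)
    then show "continuous_on upper_half_plane (\<lambda>z. - Re (w z))" by (intro continuous_intros)
    show "negligible {x. \<not> (\<exists>c. ((\<lambda>y. - Re (w (Complex x y))) \<longlongrightarrow> c) (at_right 0))}"
    proof (rule negligible_subset[OF negN], rule subsetI, rule ccontr)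
      fix x assume x: "x \<in> {x. \<not> (\<exists>c. ((\<lambda>y. - Re (w (Complex x y))) \<longlongrightarrow> c) (at_right 0))}" "x \<notin> N"
      from tendsto_minus[OF tendsto_Re[OF W[OF x(2)]]] x(1) show False by blast
    qed
  qed
  define S where "S m n = radially_stable g (inverse (real (Suc m))) (inverse (real (Suc n)))" for m n
  have closedS: "closed (S m n)" for m n unfolding S_def by (rule closed_radially_stable[OF contg])
  define Z where "Z = (\<Union>m n. {x \<in> S m n. \<not> density_point (S m n) x})"
  have negZ: "negligible Z" unfolding Z_def
    by (intro negligible_Union_nat negligible_not_density_point closedS)
  have good: "has_approx_derivative ?\<gamma> (- Re (boundary_value g x)) x" if xN: "x \<notin> N" and xZ: "x \<notin> Z" for x
  proof -
    obtain G where G: "((\<lambda>y. g (Complex x y)) \<longlongrightarrow> G) (at_right 0)" using xN unfolding N_def by blast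
    have bG: "boundary_value g x = G" unfolding boundary_value_def using G by (intro tendsto_Lim) auto
    show ?thesis
      unfolding bG
    proof (rule approx_derivative_of_density_bound[OF meas negN])
      fix \<epsilon> :: real assume "0 < \<epsilon>"
      then obtain m where m: "inverse (real (Suc m)) < \<epsilon> / 14"
        using reals_Archimedean[of "\<epsilon> / 14"] by auto
      define e where "e = inverse (real (Suc m))"
      have e: "0 < e" "14 * e < \<epsilon>" using m by (auto simp: e_def)
      have "eventually (\<lambda>y. dist (g (Complex x y)) G < e / 2) (at_right 0)"
        using G by (rule tendstoD) (use e in simp)
      then obtain b where b: "b > 0" "\<And>y. 0 < y \<Longrightarrow> y < b \<Longrightarrow> dist (g (Complex x y)) G < e / 2"
        unfolding eventually_at_right_field by blast
      obtain n where n: "inverse (real (Suc n)) < b" using reals_Archimedean[OF b(1)] by auto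
      have xS: "x \<in> S m n"
        unfolding S_def radially_stable_def e_def[symmetric]
      proof (intro CollectI ballI)
        fix y y' assume "y \<in> {0<..inverse (real (Suc n))}" "y' \<in> {0<..inverse (real (Suc n))}"
        then have "dist (g (Complex x y)) G < e / 2" "dist (g (Complex x y')) G < e / 2"
          using b(2)[of y] b(2)[of y'] n by auto
        then show "norm (g (Complex x y) - g (Complex x y')) \<le> e"
          using dist_triangle2[of "g (Complex x y)" "g (Complex x y')" G] unfolding dist_norm[symmetric] by linarith
      qed
      have dens: "density_point (S m n) x" using xS xZ unfolding Z_def by blast
      obtain r where r: "r > 0" "\<And>h. h \<noteq> 0 \<Longrightarrow> \<bar>h\<bar> < r \<Longrightarrow> x + h \<in> S m n \<Longrightarrow> x + h \<notin> N \<Longrightarrow>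
          norm ((W (x + h) - W x) / of_real h - G) \<le> 14 * e"
        using boundary_difference_quotient[OF der pos hol G W xN
            xS[unfolded S_def e_def[symmetric]] dens[unfolded S_def e_def[symmetric]] e(1)]
        unfolding S_def e_def[symmetric] by auto
      have "\<bar>(?\<gamma> (x + h) - ?\<gamma> x) / h - (- Re G)\<bar> < \<epsilon>"
        if h: "h \<noteq> 0" "\<bar>h\<bar> < r" "x + h \<in> S m n" "x + h \<notin> N" for h
      proof -
        have "(?\<gamma> (x + h) - ?\<gamma> x) / h - (- Re G) = - Re ((W (x + h) - W x) / of_real h - G)"
          using h(1) by (simp add: \<gamma>[OF h(4)] \<gamma>[OF xN] Re_divide_of_real diff_divide_distrib)
        then have "\<bar>(?\<gamma> (x + h) - ?\<gamma> x) / h - (- Re G)\<bar> \<le> norm ((W (x + h) - W x) / of_real h - G)"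
          using abs_Re_le_cmod[of "(W (x + h) - W x) / of_real h - G"] by simp
        then show ?thesis using r(2)[OF h] e(2) by linarith
      qed
      then show "\<exists>S r. closed S \<and> density_point S x \<and> 0 < r \<and> (\<forall>h. h \<noteq> 0 \<longrightarrow> \<bar>h\<bar> < r \<longrightarrow> x + h \<in> S \<longrightarrow>
          x + h \<notin> N \<longrightarrow> \<bar>(?\<gamma> (x + h) - ?\<gamma> x) / h - (- Re G)\<bar> < \<epsilon>)"
        using closedS dens r(1) by blast
    qed
  qed
  have "AE x in lebesgue. x \<notin> N" "AE x in lebesgue. x \<notin> Z"
    unfolding AE_lebesgue_iff_negligible not_not Collect_mem_eq using negN negZ by simp_all
  then show ?thesis by eventually_elim (rule good)
qed

section \<open>Solutions of the Jacobi difference equation\<close>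

locale jacobi_coefficients =
  fixes a b :: "nat \<Rightarrow> real" and M :: real
  assumes M_pos: "0 < M" and a_zero: "a 0 = 1"
    and a_lower: "1 \<le> n \<Longrightarrow> inverse (M + 1) \<le> a n"
    and a_upper: "1 \<le> n \<Longrightarrow> a n \<le> M + 1"
    and b_bound: "1 \<le> n \<Longrightarrow> \<bar>b n\<bar> \<le> M"
begin

lemma a_pos: "0 < a n"
proof (cases "n = 0")
  case False
  have "0 < inverse (M + 1)" using M_pos by simp
  also have "\<dots> \<le> a n" using False by (intro a_lower) simp
  finally show ?thesis .
qed (simp add: a_zero)

lemma a_le: "a n \<le> M + 1"
  using a_upper[of n] a_zero M_pos by (cases "n = 0") auto

definition solves :: "complex \<Rightarrow> (nat \<Rightarrow> complex) \<Rightarrow> bool" where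
  "solves z f \<longleftrightarrow> (\<forall>n. of_real (a (Suc n)) * f (Suc (Suc n)) =
      (z - of_real (b (Suc n))) * f (Suc n) - of_real (a n) * f n)"

lemma solvesD: "solves z f \<Longrightarrow> of_real (a (Suc n)) * f (Suc (Suc n)) =
    (z - of_real (b (Suc n))) * f (Suc n) - of_real (a n) * f n"
  by (simp add: solves_def)

lemma solves_jacobi_solution: "solves z (jacobi_solution a b z c0 c1)"
  unfolding solves_def
proof
  fix n
  have "a (Suc n) \<noteq> 0" using a_pos[of "Suc n"] by simp
  then show "of_real (a (Suc n)) * jacobi_solution a b z c0 c1 (Suc (Suc n)) =
      (z - of_real (b (Suc n))) * jacobi_solution a b z c0 c1 (Suc n) - of_real (a n) * jacobi_solution a b z c0 c1 n"
    by simp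
qed

lemma jacobi_solution_linear:
  "jacobi_solution a b z c0 c1 n = c0 * jacobi_solution a b z 1 0 n + c1 * jacobi_solution a b z 0 1 n"
proof (induction n rule: induct_nat_012)
  case (ge2 n)
  show ?case by (simp add: ge2 add_divide_distrib[symmetric]) (simp add: algebra_simps)
qed simp_all

text \<open>
  A discrete energy current, proportional to the Wronskian of \<open>f\<close> and its conjugate. Along a solution
  it increases by \<open>Im z * |f|^2\<close> at every site (\<open>flux_Suc\<close>), which is the source of all bounds on
  solutions below.
\<close>

definition flux :: "(nat \<Rightarrow> complex) \<Rightarrow> nat \<Rightarrow> real" where
  "flux f n = a n * Im (f (Suc n) * cnj (f n))"

lemma flux_Suc:
  assumes "solves z f"
  shows "flux f (Suc n) = flux f n + Im z * (cmod (f (Suc n)))\<^sup>2"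
proof -
  have "flux f (Suc n) = Im ((of_real (a (Suc n)) * f (Suc (Suc n))) * cnj (f (Suc n)))"
    by (simp add: flux_def algebra_simps)
  also have "\<dots> = Im (((z - of_real (b (Suc n))) * f (Suc n) - of_real (a n) * f n) * cnj (f (Suc n)))"
    by (simp only: solvesD[OF assms])
  also have "\<dots> = flux f n + Im z * (cmod (f (Suc n)))\<^sup>2"
    unfolding cmod_power2 by (simp add: flux_def power2_eq_square algebra_simps)
  finally show ?thesis .
qed

lemma flux_eq_sum:
  assumes "solves z f"
  shows "flux f n = flux f 0 + Im z * (\<Sum>k=1..n. (cmod (f k))\<^sup>2)"
  by (induction n) (simp_all add: flux_Suc[OF assms] algebra_simps)

lemma abs_flux_le: "\<bar>flux f n\<bar> \<le> a n * (cmod (f (Suc n)) * cmod (f n))"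
proof -
  have "\<bar>Im (f (Suc n) * cnj (f n))\<bar> \<le> cmod (f (Suc n)) * cmod (f n)"
    using abs_Im_le_cmod[of "f (Suc n) * cnj (f n)"] by (simp add: norm_mult)
  then show ?thesis using a_pos[of n] by (simp add: flux_def abs_mult)
qed

lemma flux_tendsto_zero:
  assumes "summable (\<lambda>n. (cmod (f n))\<^sup>2)"
  shows "flux f \<longlonglongrightarrow> 0"
proof -
  have "(\<lambda>n. (cmod (f n))\<^sup>2) \<longlonglongrightarrow> 0" using assms by (rule summable_LIMSEQ_zero)
  then have "(\<lambda>n. sqrt ((cmod (f n))\<^sup>2)) \<longlonglongrightarrow> sqrt 0" by (intro tendsto_intros)
  then have c: "(\<lambda>n. cmod (f n)) \<longlonglongrightarrow> 0" by simp
  from tendsto_mult[OF tendsto_const[of "M + 1"] tendsto_mult[OF LIMSEQ_Suc[OF c] c]]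
  have lim: "(\<lambda>n. (M + 1) * (cmod (f (Suc n)) * cmod (f n))) \<longlonglongrightarrow> 0" by simp
  show ?thesis
  proof (rule Lim_null_comparison[OF _ lim])
    show "\<forall>\<^sub>F n in sequentially. norm (flux f n) \<le> (M + 1) * (cmod (f (Suc n)) * cmod (f n))"
    proof (intro always_eventually allI)
      fix n
      have "a n * (cmod (f (Suc n)) * cmod (f n)) \<le> (M + 1) * (cmod (f (Suc n)) * cmod (f n))"
        using a_le[of n] by (intro mult_right_mono) auto
      then show "norm (flux f n) \<le> (M + 1) * (cmod (f (Suc n)) * cmod (f n))"
        using abs_flux_le[of f n] by simp
    qed
  qed
qed

lemma flux_nonpos:
  assumes "solves z f" "0 < Im z" "summable (\<lambda>n. (cmod (f n))\<^sup>2)"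
  shows "flux f n \<le> 0"
proof -
  have "incseq (flux f)" using assms by (intro incseq_SucI) (simp add: flux_Suc[OF assms(1)])
  then show ?thesis using flux_tendsto_zero[OF assms(3)] by (rule incseq_le)
qed

lemma flux_le_of_summable:
  assumes "solves z f" "0 < Im z" "summable (\<lambda>n. (cmod (f n))\<^sup>2)"
  shows "flux f n \<le> - Im z * (cmod (f (Suc n)))\<^sup>2"
  using flux_nonpos[OF assms, of "Suc n"] flux_Suc[OF assms(1), of n] by simp

text \<open>
  The flux increases by \<open>Im z * |f|^2\<close> at every site, starts at zero and tends to zero.
\<close>

lemma square_summable_solution_zero:
  assumes "solves z f" "0 < Im z" "summable (\<lambda>n. (cmod (f n))\<^sup>2)" "f 0 = 0"
  shows "f n = 0"
proof -
  have nonpos: "Im z * (\<Sum>k=1..n. (cmod (f k))\<^sup>2) \<le> 0"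
    using flux_nonpos[OF assms(1-3), of n] flux_eq_sum[OF assms(1), of n] assms(4) by (simp add: flux_def)
  show ?thesis
  proof (cases "n = 0")
    case False
    have "(cmod (f n))\<^sup>2 \<le> (\<Sum>k=1..n. (cmod (f k))\<^sup>2)"
      using False by (intro member_le_sum) auto
    also have "\<dots> \<le> 0" using nonpos assms(2) by (simp add: mult_le_0_iff)
    finally show ?thesis by simp
  qed (use assms in simp)
qed

lemma f_minus_simps: "f_minus a b 0 z = 0" "f_minus a b (Suc 0) z = 1"
  by (simp_all add: f_minus_def)

lemma solves_f_minus: "solves z (\<lambda>n. f_minus a b n z)"
  unfolding f_minus_def by (rule solves_jacobi_solution)

lemma flux_f_minus: "flux (\<lambda>n. f_minus a b n z) n = Im z * (\<Sum>k=1..n. (cmod (f_minus a b k z))\<^sup>2)"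
  using flux_eq_sum[OF solves_f_minus, of z n] by (simp add: flux_def f_minus_simps)

lemma flux_f_minus_pos:
  assumes "0 < Im z" "1 \<le> n"
  shows "0 < flux (\<lambda>n. f_minus a b n z) n"
proof -
  have "(cmod (f_minus a b 1 z))\<^sup>2 \<le> (\<Sum>k=1..n. (cmod (f_minus a b k z))\<^sup>2)"
    using assms by (intro member_le_sum) auto
  then have "1 \<le> (\<Sum>k=1..n. (cmod (f_minus a b k z))\<^sup>2)" by (simp add: f_minus_simps)
  then show ?thesis using assms by (simp add: flux_f_minus)
qed

lemma f_minus_nonzero:
  assumes "0 < Im z" "1 \<le> n"
  shows "f_minus a b n z \<noteq> 0"
  using flux_f_minus_pos[OF assms] by (auto simp: flux_def)

lemma Im_f_minus_ratio_pos:
  assumes "0 < Im z" "1 \<le> n"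
  shows "0 < Im (f_minus a b (Suc n) z / f_minus a b n z)"
proof -
  have "0 < Im (f_minus a b (Suc n) z * cnj (f_minus a b n z))"
    using flux_f_minus_pos[OF assms] a_pos[of n] by (simp add: flux_def zero_less_mult_iff)
  moreover have "f_minus a b n z \<noteq> 0" using assms by (rule f_minus_nonzero)
  ultimately show ?thesis
    unfolding complex_div_cnj[of "f_minus a b (Suc n) z"] by (simp add: Im_divide_of_real flip: of_real_power)
qed

lemma f_minus_step_bound:
  assumes "0 < Im z"
  shows "Im z * cmod (f_minus a b n z) \<le> a n * cmod (f_minus a b (Suc n) z)"
proof (cases "n = 0")
  case False
  have "Im z * (cmod (f_minus a b n z))\<^sup>2 \<le> flux (\<lambda>n. f_minus a b n z) n"
    unfolding flux_f_minus using False assms by (intro mult_left_mono member_le_sum) auto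
  also have "\<dots> \<le> a n * (cmod (f_minus a b (Suc n) z) * cmod (f_minus a b n z))"
    using abs_flux_le[of "\<lambda>n. f_minus a b n z" n] by simp
  finally have "(Im z * cmod (f_minus a b n z)) * cmod (f_minus a b n z)
      \<le> (a n * cmod (f_minus a b (Suc n) z)) * cmod (f_minus a b n z)"
    by (simp add: power2_eq_square mult_ac)
  then show ?thesis using f_minus_nonzero[OF assms, of n] False by simp
qed (use a_pos[of 0] in \<open>simp add: f_minus_simps\<close>)

text \<open>
  Weyl's limit point argument. The solution \<open>q N\<close> that vanishes at \<open>N + 1\<close> has no flux there, so its
  square sum up to \<open>N\<close> is \<open>- Im (t N) / Im z\<close>. The term of index one of this sum is already
  \<open>|t N|^2\<close>; this bounds \<open>t N\<close>, and a limit point of the \<open>t N\<close> yields a square summable solution.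
\<close>

lemma square_summable_solution_exists:
  assumes z: "0 < Im z"
  shows "\<exists>t. summable (\<lambda>n. (cmod (jacobi_solution a b z 1 t n))\<^sup>2)"
proof -
  let ?\<phi> = "jacobi_solution a b z 1 0" and ?p = "jacobi_solution a b z 0 1"
  \<comment> \<open>Chosen such that \<open>q N\<close> vanishes at \<open>N + 1\<close>.\<close>
  define t where "t N = - ?\<phi> (Suc N) / ?p (Suc N)" for N
  define q where "q N = jacobi_solution a b z 1 (t N)" for N
  have q_eq: "q N k = ?\<phi> k + t N * ?p k" for N k
    unfolding q_def by (subst jacobi_solution_linear) simp
  have end_zero: "q N (Suc N) = 0" for N
    using f_minus_nonzero[OF z, of "Suc N"] by (simp add: q_eq t_def f_minus_def)
  have total: "Im z * (\<Sum>k=1..N. (cmod (q N k))\<^sup>2) = - Im (t N)" for N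
  proof -
    have "solves z (q N)" unfolding q_def by (rule solves_jacobi_solution)
    from flux_eq_sum[OF this, of N] show ?thesis
      by (simp add: flux_def end_zero a_zero) (simp add: q_def)
  qed
  have t_bound: "cmod (t N) \<le> 1 / Im z" if "1 \<le> N" for N
  proof -
    have "Im z * (cmod (t N))\<^sup>2 \<le> Im z * (\<Sum>k=1..N. (cmod (q N k))\<^sup>2)"
    proof (intro mult_left_mono)
      have "(cmod (q N 1))\<^sup>2 \<le> (\<Sum>k=1..N. (cmod (q N k))\<^sup>2)" using that by (intro member_le_sum) auto
      then show "(cmod (t N))\<^sup>2 \<le> (\<Sum>k=1..N. (cmod (q N k))\<^sup>2)" by (simp add: q_def)
    qed (use z in simp)
    also have "\<dots> \<le> cmod (t N)" using abs_Im_le_cmod[of "t N"] total[of N] by linarith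
    finally have "(cmod (t N) * Im z) * cmod (t N) \<le> 1 * cmod (t N)" by (simp add: power2_eq_square mult_ac)
    then have "cmod (t N) = 0 \<or> cmod (t N) * Im z \<le> 1" by (simp only: mult_le_cancel_right) auto
    then show ?thesis using z by (auto simp: pos_le_divide_eq)
  qed
  have "bounded (range (\<lambda>N. t (Suc N)))"
    unfolding bounded_iff using t_bound by (intro exI[of _ "1 / Im z"]) auto
  from bounded_imp_convergent_subsequence[OF this]
  obtain s r where r: "strict_mono r" and lim: "((\<lambda>N. t (Suc N)) \<circ> r) \<longlonglongrightarrow> s" by blast
  define f where "f = jacobi_solution a b z 1 s"
  have f_eq: "f k = ?\<phi> k + s * ?p k" for k
    unfolding f_def by (subst jacobi_solution_linear) simp
  have conv: "(\<lambda>j. q (Suc (r j)) k) \<longlonglongrightarrow> f k" for k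
    unfolding q_eq f_eq using lim by (intro tendsto_intros) (simp add: comp_def)
  have partial: "(\<Sum>k=1..K. (cmod (f k))\<^sup>2) \<le> 1 / (Im z)\<^sup>2" for K
  proof (rule LIMSEQ_le_const2)
    show "(\<lambda>j. \<Sum>k=1..K. (cmod (q (Suc (r j)) k))\<^sup>2) \<longlonglongrightarrow> (\<Sum>k=1..K. (cmod (f k))\<^sup>2)"
      by (intro tendsto_intros conv)
    show "\<exists>N. \<forall>j\<ge>N. (\<Sum>k=1..K. (cmod (q (Suc (r j)) k))\<^sup>2) \<le> 1 / (Im z)\<^sup>2"
    proof (intro exI[of _ K] allI impI)
      fix j assume "K \<le> j"
      then have "K \<le> Suc (r j)" using seq_suble[OF r, of j] by simp
      then have "Im z * (\<Sum>k=1..K. (cmod (q (Suc (r j)) k))\<^sup>2)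
          \<le> Im z * (\<Sum>k=1..Suc (r j). (cmod (q (Suc (r j)) k))\<^sup>2)"
        using z by (intro mult_left_mono sum_mono2) auto
      also have "\<dots> \<le> cmod (t (Suc (r j)))" using total[of "Suc (r j)"] abs_Im_le_cmod[of "t (Suc (r j))"] by linarith
      also have "\<dots> \<le> 1 / Im z" by (rule t_bound) simp
      finally show "(\<Sum>k=1..K. (cmod (q (Suc (r j)) k))\<^sup>2) \<le> 1 / (Im z)\<^sup>2"
        using z by (simp add: power2_eq_square pos_le_divide_eq mult_ac)
    qed
  qed
  have "summable (\<lambda>n. (cmod (f (Suc n)))\<^sup>2)"
  proof (rule summableI_nonneg_bounded)
    show "(\<Sum>i<n. (cmod (f (Suc i)))\<^sup>2) \<le> 1 / (Im z)\<^sup>2" for n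
    proof -
      have "(\<Sum>i<n. (cmod (f (Suc i)))\<^sup>2) = (\<Sum>k=1..n. (cmod (f k))\<^sup>2)"
        by (simp add: sum.shift_bounds_cl_Suc_ivl sum.atLeast1_atMost_eq)
      then show ?thesis using partial[of n] by simp
    qed
  qed simp
  then show ?thesis unfolding f_def by (subst (asm) summable_Suc_iff) blast
qed

section \<open>The Green function\<close>

lemma jacobi_op_eigen_zero:
  assumes z: "0 < Im z" and v: "v \<in> ell2" and eq: "\<And>n. jacobi_op a b v n = z * v n"
  shows "v n = 0"
proof (rule square_summable_solution_zero[OF _ z])
  have v0: "v 0 = 0" using v by (simp add: ell2_def)
  show "v 0 = 0" by fact
  show "summable (\<lambda>n. (cmod (v n))\<^sup>2)" using v by (simp add: ell2_def)
  show "solves z v"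
    unfolding solves_def
  proof
    fix n
    from eq[of "Suc n"] show "of_real (a (Suc n)) * v (Suc (Suc n)) =
        (z - of_real (b (Suc n))) * v (Suc n) - of_real (a n) * v n"
      using v0 by (cases "n = 0") (auto simp: jacobi_op_def algebra_simps)
  qed
qed

text \<open>
  Makes the value of \<open>inv_into\<close> in the definition of the resolvent unique, so that it can be identified by
  exhibiting one preimage.
\<close>

lemma inj_on_jacobi_shift:
  assumes z: "0 < Im z"
  shows "inj_on (\<lambda>u n. jacobi_op a b u n - z * u n) ell2"
proof (rule inj_onI)
  fix u v assume u: "u \<in> ell2" and v: "v \<in> ell2"
    and eq: "(\<lambda>n. jacobi_op a b u n - z * u n) = (\<lambda>n. jacobi_op a b v n - z * v n)"
  have d: "(\<lambda>n. u n - v n) \<in> ell2"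
  proof -
    have "summable (\<lambda>n. 2 * (cmod (u n))\<^sup>2 + 2 * (cmod (v n))\<^sup>2)"
      using u v by (intro summable_add summable_mult) (auto simp: ell2_def)
    then have "summable (\<lambda>n. (cmod (u n - v n))\<^sup>2)"
    proof (rule summable_comparison_test'[where N = 0])
      fix n
      have "(cmod (u n - v n))\<^sup>2 \<le> (cmod (u n) + cmod (v n))\<^sup>2"
        by (intro power_mono norm_triangle_ineq4) simp
      also have "\<dots> \<le> 2 * (cmod (u n))\<^sup>2 + 2 * (cmod (v n))\<^sup>2"
        using zero_le_power2[of "cmod (u n) - cmod (v n)"] by (simp add: power2_eq_square algebra_simps)
      finally show "norm ((cmod (u n - v n))\<^sup>2) \<le> 2 * (cmod (u n))\<^sup>2 + 2 * (cmod (v n))\<^sup>2" by simp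
    qed
    then show ?thesis using u v by (simp add: ell2_def)
  qed
  have "u n - v n = 0" for n
  proof (rule jacobi_op_eigen_zero[OF z d])
    fix n
    have "jacobi_op a b (\<lambda>n. u n - v n) n = jacobi_op a b u n - jacobi_op a b v n"
      by (simp add: jacobi_op_def algebra_simps)
    also have "\<dots> = (jacobi_op a b u n - z * u n) - (jacobi_op a b v n - z * v n) + z * (u n - v n)"
      by (simp add: algebra_simps)
    also have "jacobi_op a b u n - z * u n = jacobi_op a b v n - z * v n"
      using eq by (rule fun_cong)
    finally show "jacobi_op a b (\<lambda>n. u n - v n) n = z * (u n - v n)" by simp
  qed
  then show "u = v" by (auto simp: fun_eq_iff)
qed

lemma wronskian:
  assumes "solves z f" "f 0 = 1"
  shows "of_real (a n) * (f n * f_minus a b (Suc n) z - f (Suc n) * f_minus a b n z) = 1"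
proof (induction n)
  case 0
  show ?case by (simp add: assms a_zero f_minus_simps)
next
  case (Suc n)
  have "of_real (a (Suc n)) * (f (Suc n) * f_minus a b (Suc (Suc n)) z - f (Suc (Suc n)) * f_minus a b (Suc n) z)
      = f (Suc n) * (of_real (a (Suc n)) * f_minus a b (Suc (Suc n)) z)
        - (of_real (a (Suc n)) * f (Suc (Suc n))) * f_minus a b (Suc n) z"
    by (simp add: algebra_simps)
  also have "\<dots> = of_real (a n) * (f n * f_minus a b (Suc n) z - f (Suc n) * f_minus a b n z)"
    unfolding solvesD[OF assms(1)] solvesD[OF solves_f_minus] by (simp add: algebra_simps)
  finally show ?case using Suc by simp
qed

text \<open>
  The usual formula for the Green function: minus the product of the solution vanishing at zero, taken at
  the smaller argument, with the square summable one, taken at the larger argument, is a preimage of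
  the basis vector because the Wronskian is one.
\<close>

lemma green_diag_of_summable:
  assumes z: "0 < Im z" and f: "solves z f" "f 0 = 1" "summable (\<lambda>n. (cmod (f n))\<^sup>2)" and n: "1 \<le> n"
  shows "green_diag a b n z = - (f_minus a b n z * f n)"
proof -
  let ?p = "\<lambda>k. f_minus a b k z"
  define v where "v k = (if k \<le> n then - (?p k * f n) else - (?p n * f k))" for k
  have v_ge: "v k = - (?p n * f k)" if "n \<le> k" for k using that by (cases "k = n") (auto simp: v_def)
  have v_le: "v k = - (?p k * f n)" if "k \<le> n" for k using that by (simp add: v_def)
  have v0: "v 0 = 0" by (simp add: v_def f_minus_simps)
  have "summable (\<lambda>k. (cmod (?p n))\<^sup>2 * (cmod (f k))\<^sup>2)" using f(3) by (rule summable_mult)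
  moreover have "eventually (\<lambda>k. (cmod (v k))\<^sup>2 = (cmod (?p n))\<^sup>2 * (cmod (f k))\<^sup>2) sequentially"
    unfolding eventually_sequentially using v_ge by (intro exI[of _ n]) (simp add: norm_mult power_mult_distrib)
  ultimately have "summable (\<lambda>k. (cmod (v k))\<^sup>2)" by (simp only: summable_cong)
  then have v: "v \<in> ell2" using v0 by (simp add: ell2_def)
  have op: "jacobi_op a b v (Suc k) = of_real (a (Suc k)) * v (Suc (Suc k)) + of_real (a k) * v k + of_real (b (Suc k)) * v (Suc k)" for k
    using v0 by (cases "k = 0") (auto simp: jacobi_op_def)
  have "jacobi_op a b v k - z * v k = basis_vector n k" for k
  proof (cases k)
    case 0
    then show ?thesis using n v0 by (simp add: jacobi_op_def basis_vector_def)
  next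
    case (Suc m)
    consider "k < n" | "k = n" | "n < k" by linarith
    then show ?thesis
    proof cases
      case 1
      have "jacobi_op a b v k - z * v k = - f n * (of_real (a (Suc m)) * ?p (Suc (Suc m)) + of_real (a m) * ?p m
          + of_real (b (Suc m)) * ?p (Suc m) - z * ?p (Suc m))"
        using 1 unfolding Suc op by (simp add: v_le algebra_simps)
      then show ?thesis using 1 unfolding solvesD[OF solves_f_minus] by (simp add: basis_vector_def algebra_simps)
    next
      case 3
      have "jacobi_op a b v k - z * v k = - ?p n * (of_real (a (Suc m)) * f (Suc (Suc m)) + of_real (a m) * f m
          + of_real (b (Suc m)) * f (Suc m) - z * f (Suc m))"
        using 3 unfolding Suc op by (simp add: v_ge algebra_simps)
      then show ?thesis using 3 unfolding solvesD[OF f(1)] by (simp add: basis_vector_def algebra_simps)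
    next
      case 2
      have "jacobi_op a b v k - z * v k = - (of_real (a (Suc m)) * (?p n * f (Suc n)))
          - f n * (of_real (a m) * ?p m + of_real (b (Suc m)) * ?p (Suc m) - z * ?p (Suc m))"
        using 2 unfolding Suc op by (simp add: v_ge v_le algebra_simps)
      also have "of_real (a m) * ?p m + of_real (b (Suc m)) * ?p (Suc m) - z * ?p (Suc m) = - (of_real (a (Suc m)) * ?p (Suc (Suc m)))"
        using solvesD[OF solves_f_minus, of m z] by (simp add: algebra_simps)
      finally have "jacobi_op a b v k - z * v k = of_real (a n) * (f n * ?p (Suc n) - f (Suc n) * ?p n)"
        using 2 Suc by (simp add: algebra_simps)
      then show ?thesis using wronskian[OF f(1,2), of n] 2 by (simp add: basis_vector_def)
    qed
  qed
  then have "(\<lambda>k. jacobi_op a b v k - z * v k) = basis_vector n" by (rule ext)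
  then have "jacobi_resolvent a b z (basis_vector n) = v"
    unfolding jacobi_resolvent_def by (intro inv_into_f_eq inj_on_jacobi_shift z v)
  then have "green_diag a b n z = (\<Sum>k. cnj (basis_vector n k) * v k)" by (simp add: green_diag_def ell2_inner_def)
  also have "\<dots> = (\<Sum>k\<in>{n}. cnj (basis_vector n k) * v k)" by (rule suminf_finite) (auto simp: basis_vector_def)
  also have "\<dots> = v n" by (simp add: basis_vector_def)
  finally show ?thesis by (simp add: v_le)
qed

text \<open>
  The initial value \<open>- green_diag a b 1 z\<close> in the definition of \<open>f_plus\<close> is the one that selects the
  square summable solution.
\<close>

lemma f_plus_properties:
  assumes z: "0 < Im z"
  shows solves_f_plus: "solves z (\<lambda>n. f_plus a b n z)"
    and f_plus_zero: "f_plus a b 0 z = 1"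
    and summable_f_plus: "summable (\<lambda>n. (cmod (f_plus a b n z))\<^sup>2)"
proof -
  obtain t where t: "summable (\<lambda>n. (cmod (jacobi_solution a b z 1 t n))\<^sup>2)"
    using square_summable_solution_exists[OF z] by blast
  have "green_diag a b 1 z = - t"
    using green_diag_of_summable[OF z solves_jacobi_solution _ t, of 1] by (simp add: f_minus_simps)
  then have eq: "f_plus a b n z = jacobi_solution a b z 1 t n" for n by (simp add: f_plus_def)
  show "solves z (\<lambda>n. f_plus a b n z)" unfolding eq by (rule solves_jacobi_solution)
  show "summable (\<lambda>n. (cmod (f_plus a b n z))\<^sup>2)" unfolding eq by (rule t)
  show "f_plus a b 0 z = 1" by (simp add: f_plus_def)
qed

lemma green_diag_eq: "0 < Im z \<Longrightarrow> 1 \<le> n \<Longrightarrow> green_diag a b n z = - (f_minus a b n z * f_plus a b n z)"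
  by (rule green_diag_of_summable) (auto intro: solves_f_plus f_plus_zero summable_f_plus)

lemma wronskian_f_plus:
  "0 < Im z \<Longrightarrow> of_real (a n) * (f_plus a b n z * f_minus a b (Suc n) z - f_plus a b (Suc n) z * f_minus a b n z) = 1"
  by (rule wronskian) (auto intro: solves_f_plus f_plus_zero)

lemma flux_f_plus_le:
  "0 < Im z \<Longrightarrow> flux (\<lambda>n. f_plus a b n z) n \<le> - Im z * (cmod (f_plus a b (Suc n) z))\<^sup>2"
  by (rule flux_le_of_summable) (auto intro: solves_f_plus summable_f_plus)

lemma f_plus_nonzero:
  assumes z: "0 < Im z"
  shows "f_plus a b n z \<noteq> 0"
proof
  assume 0: "f_plus a b n z = 0"
  then have "Im z * (cmod (f_plus a b (Suc n) z))\<^sup>2 \<le> 0" using flux_f_plus_le[OF z, of n] by (simp add: flux_def)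
  then have "f_plus a b (Suc n) z = 0" using z by (simp add: mult_le_0_iff)
  with 0 wronskian_f_plus[OF z, of n] show False by simp
qed

lemma f_plus_step_bound:
  assumes z: "0 < Im z"
  shows "Im z * cmod (f_plus a b (Suc n) z) \<le> a n * cmod (f_plus a b n z)"
proof -
  have "Im z * (cmod (f_plus a b (Suc n) z))\<^sup>2 \<le> \<bar>flux (\<lambda>n. f_plus a b n z) n\<bar>"
    using flux_f_plus_le[OF z, of n] by linarith
  also have "\<dots> \<le> a n * (cmod (f_plus a b (Suc n) z) * cmod (f_plus a b n z))" by (rule abs_flux_le)
  finally have "(Im z * cmod (f_plus a b (Suc n) z)) * cmod (f_plus a b (Suc n) z)
      \<le> (a n * cmod (f_plus a b n z)) * cmod (f_plus a b (Suc n) z)"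
    by (simp add: power2_eq_square mult_ac)
  then show ?thesis using f_plus_nonzero[OF z, of "Suc n"] by simp
qed

lemma inverse_product_eq:
  assumes z: "0 < Im z"
  shows "inverse (f_plus a b (Suc n) z * f_minus a b (Suc n) z) =
    of_real (a n) * (f_plus a b n z / f_plus a b (Suc n) z) - of_real (a n) * (f_minus a b n z / f_minus a b (Suc n) z)"
proof -
  note nz = f_plus_nonzero[OF z, of "Suc n"] f_minus_nonzero[OF z, of "Suc n"]
  have "of_real (a n) * (f_plus a b n z / f_plus a b (Suc n) z) - of_real (a n) * (f_minus a b n z / f_minus a b (Suc n) z)
     = of_real (a n) * (f_plus a b n z * f_minus a b (Suc n) z - f_plus a b (Suc n) z * f_minus a b n z)
       / (f_plus a b (Suc n) z * f_minus a b (Suc n) z)"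
    using nz by (simp add: field_simps)
  then show ?thesis unfolding wronskian_f_plus[OF z] by (simp add: inverse_eq_divide)
qed

text \<open>
  In \<open>inverse_product_eq\<close> both terms on the right contribute nonnegatively to the imaginary part, and
  the first one contributes at least \<open>Im z\<close>.
\<close>

lemma product_upper_bound:
  assumes z: "0 < Im z"
  shows "cmod (f_plus a b (Suc n) z * f_minus a b (Suc n) z) \<le> 1 / Im z"
proof -
  let ?q = "\<lambda>n. f_plus a b n z" and ?p = "\<lambda>n. f_minus a b n z"
  have Im_div: "Im (of_real c * (u / v)) = (c * Im (u * cnj v)) / (cmod v)\<^sup>2" for c u v
  proof -
    have "Im (u / v) = Im (u * cnj v) / (cmod v)\<^sup>2"
      unfolding complex_div_cnj[of u v] by (simp add: Im_divide_of_real flip: of_real_power)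
    moreover have "Im (of_real c * w) = c * Im w" for w :: complex by simp
    ultimately show ?thesis by (simp only: times_divide_eq_right[symmetric])
  qed
  have Im_swap: "a n * Im (u * cnj v) = - (a n * Im (v * cnj u))" for u v by (simp add: algebra_simps)
  have nz: "?q (Suc n) \<noteq> 0" "?p (Suc n) \<noteq> 0" using f_plus_nonzero[OF z] f_minus_nonzero[OF z, of "Suc n"] by auto
  have pos: "0 < (cmod (?q (Suc n)))\<^sup>2" using nz(1) by simp
  have "Im z * (cmod (?q (Suc n)))\<^sup>2 \<le> a n * Im (?q n * cnj (?q (Suc n)))"
    using flux_f_plus_le[OF z, of n] Im_swap[of "?q (Suc n)" "?q n"] unfolding flux_def by linarith
  then have 1: "Im z \<le> Im (of_real (a n) * (?q n / ?q (Suc n)))"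
    unfolding Im_div pos_le_divide_eq[OF pos] .
  have "0 \<le> flux ?p n" unfolding flux_f_minus using z by (intro mult_nonneg_nonneg sum_nonneg) auto
  then have "a n * Im (?p n * cnj (?p (Suc n))) \<le> 0"
    using Im_swap[of "?p (Suc n)" "?p n"] unfolding flux_def by linarith
  then have 2: "Im (of_real (a n) * (?p n / ?p (Suc n))) \<le> 0"
    unfolding Im_div by (rule divide_nonpos_nonneg) simp
  have "Im z \<le> Im (inverse (?q (Suc n) * ?p (Suc n)))"
    unfolding inverse_product_eq[OF z] using 1 2 by simp
  also have "\<dots> \<le> cmod (inverse (?q (Suc n) * ?p (Suc n)))"
    using abs_Im_le_cmod[of "inverse (?q (Suc n) * ?p (Suc n))"] by linarith
  finally have "Im z \<le> inverse (cmod (?q (Suc n) * ?p (Suc n)))" unfolding norm_inverse .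
  moreover have "0 < cmod (?q (Suc n) * ?p (Suc n))" using nz by simp
  moreover have "P \<le> 1 / y" if "y \<le> inverse P" "0 < P" "0 < y" for P y :: real
    using that by (simp add: field_simps)
  ultimately show ?thesis using z by blast
qed

text \<open>
  The ratio of \<open>f_plus\<close> at \<open>n\<close> and \<open>n + 1\<close> is controlled by the next ratio through the difference
  equation, because \<open>f_plus_step_bound\<close> only bounds ratios in the direction of increasing index.
\<close>

lemma inverse_product_bound:
  assumes z: "0 < Im z"
  shows "cmod (inverse (f_plus a b (Suc n) z * f_minus a b (Suc n) z)) \<le> cmod z + M + 2 * ((M + 1)\<^sup>2 / Im z)"
proof -
  let ?q = "\<lambda>n. f_plus a b n z" and ?p = "\<lambda>n. f_minus a b n z"
  have nz: "?q (Suc n) \<noteq> 0" "?p (Suc n) \<noteq> 0" using f_plus_nonzero[OF z] f_minus_nonzero[OF z, of "Suc n"] by auto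
  have sq: "a k * a k / Im z \<le> (M + 1)\<^sup>2 / Im z" for k
    unfolding power2_eq_square using z a_le[of k] a_pos[of k] M_pos
    by (intro divide_right_mono mult_mono) auto
  have P: "cmod (of_real (a n) * (?p n / ?p (Suc n))) \<le> (M + 1)\<^sup>2 / Im z"
  proof -
    have "cmod (?p n) / cmod (?p (Suc n)) \<le> a n / Im z"
      using f_minus_step_bound[OF z, of n] nz z by (simp add: field_simps)
    then have "a n * (cmod (?p n) / cmod (?p (Suc n))) \<le> a n * (a n / Im z)"
      using a_pos[of n] by (intro mult_left_mono) auto
    then show ?thesis using sq[of n] a_pos[of n] by (simp add: norm_mult norm_divide)
  qed
  have Q: "cmod (of_real (a (Suc n)) * (?q (Suc (Suc n)) / ?q (Suc n))) \<le> (M + 1)\<^sup>2 / Im z"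
  proof -
    have "cmod (?q (Suc (Suc n))) / cmod (?q (Suc n)) \<le> a (Suc n) / Im z"
      using f_plus_step_bound[OF z, of "Suc n"] nz z by (simp add: field_simps)
    then have "a (Suc n) * (cmod (?q (Suc (Suc n))) / cmod (?q (Suc n))) \<le> a (Suc n) * (a (Suc n) / Im z)"
      using a_pos[of "Suc n"] by (intro mult_left_mono) auto
    then show ?thesis using sq[of "Suc n"] a_pos[of "Suc n"] by (simp add: norm_mult norm_divide)
  qed
  have "of_real (a n) * ?q n = (z - of_real (b (Suc n))) * ?q (Suc n) - of_real (a (Suc n)) * ?q (Suc (Suc n))"
    using solvesD[OF solves_f_plus[OF z], of n] by simp
  then have "of_real (a n) * (?q n / ?q (Suc n)) = z - of_real (b (Suc n)) - of_real (a (Suc n)) * (?q (Suc (Suc n)) / ?q (Suc n))"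
    using nz by (simp add: field_simps)
  then have "inverse (?q (Suc n) * ?p (Suc n)) = z - of_real (b (Suc n))
      - of_real (a (Suc n)) * (?q (Suc (Suc n)) / ?q (Suc n)) - of_real (a n) * (?p n / ?p (Suc n))"
    unfolding inverse_product_eq[OF z] by simp
  also have "cmod \<dots> \<le> cmod z + cmod (of_real (b (Suc n)) :: complex)
      + cmod (of_real (a (Suc n)) * (?q (Suc (Suc n)) / ?q (Suc n))) + cmod (of_real (a n) * (?p n / ?p (Suc n)))"
    by (intro order_trans[OF norm_triangle_ineq4] add_mono order_refl)
  also have "\<dots> \<le> cmod z + M + 2 * ((M + 1)\<^sup>2 / Im z)"
    using P Q b_bound[of "Suc n"] by simp
  finally show ?thesis .
qed

section \<open>Averages of logarithms of ratios\<close>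

abbreviation df_minus :: "nat \<Rightarrow> complex \<Rightarrow> complex" where
  "df_minus n z \<equiv> deriv (\<lambda>z. f_minus a b n z) z"

lemma f_minus_has_derivative:
  "((\<lambda>z. f_minus a b n z) has_field_derivative df_minus n z) (at z)"
proof -
  have "(\<lambda>z. f_minus a b n z) field_differentiable at z"
  proof (induction n rule: induct_nat_012)
    case (ge2 n)
    have "a (Suc n) \<noteq> 0" using a_pos[of "Suc n"] by simp
    moreover have "f_minus a b (Suc (Suc n)) = (\<lambda>z. ((z - of_real (b (Suc n))) * f_minus a b (Suc n) z
        - of_real (a n) * f_minus a b n z) / of_real (a (Suc n)))"
      by (simp add: f_minus_def fun_eq_iff)
    ultimately show ?case using ge2 by (auto intro!: derivative_intros)
  qed (simp_all add: f_minus_def)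
  then show ?thesis by (simp add: field_differentiable_derivI)
qed

lemma df_minus_initial: "df_minus 0 z = 0" "df_minus (Suc 0) z = 0"
  by (simp_all add: f_minus_def)

lemma df_minus_recurrence:
  "of_real (a (Suc n)) * df_minus (Suc (Suc n)) z =
    (z - of_real (b (Suc n))) * df_minus (Suc n) z + f_minus a b (Suc n) z - of_real (a n) * df_minus n z"
proof -
  have "((\<lambda>z. of_real (a (Suc n)) * f_minus a b (Suc (Suc n)) z) has_field_derivative
      of_real (a (Suc n)) * df_minus (Suc (Suc n)) z) (at z)"
    by (intro DERIV_cmult f_minus_has_derivative)
  moreover have "((\<lambda>z. (z - of_real (b (Suc n))) * f_minus a b (Suc n) z - of_real (a n) * f_minus a b n z) has_field_derivative
      (z - of_real (b (Suc n))) * df_minus (Suc n) z + f_minus a b (Suc n) z - of_real (a n) * df_minus n z) (at z)"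
    by (auto intro!: derivative_eq_intros f_minus_has_derivative)
  ultimately show ?thesis
    unfolding solvesD[OF solves_f_minus] by (rule DERIV_unique)
qed

text \<open>
  Differentiating the difference equation for \<open>f_minus\<close> in \<open>z\<close> adds the term \<open>f_minus\<close> itself, so
  the Wronskian of \<open>df_minus\<close> with any solution increases by \<open>f_minus * f\<close> at every site.
\<close>

lemma christoffel_darboux:
  assumes "solves z f"
  shows "(\<Sum>k=1..n. f_minus a b k z * f k) = of_real (a n) * (df_minus (Suc n) z * f n - df_minus n z * f (Suc n))"
proof (induction n)
  case 0
  show ?case by (simp add: df_minus_initial)
next
  case (Suc n)
  have "of_real (a (Suc n)) * (df_minus (Suc (Suc n)) z * f (Suc n) - df_minus (Suc n) z * f (Suc (Suc n)))
      = (of_real (a (Suc n)) * df_minus (Suc (Suc n)) z) * f (Suc n) - df_minus (Suc n) z * (of_real (a (Suc n)) * f (Suc (Suc n)))"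
    by (simp add: algebra_simps)
  also have "\<dots> = of_real (a n) * (df_minus (Suc n) z * f n - df_minus n z * f (Suc n)) + f_minus a b (Suc n) z * f (Suc n)"
    unfolding df_minus_recurrence solvesD[OF assms] by (simp add: algebra_simps)
  finally show ?case using Suc by simp
qed

text \<open>
  Apply \<open>christoffel_darboux\<close> both to \<open>f_plus\<close> and to \<open>f_minus\<close> and eliminate \<open>df_minus n\<close>. With
  Wronskian one, what remains besides the logarithmic derivative is the sum of the squares of
  \<open>f_minus\<close> times the ratio of \<open>f_plus\<close> to \<open>f_minus\<close> at \<open>n + 1\<close>. The sum of the squared moduli is a
  flux, hence at most a constant times \<open>|f_minus (n + 1)| * |f_minus n|\<close>; after cancellation only the
  product of \<open>f_plus\<close> and \<open>f_minus\<close> at \<open>n + 1\<close> is left, which is bounded.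
\<close>

lemma green_sum_log_derivative:
  assumes z: "0 < Im z"
  shows "cmod ((\<Sum>k=1..n. green_diag a b k z) + df_minus (Suc n) z / f_minus a b (Suc n) z) \<le> (M + 1)\<^sup>2 / (Im z) ^ 3"
proof -
  let ?p = "\<lambda>n. f_minus a b n z" and ?q = "\<lambda>n. f_plus a b n z" and ?d = "\<lambda>n. df_minus n z"
  define y where "y = Im z"
  have y: "0 < y" using z by (simp add: y_def)
  have nz: "?p (Suc n) \<noteq> 0" using f_minus_nonzero[OF z, of "Suc n"] by simp
  have green: "(\<Sum>k=1..n. green_diag a b k z) = - (\<Sum>k=1..n. ?p k * ?q k)"
    by (simp add: green_diag_eq[OF z] sum_negf)
  have pq: "(\<Sum>k=1..n. ?p k * ?q k) = of_real (a n) * (?d (Suc n) * ?q n - ?d n * ?q (Suc n))"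
    by (rule christoffel_darboux[OF solves_f_plus[OF z]])
  have pp: "(\<Sum>k=1..n. ?p k * ?p k) = of_real (a n) * (?d (Suc n) * ?p n - ?d n * ?p (Suc n))"
    by (rule christoffel_darboux[OF solves_f_minus])
  have "?p (Suc n) * (\<Sum>k=1..n. ?p k * ?q k) - ?q (Suc n) * (\<Sum>k=1..n. ?p k * ?p k)
      = ?d (Suc n) * (of_real (a n) * (?q n * ?p (Suc n) - ?q (Suc n) * ?p n))"
    unfolding pq pp by (simp add: algebra_simps)
  then have "?p (Suc n) * (\<Sum>k=1..n. ?p k * ?q k) = ?d (Suc n) + ?q (Suc n) * (\<Sum>k=1..n. ?p k * ?p k)"
    unfolding wronskian_f_plus[OF z] by (simp add: algebra_simps)
  then have "(\<Sum>k=1..n. ?p k * ?q k) = ?d (Suc n) / ?p (Suc n) + ?q (Suc n) * (\<Sum>k=1..n. ?p k * ?p k) / ?p (Suc n)"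
    using nz by (simp add: field_simps)
  then have "cmod ((\<Sum>k=1..n. green_diag a b k z) + ?d (Suc n) / ?p (Suc n))
      = cmod (?q (Suc n)) * cmod (\<Sum>k=1..n. ?p k * ?p k) / cmod (?p (Suc n))"
    unfolding green by (simp add: norm_mult norm_divide)
  also have "cmod (\<Sum>k=1..n. ?p k * ?p k) \<le> (\<Sum>k=1..n. (cmod (?p k))\<^sup>2)"
    by (intro sum_norm_le) (simp add: norm_mult power2_eq_square)
  also have "\<dots> = flux ?p n / y" using y by (simp add: flux_f_minus y_def)
  also have "\<dots> \<le> a n * (cmod (?p (Suc n)) * cmod (?p n)) / y"
    using abs_flux_le[of ?p n] y by (intro divide_right_mono) auto
  finally have "cmod ((\<Sum>k=1..n. green_diag a b k z) + ?d (Suc n) / ?p (Suc n))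
      \<le> cmod (?q (Suc n)) * (a n * (cmod (?p (Suc n)) * cmod (?p n)) / y) / cmod (?p (Suc n))"
    by (simp add: mult_left_mono divide_right_mono)
  also have "\<dots> = cmod (?q (Suc n)) * a n * cmod (?p n) / y" using nz by simp
  also have "\<dots> \<le> cmod (?q (Suc n)) * a n * (a n * cmod (?p (Suc n)) / y) / y"
  proof (intro divide_right_mono mult_left_mono)
    show "cmod (?p n) \<le> a n * cmod (?p (Suc n)) / y"
      using f_minus_step_bound[OF z, of n] y by (simp add: y_def pos_le_divide_eq mult.commute)
  qed (use y a_pos[of n] in auto)
  also have "\<dots> = (a n)\<^sup>2 * cmod (?q (Suc n) * ?p (Suc n)) / y\<^sup>2" by (simp add: norm_mult power2_eq_square)
  also have "\<dots> \<le> (M + 1)\<^sup>2 * (1 / y) / y\<^sup>2"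
    using product_upper_bound[OF z, of n] a_le[of n] a_pos[of n] y
    by (intro divide_right_mono mult_mono power_mono) (auto simp: y_def)
  also have "\<dots> = (M + 1)\<^sup>2 / y ^ 3" by (simp add: power2_eq_square power3_eq_cube)
  finally show ?thesis by (simp add: y_def)
qed

lemma Re_Ln_ratio:
  assumes "u \<noteq> 0" "v \<noteq> 0"
  shows "Re (Ln (u / v)) = ln (cmod u) - ln (cmod v)" "Re (Ln (- (u / v))) = ln (cmod u) - ln (cmod v)"
  using assms by (simp_all add: norm_divide ln_div)

lemma Re_w_minus_avg:
  assumes z: "0 < Im z"
  shows "Re (w_minus_avg a b n z) = ln (cmod (f_minus a b (Suc n) z)) / real n"
proof -
  let ?l = "\<lambda>k. ln (cmod (f_minus a b k z))"
  have "Re (w_minus_avg a b n z) = (\<Sum>k=1..n. Re (Ln (f_minus a b (k + 1) z / f_minus a b k z))) / real n"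
    by (simp add: w_minus_avg_def Re_divide_of_nat)
  also have "(\<Sum>k=1..n. Re (Ln (f_minus a b (k + 1) z / f_minus a b k z))) = (\<Sum>k=1..n. ?l (Suc k) - ?l k)"
    unfolding Suc_eq_plus1 by (intro sum.cong refl Re_Ln_ratio f_minus_nonzero z) auto
  also have "\<dots> = ?l (Suc n) - ?l 1" by (rule sum_Suc_diff) simp
  finally show ?thesis by (simp add: f_minus_simps)
qed

lemma Re_w_plus_avg:
  assumes z: "0 < Im z"
  shows "Re (w_plus_avg a b n z) = (ln (cmod (f_plus a b (Suc n) z)) - ln (cmod (f_plus a b 1 z))) / real n"
proof -
  let ?l = "\<lambda>k. ln (cmod (f_plus a b k z))"
  have "Re (w_plus_avg a b n z) = (\<Sum>k=1..n. Re (Ln (- (f_plus a b (k + 1) z / f_plus a b k z)))) / real n"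
    by (simp add: w_plus_avg_def Re_divide_of_nat)
  also have "(\<Sum>k=1..n. Re (Ln (- (f_plus a b (k + 1) z / f_plus a b k z)))) = (\<Sum>k=1..n. ?l (Suc k) - ?l k)"
    unfolding Suc_eq_plus1 by (intro sum.cong refl Re_Ln_ratio f_plus_nonzero z)
  also have "\<dots> = ?l (Suc n) - ?l 1" by (rule sum_Suc_diff) simp
  finally show ?thesis by simp
qed

text \<open>
  Both real parts telescope, and their sum is \<open>1/n\<close> times the logarithm of a product that stays
  between two positive constants.
\<close>

lemma Re_w_sum_tendsto_zero:
  assumes z: "0 < Im z"
  shows "(\<lambda>n. Re (w_plus_avg a b n z) + Re (w_minus_avg a b n z)) \<longlonglongrightarrow> 0"
proof -
  define K where "K = cmod z + M + 2 * ((M + 1)\<^sup>2 / Im z)"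
  define B where "B = \<bar>ln (1 / Im z)\<bar> + \<bar>ln K\<bar> + \<bar>ln (cmod (f_plus a b 1 z))\<bar>"
  have "\<bar>Re (w_plus_avg a b n z) + Re (w_minus_avg a b n z)\<bar> \<le> B / real n" for n
  proof -
    let ?P = "cmod (f_plus a b (Suc n) z * f_minus a b (Suc n) z)"
    have nz: "f_plus a b (Suc n) z \<noteq> 0" "f_minus a b (Suc n) z \<noteq> 0"
      using f_plus_nonzero[OF z, of "Suc n"] f_minus_nonzero[OF z, of "Suc n"] by auto
    then have P: "0 < ?P" by simp
    have up: "ln ?P \<le> ln (1 / Im z)" using product_upper_bound[OF z, of n] P by (intro ln_mono) auto
    have "inverse ?P \<le> K" using inverse_product_bound[OF z, of n] unfolding K_def norm_inverse .
    then have "ln (inverse ?P) \<le> ln K" using P by (intro ln_mono) auto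
    then have low: "- ln K \<le> ln ?P" using P by (simp add: ln_inverse)
    have "ln ?P = ln (cmod (f_plus a b (Suc n) z)) + ln (cmod (f_minus a b (Suc n) z))"
      using nz by (simp add: norm_mult ln_mult)
    then have "Re (w_plus_avg a b n z) + Re (w_minus_avg a b n z) = (ln ?P - ln (cmod (f_plus a b 1 z))) / real n"
      unfolding Re_w_plus_avg[OF z] Re_w_minus_avg[OF z] by (simp add: add_divide_distrib diff_divide_distrib)
    moreover have "\<bar>ln ?P - ln (cmod (f_plus a b 1 z))\<bar> \<le> B" using up low unfolding B_def by linarith
    ultimately show ?thesis by (simp add: abs_divide divide_right_mono)
  qed
  moreover have "(\<lambda>n. B / real n) \<longlonglongrightarrow> 0" by (rule lim_const_over_n)
  ultimately show ?thesis by (rule_tac Lim_null_comparison) auto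
qed

lemma w_minus_avg_has_derivative:
  assumes z: "0 < Im z"
  shows "((\<lambda>z. w_minus_avg a b n z) has_field_derivative
      (df_minus (Suc n) z / f_minus a b (Suc n) z) / of_nat n) (at z)"
proof -
  let ?r = "\<lambda>k. df_minus k z / f_minus a b k z"
  have "((\<lambda>z. Ln (f_minus a b (k + 1) z / f_minus a b k z)) has_field_derivative ?r (Suc k) - ?r k) (at z)"
    if k: "k \<in> {1..n}" for k
  proof -
    have k1: "1 \<le> k" using k by simp
    have nz: "f_minus a b k z \<noteq> 0" "f_minus a b (Suc k) z \<noteq> 0"
      using f_minus_nonzero[OF z, of k] f_minus_nonzero[OF z, of "Suc k"] k1 by auto
    have "f_minus a b (Suc k) z / f_minus a b k z \<notin> \<real>\<^sub>\<le>\<^sub>0"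
      using Im_f_minus_ratio_pos[OF z k1] by (auto simp: complex_nonpos_Reals_iff)
    then have "((\<lambda>z. Ln (f_minus a b (Suc k) z / f_minus a b k z)) has_field_derivative
        inverse (f_minus a b (Suc k) z / f_minus a b k z) *
        ((df_minus (Suc k) z * f_minus a b k z - f_minus a b (Suc k) z * df_minus k z) / (f_minus a b k z * f_minus a b k z))) (at z)"
      by (rule DERIV_chain2[OF has_field_derivative_Ln DERIV_divide[OF f_minus_has_derivative f_minus_has_derivative nz(1)]])
    moreover have "inverse (f_minus a b (Suc k) z / f_minus a b k z) *
        ((df_minus (Suc k) z * f_minus a b k z - f_minus a b (Suc k) z * df_minus k z) / (f_minus a b k z * f_minus a b k z)) = ?r (Suc k) - ?r k"
      using nz by (simp add: field_simps)
    ultimately show ?thesis by simp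
  qed
  then have "((\<lambda>z. 1 / of_nat n * (\<Sum>k=1..n. Ln (f_minus a b (k + 1) z / f_minus a b k z))) has_field_derivative
      1 / of_nat n * (\<Sum>k=1..n. ?r (Suc k) - ?r k)) (at z)"
    by (intro DERIV_cmult DERIV_sum)
  moreover have "(\<Sum>k=1..n. ?r (Suc k) - ?r k) = ?r (Suc n) - ?r 1" by (rule sum_Suc_diff) simp
  ultimately show ?thesis by (simp add: w_minus_avg_def[abs_def] df_minus_initial)
qed

lemma log_derivative_plus_g_avg_tendsto_zero:
  assumes z: "0 < Im z"
  shows "(\<lambda>n. (df_minus (Suc n) z / f_minus a b (Suc n) z) / of_nat n + g_avg a b n z) \<longlonglongrightarrow> 0"
proof -
  let ?B = "(M + 1)\<^sup>2 / (Im z) ^ 3"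
  have "norm ((df_minus (Suc n) z / f_minus a b (Suc n) z) / of_nat n + g_avg a b n z) \<le> ?B / real n" for n
  proof -
    have "(df_minus (Suc n) z / f_minus a b (Suc n) z) / of_nat n + g_avg a b n z
        = ((\<Sum>k=1..n. green_diag a b k z) + df_minus (Suc n) z / f_minus a b (Suc n) z) / of_nat n"
      by (simp add: g_avg_def add_divide_distrib)
    then show ?thesis
      using green_sum_log_derivative[OF z, of n] by (simp only: norm_divide norm_of_nat divide_right_mono of_nat_0_le_iff)
  qed
  moreover have "(\<lambda>n. ?B / real n) \<longlonglongrightarrow> 0" by (rule lim_const_over_n)
  ultimately show ?thesis by (rule_tac Lim_null_comparison) auto
qed

lemma abs_Im_w_plus_avg_le:
  assumes z: "0 < Im z"
  shows "\<bar>Im (w_plus_avg a b n z)\<bar> \<le> pi"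
proof -
  have "Im (w_plus_avg a b n z) = (\<Sum>k=1..n. Im (Ln (- (f_plus a b (k + 1) z / f_plus a b k z)))) / real n"
    by (simp add: w_plus_avg_def Im_divide_of_nat)
  moreover have "\<bar>\<Sum>k=1..n. Im (Ln (- (f_plus a b (k + 1) z / f_plus a b k z)))\<bar> \<le> (\<Sum>k=1..n. pi)"
  proof (rule order_trans[OF sum_abs sum_mono])
    fix k
    have nz: "- (f_plus a b (k + 1) z / f_plus a b k z) \<noteq> 0" using f_plus_nonzero[OF z] by simp
    show "\<bar>Im (Ln (- (f_plus a b (k + 1) z / f_plus a b k z)))\<bar> \<le> pi"
      using mpi_less_Im_Ln[OF nz] Im_Ln_le_pi[OF nz] by linarith
  qed
  ultimately show ?thesis by (cases "n = 0") (simp_all add: abs_divide pos_divide_le_eq mult.commute)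
qed

end

section \<open>The derivative of the limit function\<close>

text \<open>
  The real part of \<open>D\<close> is the derivative in the direction one, and that of \<open>\<i> * D\<close> the derivative in the
  direction \<open>\<i>\<close>.
\<close>

lemma derivative_zero_of_Re_zero:
  fixes h :: "complex \<Rightarrow> complex"
  assumes S: "open S" "z \<in> S" and zero: "\<And>u. u \<in> S \<Longrightarrow> Re (h u) = 0"
    and der: "(h has_field_derivative D) (at z)"
  shows "D = 0"
proof -
  have "Re (c * D) = 0" for c
  proof -
    have "((\<lambda>t. z + of_real t * c) has_vector_derivative c) (at 0)"
      by (auto intro!: derivative_eq_intros)
    from field_vector_diff_chain_at[OF this, of h D] der
    have "((\<lambda>t. h (z + of_real t * c)) has_vector_derivative c * D) (at 0)" by (simp add: o_def)
    then have d: "((\<lambda>t. Re (h (z + of_real t * c))) has_real_derivative Re (c * D)) (at 0)"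
      by (simp add: has_vector_derivative_complex_iff)
    have "isCont (\<lambda>t::real. z + of_real t * c) 0" by (intro continuous_intros)
    then have "((\<lambda>t::real. z + of_real t * c) \<longlongrightarrow> z) (at 0)" unfolding isCont_def by simp
    from topological_tendstoD[OF this S] have ev: "eventually (\<lambda>t::real. z + of_real t * c \<in> S) (at 0)" .
    then obtain \<delta> where \<delta>: "\<delta> > 0" "\<And>t. t \<noteq> 0 \<Longrightarrow> dist t 0 < \<delta> \<Longrightarrow> z + of_real t * c \<in> S"
      unfolding eventually_at by auto
    have "((\<lambda>t. 0) has_real_derivative Re (c * D)) (at 0)"
    proof (rule has_field_derivative_transform_within_open[OF d])
      show "open (ball (0::real) \<delta>)" "0 \<in> ball (0::real) \<delta>" using \<delta>(1) by auto
      show "Re (h (z + of_real t * c)) = 0" if "t \<in> ball 0 \<delta>" for t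
        using \<delta>(2)[of t] that S(2) by (cases "t = 0") (auto intro!: zero simp: dist_commute)
    qed
    then show ?thesis by (rule DERIV_unique) (rule DERIV_const)
  qed
  from this[of 1] this[of \<i>] show ?thesis by (simp add: complex_eq_iff)
qed

lemma compactly_convergesD:
  assumes "compactly_converges F G" "0 < Im z"
  shows "(\<lambda>j. F j z) \<longlonglongrightarrow> G z"
proof -
  have "compact {z}" "{z} \<subseteq> upper_half_plane" using assms(2) by simp_all
  then have "uniform_limit {z} F G sequentially"
    using assms(1) unfolding compactly_converges_def by blast
  then show ?thesis by (rule tendsto_uniform_limitI) simp
qed

text \<open>
  The derivatives of the averages of \<open>w_minus\<close> converge to \<open>w_minus'\<close> by Weierstrass and to \<open>- g\<close> by
  \<open>green_sum_log_derivative\<close>; the sum of \<open>w_plus\<close> and \<open>w_minus\<close> has vanishing real part.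
\<close>

lemma (in jacobi_coefficients) w_plus_has_derivative_g:
  fixes N :: "nat \<Rightarrow> nat"
  assumes N: "filterlim N at_top sequentially"
    and wp: "compactly_converges (\<lambda>j. w_plus_avg a b (N j)) w_plus" "herglotz w_plus"
    and wm: "compactly_converges (\<lambda>j. w_minus_avg a b (N j)) w_minus"
    and g: "compactly_converges (\<lambda>j. g_avg a b (N j)) g"
    and z: "0 < Im z"
  shows "(w_plus has_field_derivative g z) (at z)"
proof -
  have opn: "open upper_half_plane" by (rule open_halfspace_Im_gt)
  let ?f' = "\<lambda>j z. (df_minus (Suc (N j)) z / f_minus a b (Suc (N j)) z) / of_nat (N j)"
  have "\<exists>g'. \<forall>x\<in>upper_half_plane. (w_minus has_field_derivative g' x) (at x) \<and> ((\<lambda>j. ?f' j x) \<longlonglongrightarrow> g' x)"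
  proof (rule has_complex_derivative_uniform_sequence[OF opn])
    show "((\<lambda>z. w_minus_avg a b (N j) z) has_field_derivative ?f' j x) (at x)" if "x \<in> upper_half_plane" for j x
      using that by (intro w_minus_avg_has_derivative) simp
    fix x assume "x \<in> upper_half_plane"
    with opn have "\<exists>d>0. cball x d \<subseteq> upper_half_plane" unfolding open_contains_cball by (rule bspec)
    then obtain d where d: "0 < d" "cball x d \<subseteq> upper_half_plane" by (elim exE conjE)
    then have "uniform_limit (cball x d) (\<lambda>j. w_minus_avg a b (N j)) w_minus sequentially"
      using wm unfolding compactly_converges_def by simp
    with d show "\<exists>d>0. cball x d \<subseteq> upper_half_plane \<and> uniform_limit (cball x d) (\<lambda>j. w_minus_avg a b (N j)) w_minus sequentially"
      by (intro exI[of _ d] conjI)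
  qed
  then obtain g' where g': "\<And>x. 0 < Im x \<Longrightarrow> (\<lambda>j. ?f' j x) \<longlonglongrightarrow> g' x"
    "\<And>x. 0 < Im x \<Longrightarrow> (w_minus has_field_derivative g' x) (at x)" by auto
  have sum: "(\<lambda>j. ?f' j z + g_avg a b (N j) z) \<longlonglongrightarrow> 0"
    using filterlim_compose[OF log_derivative_plus_g_avg_tendsto_zero[OF z] N] .
  have "(\<lambda>j. ?f' j z + g_avg a b (N j) z) \<longlonglongrightarrow> g' z + g z"
    by (intro tendsto_add g' z compactly_convergesD[OF g])
  from LIMSEQ_unique[OF sum this] have g'_eq: "g' z = - g z" by (simp add: eq_neg_iff_add_eq_0)
  have hol: "w_plus holomorphic_on upper_half_plane" using wp(2) by (simp add: herglotz_def)
  then have dp: "(w_plus has_field_derivative deriv w_plus z) (at z)"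
    using z by (intro holomorphic_derivI[OF _ opn]) auto
  have "deriv w_plus z + g' z = 0"
  proof (rule derivative_zero_of_Re_zero[OF opn])
    show "z \<in> upper_half_plane" using z by simp
    show "((\<lambda>u. w_plus u + w_minus u) has_field_derivative deriv w_plus z + g' z) (at z)"
      by (intro DERIV_add dp g' z)
    fix u assume "u \<in> upper_half_plane"
    then have u: "0 < Im u" by simp
    have 1: "(\<lambda>j. Re (w_plus_avg a b (N j) u) + Re (w_minus_avg a b (N j) u)) \<longlonglongrightarrow> 0"
      using filterlim_compose[OF Re_w_sum_tendsto_zero[OF u] N] .
    have "(\<lambda>j. Re (w_plus_avg a b (N j) u) + Re (w_minus_avg a b (N j) u)) \<longlonglongrightarrow> Re (w_plus u) + Re (w_minus u)"
      by (intro tendsto_intros compactly_convergesD[OF wp(1) u] compactly_convergesD[OF wm u])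
    from LIMSEQ_unique[OF 1 this] show "Re (w_plus u + w_minus u) = 0" by simp
  qed
  then have "deriv w_plus z = g z" using g'_eq by simp
  then show ?thesis using dp by simp
qed

lemma (in jacobi_coefficients) abs_Im_w_plus_le:
  assumes wp: "compactly_converges (\<lambda>j. w_plus_avg a b (N j)) w_plus" and z: "0 < Im z"
  shows "\<bar>Im (w_plus z)\<bar> \<le> pi"
proof (rule tendsto_upperbound)
  show "(\<lambda>j. \<bar>Im (w_plus_avg a b (N j) z)\<bar>) \<longlonglongrightarrow> \<bar>Im (w_plus z)\<bar>"
    by (intro tendsto_intros compactly_convergesD[OF wp z])
  show "\<forall>\<^sub>F j in sequentially. \<bar>Im (w_plus_avg a b (N j) z)\<bar> \<le> pi"
    by (intro always_eventually allI abs_Im_w_plus_avg_le z)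
qed simp

section \<open>Approximate differentiability of the Lyapunov exponent\<close>

theorem theorem1p4:
  fixes a b :: "nat \<Rightarrow> real"
    and E :: "real \<Rightarrow> (nat \<Rightarrow> complex) \<Rightarrow> nat \<Rightarrow> complex"
    and N :: "nat \<Rightarrow> nat"
    and w_plus w_minus g :: "complex \<Rightarrow> complex"
    and \<nu> \<kappa> :: "real measure"
    and A :: real
  assumes "bounded_jacobi a b" and "a 0 = 1"
    and "spectral_resolution a b E"
    and "filterlim N at_top sequentially"
    and "compactly_converges (\<lambda>j. w_plus_avg a b (N j)) w_plus" and "herglotz w_plus"
    and "compactly_converges (\<lambda>j. w_minus_avg a b (N j)) w_minus" and "herglotz w_minus"
    and "compactly_converges (\<lambda>j. g_avg a b (N j)) g" and "herglotz g"
    and "weak_star_converges (\<lambda>j. nu_avg E (N j)) \<nu>" and "real_distribution \<nu>"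
    and "weak_star_converges (\<lambda>j. dk_avg a b (N j)) \<kappa>" and "real_distribution \<kappa>"
    and "(\<lambda>j. (\<Prod>n=1..N j. a n) powr (1 / real (N j))) \<longlonglongrightarrow> A" and "A > 0"
  shows "(AE x in lebesgue.
            has_approx_derivative (lyapunov_exponent w_plus) (- Re (boundary_value g x)) x) \<and>
         (AE x in lebesgue. approx_differentiable (lyapunov_exponent w_plus) x)"
proof -
  obtain M where "0 < M" "\<And>n. 1 \<le> n \<Longrightarrow> inverse (M + 1) \<le> a n \<and> a n \<le> M + 1 \<and> \<bar>b n\<bar> \<le> M"
    using \<open>bounded_jacobi a b\<close> unfolding bounded_jacobi_def by blast
  then interpret jacobi_coefficients a b M
    using \<open>a 0 = 1\<close> by unfold_locales auto
  have main: "AE x in lebesgue.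
      has_approx_derivative (lyapunov_exponent w_plus) (- Re (boundary_value g x)) x"
    unfolding lyapunov_exponent_def
  proof (rule approx_derivative_boundary_real_part)
    show "(w_plus has_field_derivative g z) (at z)" if "0 < Im z" for z
      using assms(4,5,6,7,9) that by (rule w_plus_has_derivative_g)
    show "\<bar>Im (w_plus z)\<bar> \<le> pi" if "0 < Im z" for z
      using assms(5) that by (rule abs_Im_w_plus_le)
  qed fact
  moreover from main have "AE x in lebesgue. approx_differentiable (lyapunov_exponent w_plus) x"
    by (rule eventually_mono) (auto simp: approx_differentiable_def)
  ultimately show ?thesis ..
qed

end
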